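(* Let $n>2$ be an integer. All the maximal cones of the fan $\overline{\mathcal Z_{2,n}}$ are simplicial of dimension $n-3$, and they are of the form $$\mathcal P_W:=\Big\{\sum_{J\in W}c_J\beta_J: c_J\in\mathbb R_{\ge0}\Big\}$$ for some nonfrozen maximal $w$-collection $W\subseteq\binom{[n]}{2}$.
   Context: $[n]=\{1,\dots,n\}$ with its cyclic order; $\binom{[n]}{2}$ is the set of 2-subsets; $e_I=\sum_{i\in I}e_i$; $\Delta_{2,n}=\mathrm{Conv}\{e_I:I\in\binom{[n]}{2}\}$. Two 2-sets $I,J$ are weakly separated if there are no cyclically ordered $a,b,c,d$ with $a,c\in I\setminus J$ and $b,d\in J\setminus I$. A $w$-collection is a collection of pairwise weakly separated 2-sets. A 2-set is frozen if it is a cyclic interval of $[n]$ and nonfrozen otherwise. A nonfrozen maximal $w$-collection is the set of nonfrozen members of an inclusion-maximal $w$-collection in $\binom{[n]}{2}$. $\mathfrak B_{2,n}$ is the real vector space with basis the formal symbols $\beta_J$, $J\in\binom{[n]}{2}$. Geometrically, $\beta_J$ is the translate to $e_J$ of the standard blade, which is the union of the boundaries of the $n$ cones $\{x:\sum_i x_i=0,\ x_j\ge0,\ x_j+x_{j+1}\ge0,\dots,x_j+\dots+x_{j-2}\ge0\}$, $j\in[n]$ (indices mod $n$); it subdivides $\Delta_{2,n}$ into the intersections of $\Delta_{2,n}$ with the translated cones. A set of blades induces the common refinement. A positroid subdivision is a polyhedral subdivision all of whose cells are positroid polytopes, i.e. polytopes $\mathrm{Conv}\{e_J:J\in\mathcal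 M\}$, where $\mathcal M$ is the set of indices of nonzero maximal minors of a full-rank real matrix with all maximal minors nonnegative. $\mathcal Z_{2,n}$ is the set of $z=\sum_J c_J\beta_J\in\mathfrak B_{2,n}$ such that (1) the blades $\{\beta_J:c_J\ne0\}$ induce a positroid subdivision of $\Delta_{2,n}$ (equivalently, the sets $J$ with $c_J\ne0$ are pairwise weakly separated), and (2) $c_J\ge0$ for every nonfrozen $J$. Let $\mathcal F_{2,n}=\mathrm{span}\{\beta_I:I\text{ frozen}\}$ and $\overline{\mathcal Z_{2,n}}=\mathcal Z_{2,n}/\mathcal F_{2,n}$, whose elements are uniquely written as combinations of nonfrozen $\beta_J$. Fan structure: the positive tropical Grassmannian $\mathrm{Trop}^+Gr_{2,n}$ is the set of $p\in\mathbb R^{\binom{[n]}{2}}$ with $p_{ac}+p_{bd}=\min\{p_{ab}+p_{cd},p_{bc}+p_{ad}\}$ for all $a<b<c<d$. It carries the secondary fan structure, where $p,p'$ lie in the relative interior of the same cone iff they induce, as height functions (lifting $e_I$ to height $p_I$ and projecting lower faces), the same regular subdivision of $\Delta_{2,n}$. The fan structure on $\overline{\mathcal Z_{2,n}}$ is the one transported from this, modulo lineality, by $p\mapsto\sum_I p_I\mathcal L_I$ modulo $\mathcal F_{2,n}$. Here $\mathcal L_J=\sum_{M\subseteq J^\bullet}(-1)^{1+|M|}\beta_{J_M}$, $J^\bullet$ is the set of initial elements of the maximal cyclic intervals of $J$, and $J_M$ is obtained from $J$ by replacing each $j\in M$ by $j-1$ (mod $n$). Equivalently, the class of $\sum_J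 c_J\beta_J$ corresponds, up to a positive scalar and lineality, to the height function $I\mapsto\sum_J c_J\,d(e_J,e_I)$, where $d(e_J,e_I)$ is the least number of steps from $e_J$ to $e_I$ with each step in $\{e_1-e_2,\dots,e_n-e_1\}$. *)

theory Defs
  imports "HOL-Analysis.Analysis"
begin

text \<open>
  The ground set \<open>[n]\<close> is a finite linearly ordered type \<open>'n\<close> with \<open>n = CARD('n)\<close>, and
  its cyclic order is the one induced by the linear order. Vectors indexed by
  2-subsets are vectors over the finite type \<open>'n set\<close> supported on sets of cardinality 2.
\<close>

subsection \<open>Cyclic order, 2-sets and weak separation\<close>

definition csuc :: "'n::{finite,linorder} \<Rightarrow> 'n" where
  "csuc i = (if \<exists>j. i < j then Min {j. i < j} else Min UNIV)"

definition cpred :: "'n::{finite,linorder} \<Rightarrow> 'n" where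
  "cpred i = (if \<exists>j. j < i then Max {j. j < i} else Max UNIV)"

definition cyclically_ordered :: "'n::{finite,linorder} \<Rightarrow> 'n \<Rightarrow> 'n \<Rightarrow> 'n \<Rightarrow> bool" where
  "cyclically_ordered a b c d \<longleftrightarrow>
     (a < b \<and> b < c \<and> c < d) \<or> (b < c \<and> c < d \<and> d < a) \<or>
     (c < d \<and> d < a \<and> a < b) \<or> (d < a \<and> a < b \<and> b < c)"

definition two_sets :: "'n::{finite,linorder} set set" where
  "two_sets = {I. card I = 2}"

definition weakly_separated :: "'n::{finite,linorder} set \<Rightarrow> 'n set \<Rightarrow> bool" where
  "weakly_separated I J \<longleftrightarrow>
     \<not> (\<exists>a b c d. cyclically_ordered a b c d \<and> a \<in> I - J \<and> c \<in> I - J \<and> b \<in> J - I \<and> d \<in> J - I)"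

definition w_collection :: "'n::{finite,linorder} set set \<Rightarrow> bool" where
  "w_collection W \<longleftrightarrow> W \<subseteq> two_sets \<and> (\<forall>I\<in>W. \<forall>J\<in>W. weakly_separated I J)"

definition maximal_w_collection :: "'n::{finite,linorder} set set \<Rightarrow> bool" where
  "maximal_w_collection W \<longleftrightarrow>
     w_collection W \<and> (\<forall>W'. w_collection W' \<and> W \<subseteq> W' \<longrightarrow> W' = W)"

definition cyclic_interval :: "'n::{finite,linorder} set \<Rightarrow> bool" where
  "cyclic_interval I \<longleftrightarrow> (\<exists>i m. I = (\<lambda>t. (csuc ^^ t) i) ` {..<m})"

definition frozen_sets :: "'n::{finite,linorder} set set" where
  "frozen_sets = {I \<in> two_sets. cyclic_interval I}"

definition nonfrozen_sets :: "'n::{finite,linorder} set set" where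
  "nonfrozen_sets = two_sets - frozen_sets"

definition nonfrozen_maximal_w_collection :: "'n::{finite,linorder} set set \<Rightarrow> bool" where
  "nonfrozen_maximal_w_collection W \<longleftrightarrow>
     (\<exists>W'. maximal_w_collection W' \<and> W = W' \<inter> nonfrozen_sets)"

subsection \<open>Hypersimplex and positroid polytopes\<close>

definition e_vec :: "'n::{finite,linorder} set \<Rightarrow> real^'n::{finite,linorder}" where
  "e_vec I = (\<Sum>i\<in>I. axis i 1)"

definition hypersimplex :: "(real^'n::{finite,linorder}) set" where
  "hypersimplex = convex hull (e_vec ` two_sets)"

definition minor2 :: "real^'n::{finite,linorder}^2 \<Rightarrow> 'n set \<Rightarrow> real" where
  "minor2 A I = det (\<chi> r s. A $ r $ (if s = 1 then Min I else Max I) :: real^2^2)"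

definition positroid :: "'n::{finite,linorder} set set \<Rightarrow> bool" where
  "positroid M \<longleftrightarrow> (\<exists>A::real^'n::{finite,linorder}^2. rank A = 2 \<and> (\<forall>I\<in>two_sets. minor2 A I \<ge> 0) \<and>
     M = {I \<in> two_sets. minor2 A I \<noteq> 0})"

definition positroid_polytope :: "(real^'n::{finite,linorder}) set \<Rightarrow> bool" where
  "positroid_polytope P \<longleftrightarrow> (\<exists>M. positroid M \<and> P = convex hull (e_vec ` M))"

definition polyhedral_subdivision :: "'a::euclidean_space set set \<Rightarrow> 'a set \<Rightarrow> bool" where
  "polyhedral_subdivision \<C> P \<longleftrightarrow>
     finite \<C> \<and> (\<forall>C\<in>\<C>. polytope C \<and> C \<noteq> {}) \<and>
     (\<forall>C\<in>\<C>. \<forall>F. F face_of C \<and> F \<noteq> {} \<longrightarrow> F \<in> \<C>) \<and>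
     (\<forall>C\<in>\<C>. \<forall>D\<in>\<C>. C \<inter> D face_of C \<and> C \<inter> D face_of D) \<and>
     \<Union>\<C> = P"

definition positroid_subdivision :: "(real^'n::{finite,linorder}) set set \<Rightarrow> bool" where
  "positroid_subdivision \<C> \<longleftrightarrow>
     polyhedral_subdivision \<C> hypersimplex \<and> (\<forall>C\<in>\<C>. positroid_polytope C)"

subsection \<open>Blades\<close>

definition blade_cone :: "'n::{finite,linorder} \<Rightarrow> (real^'n::{finite,linorder}) set" where
  "blade_cone j = {x. (\<Sum>i\<in>UNIV. x $ i) = 0 \<and>
     (\<forall>m\<in>{1..CARD('n) - 1}. (\<Sum>t<m. x $ ((csuc ^^ t) j)) \<ge> 0)}"

text \<open>
  The common refinement of the subdivisions of the hypersimplex induced by the blades at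
  \<open>e_vec J\<close> for \<open>J \<in> S\<close>. Choosing one translated cone, with index \<open>f J\<close>, for every blade
  gives an intersection; the cells are all nonempty faces of these intersections.
\<close>
definition blade_subdivision :: "'n::{finite,linorder} set set \<Rightarrow> (real^'n::{finite,linorder}) set set" where
  "blade_subdivision S =
     {F. F \<noteq> {} \<and> (\<exists>f. F face_of (hypersimplex \<inter> (\<Inter>J\<in>S. (+) (e_vec J) ` blade_cone (f J))))}"

definition beta :: "'n::{finite,linorder} set \<Rightarrow> real^('n set)" where
  "beta J = axis J 1"

definition blade_space :: "(real^('n::{finite,linorder} set)) set" where
  "blade_space = span (beta ` two_sets)"

definition frozen_space :: "(real^('n::{finite,linorder} set)) set" where
  "frozen_space = span (beta ` frozen_sets)"

definition Z_set :: "(real^('n::{finite,linorder} set)) set" where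
  "Z_set = {z \<in> blade_space. positroid_subdivision (blade_subdivision {J. z $ J \<noteq> 0}) \<and>
     (\<forall>J\<in>nonfrozen_sets. z $ J \<ge> 0)}"

text \<open>
  The quotient of the blade space by the frozen space: a class is represented by its unique
  member that is a combination of nonfrozen \<open>beta J\<close>.
\<close>
definition mod_frozen :: "real^('n::{finite,linorder} set) \<Rightarrow> real^('n set)" where
  "mod_frozen z = (\<Sum>J\<in>nonfrozen_sets. z $ J *\<^sub>R beta J)"

lemma mod_frozen_nth: "mod_frozen z $ J = (if J \<in> nonfrozen_sets then z $ J else 0)"
  by (simp add: mod_frozen_def beta_def axis_def if_distrib cong: if_cong)

lemma span_beta_iff: "z \<in> span (beta ` S) \<longleftrightarrow> (\<forall>J. J \<notin> S \<longrightarrow> z $ J = 0)"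
proof
  assume "z \<in> span (beta ` S)"
  then show "\<forall>J. J \<notin> S \<longrightarrow> z $ J = 0"
    by (induction rule: span_induct_alt) (auto simp: beta_def axis_def split: if_splits)
next
  assume *: "\<forall>J. J \<notin> S \<longrightarrow> z $ J = 0"
  have "z = (\<Sum>J\<in>S. z $ J *\<^sub>R beta J)"
    using * by (auto simp: vec_eq_iff beta_def axis_def if_distrib cong: if_cong)
  moreover have "(\<Sum>J\<in>S. z $ J *\<^sub>R beta J) \<in> span (beta ` S)"
    by (intro span_sum span_scale span_base) auto
  ultimately show "z \<in> span (beta ` S)" by simp
qed

lemma mod_frozen_eq_iff:
  assumes "z \<in> blade_space" "z' \<in> blade_space"
  shows "mod_frozen z = mod_frozen z' \<longleftrightarrow> z - z' \<in> frozen_space"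
  using assms unfolding blade_space_def frozen_space_def span_beta_iff
  by (auto simp: vec_eq_iff mod_frozen_nth nonfrozen_sets_def) metis+

definition Zbar_set :: "(real^('n::{finite,linorder} set)) set" where
  "Zbar_set = mod_frozen ` Z_set"

subsection \<open>Positive tropical Grassmannian with its secondary fan\<close>

definition trop_pos :: "(real^('n::{finite,linorder} set)) set" where
  "trop_pos = {p. (\<forall>I. I \<notin> two_sets \<longrightarrow> p $ I = 0) \<and>
     (\<forall>a b c d. a < b \<and> b < c \<and> c < d \<longrightarrow>
        p $ {a,c} + p $ {b,d} = min (p $ {a,b} + p $ {c,d}) (p $ {b,c} + p $ {a,d}))}"

definition lifted_hypersimplex ::
    "real^('n::{finite,linorder} set) \<Rightarrow> ((real^'n::{finite,linorder}) \<times> real) set" where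
  "lifted_hypersimplex p = convex hull ((\<lambda>I. (e_vec I, p $ I)) ` two_sets)"

text \<open>
  A lower face is the set of minimizers of a linear functional \<open>(x, h) \<mapsto> y \<bullet> x + h\<close>,
  that is, of a functional with positive last coordinate, normalised to 1.
\<close>
definition lower_faces ::
    "real^('n::{finite,linorder} set) \<Rightarrow> ((real^'n::{finite,linorder}) \<times> real) set set" where
  "lower_faces p = range (\<lambda>y. {q \<in> lifted_hypersimplex p.
     \<forall>r\<in>lifted_hypersimplex p. y \<bullet> fst q + snd q \<le> y \<bullet> fst r + snd r})"

definition regular_subdivision ::
    "real^('n::{finite,linorder} set) \<Rightarrow> (real^'n::{finite,linorder}) set set" where
  "regular_subdivision p = (\<lambda>F. fst ` F) ` lower_faces p"

text \<open>
  A closed convex cone is the closure of its relative interior, so the cone of the secondary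
  fan having \<open>p\<close> in its relative interior is the closure of the class of \<open>p\<close>.
\<close>
definition trop_fan :: "(real^('n::{finite,linorder} set)) set set" where
  "trop_fan = (\<lambda>p. closure {p' \<in> trop_pos. regular_subdivision p' = regular_subdivision p}) ` trop_pos"

subsection \<open>The fan structure on the quotient\<close>

definition initial_elements :: "'n::{finite,linorder} set \<Rightarrow> 'n set" where
  "initial_elements J = {j \<in> J. cpred j \<notin> J}"

definition L_elt :: "'n::{finite,linorder} set \<Rightarrow> real^('n set)" where
  "L_elt J = (\<Sum>M\<in>Pow (initial_elements J). (-1) ^ (1 + card M) *\<^sub>R beta ((J - M) \<union> cpred ` M))"

definition trop_to_Zbar :: "real^('n::{finite,linorder} set) \<Rightarrow> real^('n set)" where
  "trop_to_Zbar p = mod_frozen (\<Sum>I\<in>two_sets. p $ I *\<^sub>R L_elt I)"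

definition Zbar_fan :: "(real^('n::{finite,linorder} set)) set set" where
  "Zbar_fan = (\<lambda>C. trop_to_Zbar ` C) ` trop_fan"

definition maximal_cones :: "'a set set \<Rightarrow> 'a set set" where
  "maximal_cones \<F> = {C \<in> \<F>. \<forall>D\<in>\<F>. C \<subseteq> D \<longrightarrow> D = C}"

definition simplicial_cone :: "'a::euclidean_space set \<Rightarrow> bool" where
  "simplicial_cone C \<longleftrightarrow> (\<exists>B. finite B \<and> independent B \<and> C = convex_cone hull B)"

definition P_cone :: "'n::{finite,linorder} set set \<Rightarrow> (real^('n set)) set" where
  "P_cone W = {(\<Sum>J\<in>W. c J *\<^sub>R beta J) | c. \<forall>J\<in>W. c J \<ge> 0}"

end

theory Submission
  imports Defs
begin

text \<open>
  Inside the hypersimplex the blade at \<open>{i, j}\<close> is the split along the hyperplane where the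
  coordinates in the cyclic interval \<open>(i, j]\<close> sum to 1. For pairwise weakly separated \<open>J\<close> these
  intervals are pairwise nested, disjoint or covering, so every cell of the common refinement is
  \<open>{x \<ge> 0. \<Sum>x = 2}\<close> cut by \<open>x(P) \<le> 1\<close> for the classes \<open>P\<close> of a noncrossing partition: its vertices
  are 0/1 vectors and its matroid is a rank-two positroid. If \<open>{a, c}\<close> and \<open>{b, d}\<close> cross, a cell
  through the centre of the octahedron on \<open>a, b, c, d\<close> violates the three-term Pluecker relation.

  The coefficient of \<open>\<beta>\<^bsub>{i,j}\<^esub>\<close> in the image of \<open>p\<close> is
  \<open>p(i+1,j) + p(i,j+1) - p(i,j) - p(i+1,j+1)\<close>; this map is split by \<open>\<beta>\<^bsub>J\<^esub> \<mapsto> (I \<mapsto> [I \<subseteq> (i, j]])\<close>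
  and its kernel consists of the heights \<open>u(i) + u(j)\<close>. In these coordinates the positive tropical
  Grassmannian is given by nonnegative coefficients with weakly separated support, and the regular
  subdivision of \<open>p\<close> is the blade subdivision of that support, from which the support can be
  recovered. So the cones of the fan are the \<open>P_cone W\<close> with \<open>W\<close> weakly separated and nonfrozen, and
  the maximal \<open>W\<close> are the triangulations of the \<open>n\<close>-gon, with \<open>n - 3\<close> diagonals each.
\<close>

subsection \<open>Polytopes cut out by mass constraints\<close>

text \<open>\<open>blade_subdivision\<close> ranges over all choices of one translated cone per
  blade, and most of these cut the hypersimplex in a degenerate piece: half of a split on which some
  coordinates are also forced to vanish. The common refinement is therefore handled as the set of
  faces of \<open>cell W \<sigma>\<close>, with one side chosen per chord. This requires a class of
  polytopes closed under faces, which dictates two conventions: vanishing coordinates are recorded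
  in a set \<open>E\<close>, and every condition imposed on the constraint sets is invariant under
  complementation, because a face adds complements of tight sets. The fan is defined by closures of
  classes of heights, before the lineality is divided out. A continuous map with a kernel carries
  such a closure into a cone, but need not fill it; limits are lifted back through the explicit
  section \<open>height\<close>.\<close>

definition mass :: "real^'n \<Rightarrow> 'n::finite set \<Rightarrow> real" where
  "mass x B = (\<Sum>i\<in>B. x $ i)"

lemma mass_add: "mass (x + y) B = mass x B + mass y B"
  by (simp add: mass_def sum.distrib)

lemma mass_diff: "mass (x - y) B = mass x B - mass y B"
  by (simp add: mass_def sum_subtractf)

lemma mass_scaleR: "mass (c *\<^sub>R x) B = c * mass x B"
  by (simp add: mass_def sum_distrib_left)

lemma mass_Compl: "mass x (- B) = mass x UNIV - mass x B"
  by (simp add: mass_def Compl_eq_Diff_UNIV sum_diff)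

lemma mass_mono:
  assumes "\<And>i. 0 \<le> x $ i" "A \<subseteq> B"
  shows "mass x A \<le> mass x B"
  using assms by (auto simp: mass_def intro!: sum_mono2)

lemma mass_Un_Int: "mass x (A \<union> B) + mass x (A \<inter> B) = mass x A + mass x B"
  by (simp add: mass_def sum.union_inter)

lemma mass_as_inner: "mass x B = e_vec B \<bullet> x"
  by (simp add: mass_def e_vec_def inner_sum_left inner_axis')

lemma e_vec_nth: "e_vec I $ i = (if i \<in> I then 1 else 0)"
  by (auto simp: e_vec_def axis_def if_distrib cong: if_cong)

lemma e_vec_inj: "e_vec I = e_vec J \<longleftrightarrow> I = J"
  by (auto simp: vec_eq_iff e_vec_nth split: if_splits)

lemma mass_e_vec: "mass (e_vec I) B = real (card (I \<inter> B))"
proof -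
  have "mass (e_vec I) B = (\<Sum>i\<in>B \<inter> I. 1)"
    unfolding mass_def e_vec_nth by (subst sum.inter_restrict) auto
  then show ?thesis by (simp add: Int_commute)
qed

text \<open>Finitely many strict inequalities leave a common margin. It supplies the step length for
  moves inside a polytope and, later, the tilt of a functional that cuts out a face of a
  cell.\<close>

lemma small_multiple_less:
  fixes f g :: "'a \<Rightarrow> real"
  assumes "finite S" "\<And>s. s \<in> S \<Longrightarrow> 0 < g s"
  obtains \<epsilon> where "0 < \<epsilon>" "\<And>s. s \<in> S \<Longrightarrow> \<epsilon> * f s < g s"
proof -
  have "\<forall>\<^sub>F \<epsilon> in at_right 0. \<epsilon> * f s < g s" if "s \<in> S" for s
  proof -
    have "((\<lambda>\<epsilon>. \<epsilon> * f s) \<longlongrightarrow> 0 * f s) (at_right 0)"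
      by (intro tendsto_intros)
    then show ?thesis
      using assms(2)[OF that] by (auto dest: order_tendstoD(2))
  qed
  then have "\<forall>\<^sub>F \<epsilon> in at_right (0::real). \<forall>s\<in>S. \<epsilon> * f s < g s"
    using assms(1) by (simp add: eventually_ball_finite)
  moreover have "\<forall>\<^sub>F \<epsilon> in at_right (0::real). 0 < \<epsilon>"
    by (simp add: eventually_at_right_less)
  ultimately have "\<forall>\<^sub>F \<epsilon> in at_right (0::real). 0 < \<epsilon> \<and> (\<forall>s\<in>S. \<epsilon> * f s < g s)"
    by eventually_elim auto
  then have "\<exists>\<epsilon>>0. \<forall>s\<in>S. \<epsilon> * f s < g s"
    by (rule eventually_happens'[OF trivial_limit_at_right_real])
  then show ?thesis using that by blast
qed

text \<open>Total mass 2 makes \<open>mass x (- B) \<le> 1\<close> the same as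
  \<open>mass x B \<ge> 1\<close>, so an equality is encoded by listing \<open>B\<close> together
  with its complement. With \<open>E\<close> recording the coordinates that may be nonzero, faces
  keep this format.\<close>

definition mass_polytope :: "'n::finite set \<Rightarrow> 'n set set \<Rightarrow> (real^'n) set" where
  "mass_polytope E \<B> = {x. (\<forall>i. 0 \<le> x $ i) \<and> (\<forall>i. i \<notin> E \<longrightarrow> x $ i = 0) \<and>
     mass x UNIV = 2 \<and> (\<forall>B\<in>\<B>. mass x B \<le> 1)}"

text \<open>Only slack constraints can obstruct \<open>v\<close>, and there are finitely many. One
  sign is used to prolong a segment past \<open>x\<close>, the pair of signs to refute
  extremality.\<close>

lemma mass_polytope_perturb:
  fixes x v :: "real^'n::finite"
  assumes x: "x \<in> mass_polytope E \<B>"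
    and v0: "\<And>i. x $ i = 0 \<Longrightarrow> v $ i = 0"
    and vU: "mass v UNIV = 0"
    and vB: "\<And>B. B \<in> \<B> \<Longrightarrow> mass x B = 1 \<Longrightarrow> mass v B = 0"
  obtains \<epsilon> where "0 < \<epsilon>" "x + \<epsilon> *\<^sub>R v \<in> mass_polytope E \<B>" "x - \<epsilon> *\<^sub>R v \<in> mass_polytope E \<B>"
proof -
  have x': "\<And>i. 0 \<le> x $ i" "\<And>i. i \<notin> E \<Longrightarrow> x $ i = 0" "mass x UNIV = 2"
    "\<And>B. B \<in> \<B> \<Longrightarrow> mass x B \<le> 1"
    using x by (auto simp: mass_polytope_def)
  obtain e1 where e1: "0 < e1" "\<And>i. i \<in> {i. x $ i \<noteq> 0} \<Longrightarrow> e1 * \<bar>v $ i\<bar> < x $ i"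
    using small_multiple_less[of "{i. x $ i \<noteq> 0}" "\<lambda>i. x $ i" "\<lambda>i. \<bar>v $ i\<bar>"] x'(1)
    by (auto simp: less_le)
  obtain e2 where e2: "0 < e2"
      "\<And>B. B \<in> {B\<in>\<B>. mass x B < 1} \<Longrightarrow> e2 * \<bar>mass v B\<bar> < 1 - mass x B"
    using small_multiple_less[of "{B\<in>\<B>. mass x B < 1}" "\<lambda>B. 1 - mass x B" "\<lambda>B. \<bar>mass v B\<bar>"]
    by auto
  define e where "e = min e1 e2"
  have e: "0 < e" using e1 e2 by (simp add: e_def)
  have a: "e * \<bar>v $ i\<bar> \<le> x $ i" for i
  proof (cases "x $ i = 0")
    case False
    have "e * \<bar>v $ i\<bar> \<le> e1 * \<bar>v $ i\<bar>" by (intro mult_right_mono) (auto simp: e_def)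
    then show ?thesis using e1(2)[of i] False by simp
  qed (simp add: v0)
  have b: "mass x B + e * \<bar>mass v B\<bar> \<le> 1" if "B \<in> \<B>" for B
  proof (cases "mass x B = 1")
    case True
    then show ?thesis using vB that by simp
  next
    case False
    have "e * \<bar>mass v B\<bar> \<le> e2 * \<bar>mass v B\<bar>" by (intro mult_right_mono) (auto simp: e_def)
    then show ?thesis using e2(2)[of B] False x'(4)[OF that] that by simp
  qed
  have c: "\<bar>e * v $ i\<bar> \<le> x $ i" "\<bar>e * mass v B\<bar> = e * \<bar>mass v B\<bar>" for i B
    using a[of i] e by (auto simp: abs_mult)
  have "0 \<le> x $ i + e * v $ i" "0 \<le> x $ i - e * v $ i" for i
    using c(1)[of i] by linarith+
  moreover have "mass x B + e * mass v B \<le> 1" "mass x B - e * mass v B \<le> 1" if "B \<in> \<B>" for B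
    using b[OF that] c(2)[of B] by linarith+
  ultimately have "x + e *\<^sub>R v \<in> mass_polytope E \<B>" "x - e *\<^sub>R v \<in> mass_polytope E \<B>"
    using x'(2,3) vU v0
    by (auto simp: mass_polytope_def mass_add mass_diff mass_scaleR)
  with e that show ?thesis by blast
qed

lemma convex_mass_polytope: "convex (mass_polytope E \<B>)"
proof (rule convexI)
  fix x y :: "real^'a" and u v :: real
  assume x: "x \<in> mass_polytope E \<B>" and y: "y \<in> mass_polytope E \<B>"
    and uv: "0 \<le> u" "0 \<le> v" "u + v = 1"
  have "u * mass x B + v * mass y B \<le> 1" if "B \<in> \<B>" for B
  proof -
    have "u * mass x B + v * mass y B \<le> u * 1 + v * 1"
      using x y uv that by (intro add_mono mult_left_mono) (auto simp: mass_polytope_def)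
    then show ?thesis using uv by simp
  qed
  moreover have "u * 2 + v * 2 = 2" using uv(3) by linarith
  ultimately show "u *\<^sub>R x + v *\<^sub>R y \<in> mass_polytope E \<B>"
    using x y uv by (auto simp: mass_polytope_def mass_add mass_scaleR)
qed

lemma compact_mass_polytope: "compact (mass_polytope E \<B>)"
proof -
  have eq: "mass_polytope E \<B> =
      (\<Inter>i. {x. 0 \<le> x $ i}) \<inter> (\<Inter>i\<in>-E. {x. x $ i = 0}) \<inter> {x. mass x UNIV = 2} \<inter>
      (\<Inter>B\<in>\<B>. {x. mass x B \<le> 1})"
    by (auto simp: mass_polytope_def)
  have "closed (mass_polytope E \<B>)"
    unfolding eq mass_def
    by (intro closed_Int closed_INT ballI closed_Collect_le closed_Collect_eq continuous_intros)
  moreover have "bounded (mass_polytope E \<B>)"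
    unfolding bounded_iff
  proof (intro exI ballI)
    fix x assume x: "x \<in> mass_polytope E \<B>"
    have "norm x \<le> (\<Sum>i\<in>UNIV. \<bar>x $ i\<bar>)" by (rule norm_le_l1_cart)
    also have "\<dots> = 2" using x by (simp add: mass_polytope_def mass_def)
    finally show "norm x \<le> 2" .
  qed
  ultimately show ?thesis by (simp add: compact_eq_bounded_closed)
qed

text \<open>A face is determined by the constraints tight at a relative interior point
  \<open>x\<close>. Turning these into equalities shrinks \<open>E\<close> to the support of
  \<open>x\<close> and adds the complements of the tight sets.\<close>

lemma face_of_mass_polytope:
  fixes F :: "(real^'n::finite) set"
  assumes F: "F face_of mass_polytope E \<B>" and ne: "F \<noteq> {}"
  obtains E' \<B>' where "F = mass_polytope E' \<B>'" "\<B> \<subseteq> \<B>'" "\<B>' \<subseteq> \<B> \<union> uminus ` \<B>"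
proof -
  have cF: "convex F" using F face_of_imp_convex by blast
  then obtain x where xr: "x \<in> rel_interior F"
    using ne rel_interior_eq_empty[OF cF] by blast
  then have xF: "x \<in> F" using rel_interior_subset by blast
  have sub: "F \<subseteq> mass_polytope E \<B>" using F face_of_imp_subset by blast
  have xQ: "x \<in> mass_polytope E \<B>" using sub xF by blast
  define E' where "E' = {i. x $ i \<noteq> 0}"
  define \<B>' where "\<B>' = \<B> \<union> uminus ` {B\<in>\<B>. mass x B = 1}"
  have iff: "z \<in> mass_polytope E' \<B>' \<longleftrightarrow> z \<in> mass_polytope E \<B> \<and> (\<forall>i. x $ i = 0 \<longrightarrow> z $ i = 0)
      \<and> (\<forall>B\<in>\<B>. mass x B = 1 \<longrightarrow> mass z B = 1)" for z
  proof -
    have 1: "(\<forall>B\<in>\<B>'. mass z B \<le> 1) \<longleftrightarrow>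
       (\<forall>B\<in>\<B>. mass z B \<le> 1) \<and> (\<forall>B\<in>\<B>. mass x B = 1 \<longrightarrow> mass z (-B) \<le> 1)"
      by (auto simp: \<B>'_def)
    have 2: "\<And>i. i \<notin> E \<Longrightarrow> x $ i = 0" using xQ by (auto simp: mass_polytope_def)
    show ?thesis
      unfolding mass_polytope_def mem_Collect_eq 1 E'_def using 2
      by (auto simp: mass_Compl) (smt (verit))+
  qed
  have "z \<in> mass_polytope E' \<B>'" if z: "z \<in> F" for z
  proof -
    \<comment> \<open>The segment from \<open>z\<close> to \<open>x\<close> can be prolonged beyond
      \<open>x\<close> inside \<open>F\<close>; a constraint tight at \<open>x\<close> but slack at
      \<open>z\<close> would fail at the far end.\<close>
    obtain m where m: "m > 1" "(1 - m) *\<^sub>R z + m *\<^sub>R x \<in> F"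
      using convex_rel_interior_if[OF cF xr] z hull_inc[of z F affine] by (meson dual_order.refl)
    have w: "(1 - m) *\<^sub>R z + m *\<^sub>R x \<in> mass_polytope E \<B>" using sub m by blast
    have zQ: "z \<in> mass_polytope E \<B>" using sub z by blast
    have "z $ i = 0" if "x $ i = 0" for i
    proof -
      have "0 \<le> ((1 - m) *\<^sub>R z + m *\<^sub>R x) $ i" "0 \<le> z $ i"
        using w zQ by (auto simp only: mass_polytope_def mem_Collect_eq)
      then show ?thesis using that m(1) by (simp add: zero_le_mult_iff)
    qed
    moreover have "mass z B = 1" if "B \<in> \<B>" "mass x B = 1" for B
    proof -
      have "mass ((1 - m) *\<^sub>R z + m *\<^sub>R x) B \<le> 1" "mass z B \<le> 1"
        using w zQ that by (auto simp: mass_polytope_def)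
      then have "(1 - m) * (mass z B - 1) \<le> 0" "mass z B \<le> 1"
        using that by (auto simp only: mass_add mass_scaleR) (simp add: algebra_simps)
      then show ?thesis using m(1) by (auto simp: mult_le_0_iff)
    qed
    ultimately show ?thesis using iff zQ by blast
  qed
  moreover have "z \<in> F" if z: "z \<in> mass_polytope E' \<B>'" for z
  proof (cases "z = x")
    case False
    have zQ: "z \<in> mass_polytope E \<B>" "\<And>i. x $ i = 0 \<Longrightarrow> z $ i = 0"
      "\<And>B. B \<in> \<B> \<Longrightarrow> mass x B = 1 \<Longrightarrow> mass z B = 1" using iff z by blast+
    \<comment> \<open>Constraints tight at \<open>x\<close> are tight at \<open>z\<close>, so
      \<open>x\<close> can be pushed away from \<open>z\<close> within the polytope. Then
      \<open>x\<close> is interior to a segment starting at \<open>z\<close>, and the face property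
      pulls \<open>z\<close> into \<open>F\<close>.\<close>
    obtain \<epsilon> where \<epsilon>: "0 < \<epsilon>" "x + \<epsilon> *\<^sub>R (x - z) \<in> mass_polytope E \<B>"
    proof (rule mass_polytope_perturb[OF xQ, of "x - z"])
      show "mass (x - z) UNIV = 0" using xQ zQ(1) by (auto simp: mass_polytope_def mass_diff)
    qed (use zQ in \<open>auto simp: mass_diff\<close>)
    have "x \<in> open_segment z (x + \<epsilon> *\<^sub>R (x - z))"
      unfolding in_segment
    proof (intro conjI exI[of _ "1/(1+\<epsilon>)"])
      show "z \<noteq> x + \<epsilon> *\<^sub>R (x - z)"
      proof
        assume "z = x + \<epsilon> *\<^sub>R (x - z)"
        then have "(1 + \<epsilon>) *\<^sub>R (x - z) = 0" by (simp add: algebra_simps)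
        then show False using \<epsilon> False by simp
      qed
      have "(1+\<epsilon>) *\<^sub>R ((1 - 1/(1+\<epsilon>)) *\<^sub>R z + (1/(1+\<epsilon>)) *\<^sub>R (x + \<epsilon> *\<^sub>R (x - z))) = (1+\<epsilon>) *\<^sub>R x"
        using \<epsilon> by (simp add: vec_eq_iff field_simps)
      then show "x = (1 - 1/(1+\<epsilon>)) *\<^sub>R z + (1/(1+\<epsilon>)) *\<^sub>R (x + \<epsilon> *\<^sub>R (x - z))"
        using \<epsilon> by (smt (verit) scaleR_cancel_left)
    qed (use \<epsilon> in auto)
    then show ?thesis using face_ofD[OF F _ zQ(1) \<epsilon>(2) xF] by blast
  qed (use xF in simp)
  ultimately have "F = mass_polytope E' \<B>'" by blast
  then show ?thesis using that[of E' \<B>'] by (auto simp: \<B>'_def)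
qed

section \<open>Compatible set families and integrality of vertices\<close>

definition compatible :: "'a set \<Rightarrow> 'a set \<Rightarrow> bool" where
  "compatible B B' \<longleftrightarrow> B \<inter> B' = {} \<or> B \<subseteq> B' \<or> B' \<subseteq> B \<or> B \<union> B' = UNIV"

text \<open>The covering case in the definition makes the relation blind to replacing a set by its
  complement, which is what passing to a face does with tight constraints.\<close>

lemma compatible_uminus: "compatible (- B) B' \<longleftrightarrow> compatible B B'"
  "compatible B (- B') \<longleftrightarrow> compatible B B'"
  unfolding compatible_def by blast+

lemma compatible_singleton: "compatible {k} B" "compatible B {k}"
  by (auto simp: compatible_def)

lemma e_vec_mem_mass_polytope:
  assumes "I \<in> two_sets"
  shows "e_vec I \<in> mass_polytope E \<B> \<longleftrightarrow> I \<subseteq> E \<and> (\<forall>B\<in>\<B>. \<not> I \<subseteq> B)"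
proof -
  have c: "card I = 2" "finite I" using assms by (auto simp: two_sets_def)
  have "mass (e_vec I) B \<le> 1 \<longleftrightarrow> \<not> I \<subseteq> B" for B
  proof -
    have "card (I \<inter> B) \<le> 2" "card (I \<inter> B) = 2 \<longleftrightarrow> I \<subseteq> B"
      using c card_mono[of I "I \<inter> B"] card_subset_eq[of I "I \<inter> B"] by (auto simp: inf.absorb1)
    then show ?thesis unfolding mass_e_vec by linarith
  qed
  then show ?thesis using c
    by (auto simp: mass_polytope_def e_vec_nth mass_e_vec)
qed

text \<open>Moving mass between two positive coordinates is obstructed only by a tight set
  separating them. Laminarity on \<open>E\<close> leaves each set at most one positive coordinate,
  so a fractional coordinate lies in no tight set. Two fractional ones could then be traded, and a
  lone one contradicts the integral total 2.\<close>

lemma extreme_point_of_mass_polytope: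
  fixes x :: "real^'n::{finite,linorder}"
  assumes sing: "\<And>k. {k} \<in> \<B>"
    and lam: "\<And>B B'. B \<in> \<B> \<Longrightarrow> B' \<in> \<B> \<Longrightarrow> B \<inter> B' \<inter> E \<noteq> {} \<Longrightarrow> B \<inter> E \<subseteq> B' \<or> B' \<inter> E \<subseteq> B"
    and ext: "x extreme_point_of mass_polytope E \<B>"
  obtains I where "I \<in> two_sets" "x = e_vec I"
proof -
  have x: "x \<in> mass_polytope E \<B>" using ext by (simp add: extreme_point_of_def)
  have x0: "\<And>i. 0 \<le> x $ i" and xE: "\<And>i. i \<notin> E \<Longrightarrow> x $ i = 0" and x2: "mass x UNIV = 2"
    and xB: "\<And>B. B \<in> \<B> \<Longrightarrow> mass x B \<le> 1"
    using x by (auto simp: mass_polytope_def)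
  have x1: "x $ i \<le> 1" for i using xB[OF sing[of i]] by (simp add: mass_def)
  have split_mass: "mass x B' + x $ l \<le> mass x B" if "B' \<inter> E \<subseteq> B" "l \<in> B" "l \<notin> B'" for B B' l
  proof -
    have "mass x B' + x $ l = mass x (insert l (B' \<inter> E))"
    proof -
      have "mass x B' = mass x (B' \<inter> E)"
        unfolding mass_def using xE by (intro sum.mono_neutral_right) auto
      then show ?thesis using that by (simp add: mass_def)
    qed
    also have "\<dots> \<le> mass x B" using that x0 by (intro mass_mono) auto
    finally show ?thesis .
  qed
  have contra: False
    if kl: "k \<noteq> l" "x $ k > 0" "x $ l > 0"
      and tight: "\<And>B. B \<in> \<B> \<Longrightarrow> k \<in> B \<Longrightarrow> l \<notin> B \<Longrightarrow> mass x B < 1"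
        "\<And>B. B \<in> \<B> \<Longrightarrow> l \<in> B \<Longrightarrow> k \<notin> B \<Longrightarrow> mass x B < 1" for k l
  proof -
    define v :: "real^'n::{finite,linorder}" where "v = axis k 1 - axis l 1"
    have mv: "mass v B = of_bool (k \<in> B) - of_bool (l \<in> B)" for B
      by (simp add: v_def mass_diff) (simp add: mass_def axis_def)
    obtain \<epsilon> where \<epsilon>: "0 < \<epsilon>" "x + \<epsilon> *\<^sub>R v \<in> mass_polytope E \<B>" "x - \<epsilon> *\<^sub>R v \<in> mass_polytope E \<B>"
    proof (rule mass_polytope_perturb[OF x, of v])
      show "mass v B = 0" if "B \<in> \<B>" "mass x B = 1" for B
        using tight[OF that(1)] that(2) by (auto simp: mv)
      show "v $ i = 0" if "x $ i = 0" for i using that kl by (auto simp: v_def axis_def)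
    qed (auto simp: mv)
    have vn: "v \<noteq> 0" using kl by (auto simp: v_def axis_eq_axis)
    have "x \<in> open_segment (x + \<epsilon> *\<^sub>R v) (x - \<epsilon> *\<^sub>R v)"
      unfolding in_segment
    proof (intro conjI exI[of _ "1/2"])
      show "x + \<epsilon> *\<^sub>R v \<noteq> x - \<epsilon> *\<^sub>R v"
      proof
        assume "x + \<epsilon> *\<^sub>R v = x - \<epsilon> *\<^sub>R v"
        then have "\<epsilon> *\<^sub>R v = - (\<epsilon> *\<^sub>R v)" by (simp add: algebra_simps)
        then have "(2 * \<epsilon>) *\<^sub>R v = 0" by (simp add: vec_eq_iff)
        then show False using vn \<epsilon>(1) by simp
      qed
    qed (auto simp: vec_eq_iff field_simps)
    then show False using ext \<epsilon> by (auto simp: extreme_point_of_def)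
  qed
  \<comment> \<open>If \<open>B\<close> holds both, a set \<open>B'\<close> separating them lies
    inside \<open>B\<close> on \<open>E\<close>. It misses one of the two positive coordinates, so
    its mass stays strictly below 1 and the exchange is unobstructed.\<close>
  have unrel: False if kl: "k \<noteq> l" "x $ k > 0" "x $ l > 0" and B: "B \<in> \<B>" "k \<in> B" "l \<in> B" for k l B
  proof (rule contra[OF kl])
    have aux: "mass x B' < 1" if "B' \<in> \<B>" "k \<in> B'" "l \<notin> B'" "k \<in> B" "l \<in> B" "x $ k > 0" "x $ l > 0" for k l B'
    proof -
      have "k \<in> E" "l \<in> E" using xE that by force+
      then have "B' \<inter> E \<subseteq> B" using lam[OF B(1) that(1)] that by blast
      then show ?thesis using split_mass[of B' B l] that xB[OF B(1)] by simp
    qed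
    show "mass x B' < 1" if "B' \<in> \<B>" "k \<in> B'" "l \<notin> B'" for B' using aux that B kl by blast
    show "mass x B' < 1" if "B' \<in> \<B>" "l \<in> B'" "k \<notin> B'" for B' using aux that B kl by blast
  qed
  have single: "mass x B = x $ k" if "B \<in> \<B>" "k \<in> B" "x $ k > 0" for B k
  proof -
    have "x $ i = 0" if "i \<in> B - {k}" for i
    proof (rule ccontr)
      assume "x $ i \<noteq> 0"
      then show False using unrel[of i k B] that \<open>B \<in> \<B>\<close> \<open>k \<in> B\<close> \<open>x $ k > 0\<close> x0[of i] by auto
    qed
    then have "mass x {k} = mass x B"
      unfolding mass_def using \<open>k \<in> B\<close> by (intro sum.mono_neutral_left) auto
    then show ?thesis by (simp add: mass_def)
  qed
  have int: "x $ k = 0 \<or> x $ k = 1" for k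
  proof (rule ccontr)
    assume k: "\<not> (x $ k = 0 \<or> x $ k = 1)"
    then have k': "0 < x $ k" "x $ k < 1" using x0[of k] x1[of k] by auto
    have "x $ l = 0 \<or> x $ l = 1" if "l \<noteq> k" for l
    proof (rule ccontr)
      assume "\<not> (x $ l = 0 \<or> x $ l = 1)"
      then have l: "0 < x $ l" "x $ l < 1" using x0[of l] x1[of l] by auto
      show False
        using contra[of k l] that k' l single by metis
    qed
    then have "mass x (UNIV - {k}) = (\<Sum>l\<in>UNIV - {k}. of_bool (x $ l = 1))"
      unfolding mass_def by (intro sum.cong) auto
    also have "\<dots> = real (card {l \<in> UNIV - {k}. x $ l = 1})" by (simp add: Int_def)
    finally have "x $ k = 2 - real (card {l \<in> UNIV - {k}. x $ l = 1})"
      using x2 by (simp add: mass_def sum_diff1)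
    then have "x $ k = of_int (2 - int (card {l \<in> UNIV - {k}. x $ l = 1}))" by simp
    then obtain z where "x $ k = of_int z" by blast
    then show False using k' by auto
  qed
  define I where "I = {k. x $ k = 1}"
  have xI: "x = e_vec I" using int by (auto simp: vec_eq_iff e_vec_nth I_def)
  then have "real (card I) = 2" using x2 by (simp add: mass_e_vec)
  then have "I \<in> two_sets" by (simp add: two_sets_def)
  then show ?thesis using that xI by blast
qed

lemma mass_polytope_eq_hull:
  fixes E :: "'n::{finite,linorder} set"
  assumes "\<And>k. {k} \<in> \<B>"
    and "\<And>B B'. B \<in> \<B> \<Longrightarrow> B' \<in> \<B> \<Longrightarrow> B \<inter> B' \<inter> E \<noteq> {} \<Longrightarrow> B \<inter> E \<subseteq> B' \<or> B' \<inter> E \<subseteq> B"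
  shows "mass_polytope E \<B> = convex hull (e_vec ` {I \<in> two_sets. e_vec I \<in> mass_polytope E \<B>})"
proof
  have "mass_polytope E \<B> = convex hull {x. x extreme_point_of mass_polytope E \<B>}"
    by (intro Krein_Milman_Minkowski compact_mass_polytope convex_mass_polytope)
  also have "\<dots> \<subseteq> convex hull (e_vec ` {I \<in> two_sets. e_vec I \<in> mass_polytope E \<B>})"
  proof (intro hull_mono subsetI)
    fix x assume x: "x \<in> {x. x extreme_point_of mass_polytope E \<B>}"
    then obtain I where "I \<in> two_sets" "x = e_vec I"
      using extreme_point_of_mass_polytope[OF assms] by blast
    then show "x \<in> e_vec ` {I \<in> two_sets. e_vec I \<in> mass_polytope E \<B>}"
      using x by (auto simp: extreme_point_of_def)
  qed
  finally show "mass_polytope E \<B> \<subseteq> \<dots>" .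
  show "convex hull (e_vec ` {I \<in> two_sets. e_vec I \<in> mass_polytope E \<B>}) \<subseteq> mass_polytope E \<B>"
    by (intro hull_minimal convex_mass_polytope) auto
qed

subsection \<open>Rank-two positroids from noncrossing partitions\<close>

lemma two_sets_iff: "I \<in> two_sets \<longleftrightarrow> (\<exists>i j. i < j \<and> I = {i, j})"
  unfolding two_sets_def mem_Collect_eq card_2_iff
  by (metis doubleton_eq_iff linorder_neqE order_less_irrefl)

lemma two_setsE:
  assumes "I \<in> two_sets"
  obtains i j where "i < j" "I = {i, j}"
  using assms two_sets_iff by blast

lemma doubleton_in_two_sets [simp]: "{i, j} \<in> two_sets \<longleftrightarrow> i \<noteq> j"
  by (auto simp: two_sets_def card_insert_if)

lemma minor2_doubleton:
  assumes "i < j"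
  shows "minor2 A {i, j} = A $ 1 $ i * A $ 2 $ j - A $ 1 $ j * A $ 2 $ i"
  using assms by (auto simp: minor2_def det_2 min_def max_def)

lemma rank_eq_2_if_minor2_nonzero:
  fixes A :: "real^'n::{finite,linorder}^2"
  assumes "i < j" "minor2 A {i, j} \<noteq> 0"
  shows "rank A = 2"
proof -
  define D where "D = minor2 A {i, j}"
  have D: "D = A $ 1 $ i * A $ 2 $ j - A $ 1 $ j * A $ 2 $ i" "D \<noteq> 0"
    using assms by (auto simp: D_def minor2_doubleton)
  have "\<exists>x. A *v x = w" for w
  proof
    \<comment> \<open>Cramer's rule in the columns \<open>i\<close> and \<open>j\<close>.\<close>
    let ?x = "((w $ 1 * A $ 2 $ j - w $ 2 * A $ 1 $ j) / D) *\<^sub>R axis i 1 +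
      ((A $ 1 $ i * w $ 2 - A $ 2 $ i * w $ 1) / D) *\<^sub>R axis j 1"
    have "(A *v ?x) $ r = ((w $ 1 * A $ 2 $ j - w $ 2 * A $ 1 $ j) / D) * A $ r $ i +
       ((A $ 1 $ i * w $ 2 - A $ 2 $ i * w $ 1) / D) * A $ r $ j" for r
      by (simp add: matrix_vector_right_distrib matrix_vector_mult_scaleR
          matrix_vector_mul_component inner_axis column_def)
    moreover have "((w $ 1 * A $ 2 $ j - w $ 2 * A $ 1 $ j) / D) * A $ r $ i +
       ((A $ 1 $ i * w $ 2 - A $ 2 $ i * w $ 1) / D) * A $ r $ j = w $ r" for r
    proof -
      have "(w $ 1 * A $ 2 $ j - w $ 2 * A $ 1 $ j) * A $ r $ i +
       (A $ 1 $ i * w $ 2 - A $ 2 $ i * w $ 1) * A $ r $ j = D * w $ r"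
        using exhaust_2[of r] by (auto simp: D(1) algebra_simps)
      then show ?thesis using D(2) by (simp add: times_divide_eq_left add_divide_distrib[symmetric])
    qed
    ultimately show "A *v ?x = w" by (simp add: vec_eq_iff)
  qed
  then have "surj ((*v) A)" by (metis surjI)
  then show ?thesis using full_rank_surjective[of A] by simp
qed

text \<open>The crossing product of minors is the sum of the two noncrossing ones, so it vanishes
  when both of these do.\<close>

lemma positroid_Pluecker:
  fixes a b c d :: "'n::{finite,linorder}"
  assumes M: "positroid M" and lt: "a < b" "b < c" "c < d"
    and mem: "{a, c} \<in> M" "{b, d} \<in> M"
  shows "{a, b} \<in> M \<and> {c, d} \<in> M \<or> {a, d} \<in> M \<and> {b, c} \<in> M"
proof -
  obtain A :: "real^'n::{finite,linorder}^2" where A: "\<And>I. I \<in> two_sets \<Longrightarrow> minor2 A I \<ge> 0"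
    "M = {I \<in> two_sets. minor2 A I \<noteq> 0}"
    using M by (auto simp: positroid_def)
  have lt': "a < c" "b < d" "a < d" using lt by auto
  have "minor2 A {a, c} * minor2 A {b, d} =
     minor2 A {a, b} * minor2 A {c, d} + minor2 A {a, d} * minor2 A {b, c}"
    using lt lt' by (simp add: minor2_doubleton algebra_simps)
  moreover have "minor2 A {a, c} * minor2 A {b, d} \<noteq> 0" using mem A(2) by simp
  ultimately have "minor2 A {a, b} * minor2 A {c, d} \<noteq> 0 \<or> minor2 A {a, d} * minor2 A {b, c} \<noteq> 0"
    by auto
  then show ?thesis using lt lt' by (auto simp: A(2))
qed

text \<open>Membership changes at most twice around the circle, so these are the cyclic intervals.
  Excluding both alternating patterns makes complementation harmless and avoids naming end
  points.\<close>

definition cyclically_convex :: "'n::linorder set \<Rightarrow> bool" where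
  "cyclically_convex B \<longleftrightarrow> (\<forall>a b c d. a < b \<and> b < c \<and> c < d \<longrightarrow>
     \<not> (a \<in> B \<and> b \<notin> B \<and> c \<in> B \<and> d \<notin> B) \<and> \<not> (a \<notin> B \<and> b \<in> B \<and> c \<notin> B \<and> d \<in> B))"

lemma cyclically_convex_uminus: "cyclically_convex (- B) \<longleftrightarrow> cyclically_convex B"
  unfolding cyclically_convex_def by auto

lemma cyclically_convex_singleton: "cyclically_convex {k}"
  unfolding cyclically_convex_def by auto

lemma cyclically_convex_interval: "cyclically_convex {i<..j}"
  unfolding cyclically_convex_def by (auto simp: not_le)

text \<open>
  Realising matrix: loops get zero columns and the elements of a class the column \<open>(1, t)\<close>, with
  \<open>t\<close> increasing along \<open>E\<close> and \<open>t = 0\<close> on the class of \<open>Min E\<close>. If that class wraps around the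
  end of \<open>E\<close>, its final elements get \<open>(-1, 0)\<close>, which keeps all minors nonnegative.
\<close>
lemma positroid_of_noncrossing_partition:
  fixes E :: "'n::{finite,linorder} set" and R :: "'n \<Rightarrow> 'n \<Rightarrow> bool"
  assumes refl: "\<And>k. k \<in> E \<Longrightarrow> R k k"
    and sym: "\<And>k l. R k l \<Longrightarrow> R l k"
    and trans: "\<And>k l m. \<lbrakk>k \<in> E; l \<in> E; m \<in> E; R k l; R l m\<rbrakk> \<Longrightarrow> R k m"
    and cross1: "\<And>a b c d. \<lbrakk>{a, b, c, d} \<subseteq> E; a < b; b < c; c < d; R a c\<rbrakk> \<Longrightarrow> R a b \<or> R a d"
    and cross2: "\<And>a b c d. \<lbrakk>{a, b, c, d} \<subseteq> E; a < b; b < c; c < d; R b d\<rbrakk> \<Longrightarrow> R b a \<or> R b c"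
    and two: "k0 \<in> E" "l0 \<in> E" "\<not> R k0 l0"
  shows "positroid {I \<in> two_sets. I \<subseteq> E \<and> (\<forall>k\<in>I. \<forall>l\<in>I. k \<noteq> l \<longrightarrow> \<not> R k l)}"
    (is "positroid ?M")
proof -
  have E: "E \<noteq> {}" "finite E" using two by auto
  define m where "m = Min E"
  have m: "m \<in> E" "\<And>i. i \<in> E \<Longrightarrow> m \<le> i" using E by (auto simp: m_def)
  define cmin where "cmin i = Min {j \<in> E. R j i}" for i
  \<comment> \<open>The added 1 keeps \<open>t\<close> above the value 0 reserved for the class of
    \<open>Min E\<close>; counting below the least member makes \<open>t\<close> constant on
    classes.\<close>
  define t where "t i = real (Suc (card {j. j < cmin i}))" for i
  have cmin: "cmin i \<in> E" "R (cmin i) i" "\<And>j. j \<in> E \<Longrightarrow> R j i \<Longrightarrow> cmin i \<le> j" if "i \<in> E" for i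
  proof -
    have ne: "{j \<in> E. R j i} \<noteq> {}" using refl[OF that] that by blast
    show "cmin i \<in> E" "R (cmin i) i" using Min_in[OF _ ne] by (auto simp: cmin_def)
    show "cmin i \<le> j" if "j \<in> E" "R j i" for j using that by (auto simp: cmin_def)
  qed
  define wrap where "wrap i \<longleftrightarrow> (\<exists>b\<in>E. b < i \<and> \<not> R b m)" for i
  define A :: "real^'n::{finite,linorder}^2" where
    "A = (\<chi> r i. if i \<notin> E then 0
        else if R i m then (if r = 1 then (if wrap i then -1 else 1) else 0)
        else (if r = 1 then 1 else t i))"
  have A1: "A $ 1 $ i = (if i \<notin> E then 0 else if R i m \<and> wrap i then -1 else 1)" for i
    by (simp add: A_def)
  have A2: "A $ 2 $ i = (if i \<notin> E \<or> R i m then 0 else t i)" for i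
    by (simp add: A_def)
  have tpos: "t i > 0" for i by (simp add: t_def)
  have minor: "(minor2 A {i, j} > 0 \<and> i \<in> E \<and> j \<in> E \<and> \<not> R i j) \<or>
      (minor2 A {i, j} = 0 \<and> \<not> (i \<in> E \<and> j \<in> E \<and> \<not> R i j))" if ij: "i < j" for i j
  proof (cases "i \<in> E \<and> j \<in> E")
    case False
    then show ?thesis using ij by (auto simp: minor2_doubleton A1 A2)
  next
    case True
    then have iE: "i \<in> E" and jE: "j \<in> E" by auto
    consider (a) "R i m" "R j m" | (b) "R i m" "\<not> R j m" | (c) "\<not> R i m" "R j m"
      | (d) "\<not> R i m" "\<not> R j m" by blast
    then show ?thesis
    proof cases
      case a
      then have "R i j" using trans[OF iE m(1) jE] sym by blast
      then show ?thesis using ij a by (auto simp: minor2_doubleton A1 A2)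
    next
      case b
      \<comment> \<open>Otherwise some \<open>b\<close> outside the class gives
        \<open>m < b < i < j\<close> with \<open>m\<close> and \<open>i\<close> related and both
        \<open>b\<close> and \<open>j\<close> unrelated to them, a crossing.\<close>
      have "\<not> wrap i"
      proof
        assume "wrap i"
        then obtain b where bb: "b \<in> E" "b < i" "\<not> R b m" by (auto simp: wrap_def)
        then have "m < b" using m refl by (metis order_le_less)
        then show False using cross1[of m b i j] bb b iE jE m(1) ij sym by blast
      qed
      moreover have "\<not> R i j" using b trans[OF jE iE m(1)] sym by blast
      ultimately show ?thesis using ij b iE jE tpos by (auto simp: minor2_doubleton A1 A2)
    next
      case c
      have "wrap j" using c iE ij by (auto simp: wrap_def)
      moreover have "\<not> R i j" using c trans[OF iE jE m(1)] by blast
      ultimately show ?thesis using ij c iE jE tpos by (auto simp: minor2_doubleton A1 A2)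
    next
      case d
      show ?thesis
      proof (cases "R i j")
        case True
        have "{k \<in> E. R k i} = {k \<in> E. R k j}" using True trans sym iE jE by blast
        then have "t i = t j" by (simp add: t_def cmin_def)
        then show ?thesis using ij d iE jE True by (auto simp: minor2_doubleton A1 A2)
      next
        case False
        \<comment> \<open>If the class of \<open>j\<close> did not start after that of
          \<open>i\<close>, then \<open>m < cmin j < i < j\<close>, and the related pair
          \<open>cmin j\<close>, \<open>j\<close> would alternate with \<open>m\<close> and
          \<open>i\<close>, neither of which is related to it.\<close>
        have "cmin i < cmin j"
        proof (rule ccontr)
          assume "\<not> cmin i < cmin j"
          then have le: "cmin j \<le> i" using cmin(3)[OF iE iE refl[OF iE]] by auto
          have n1: "\<not> R (cmin j) i"
            using cmin[OF jE] False trans[OF iE cmin(1)[OF jE] jE] sym by blast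
          have n2: "\<not> R (cmin j) m"
            using d cmin[OF jE] trans[OF jE cmin(1)[OF jE] m(1)] sym by blast
          have "cmin j < i" using le n1 refl[OF iE] by (metis order_le_less)
          moreover have "m < cmin j" using m n2 refl cmin(1)[OF jE] by (metis order_le_less)
          ultimately show False
            using cross2[of m "cmin j" i j] n1 n2 cmin[OF jE] iE jE m(1) ij by blast
        qed
        then have "{k. k < cmin i} \<subset> {k. k < cmin j}" by auto
        then have "card {k. k < cmin i} < card {k. k < cmin j}" by (intro psubset_card_mono) auto
        then have "t i < t j" by (simp add: t_def)
        then show ?thesis using ij d iE jE False by (auto simp: minor2_doubleton A1 A2)
      qed
    qed
  qed
  have "rank A = 2"
  proof (cases k0 l0 rule: linorder_cases)
    case less
    then show ?thesis using minor[OF less] two rank_eq_2_if_minor2_nonzero[OF less, of A] by auto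
  next
    case greater
    then show ?thesis using minor[OF greater] two sym rank_eq_2_if_minor2_nonzero[OF greater, of A] by auto
  next
    case equal
    then show ?thesis using two refl by auto
  qed
  moreover have "minor2 A I \<ge> 0 \<and> (I \<in> ?M \<longleftrightarrow> minor2 A I \<noteq> 0)" if I: "I \<in> two_sets" for I
  proof -
    obtain i j where ij: "i < j" "I = {i, j}" using two_setsE[OF I] .
    have "I \<in> ?M \<longleftrightarrow> i \<in> E \<and> j \<in> E \<and> \<not> R i j" using ij I sym by (auto simp del: doubleton_in_two_sets)
    then show ?thesis using minor[OF ij(1)] ij(2) by auto
  qed
  ultimately show ?thesis unfolding positroid_def by (intro exI[of _ A]) auto
qed

text \<open>Two constraint sets that together cover \<open>E\<close> must share the total mass 2, so
  the coordinates in their overlap vanish; these are loops and leave \<open>E\<close>, which drives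
  the induction. Once no such overlap remains, compatibility is laminarity on \<open>E\<close>, and
  lying in a common set is a noncrossing equivalence relation.\<close>

theorem positroid_polytope_mass_polytope:
  fixes E :: "'n::{finite,linorder} set"
  assumes sing: "\<And>k. {k} \<in> \<B>"
    and compat: "\<And>B B'. B \<in> \<B> \<Longrightarrow> B' \<in> \<B> \<Longrightarrow> compatible B B'"
    and cyc: "\<And>B. B \<in> \<B> \<Longrightarrow> cyclically_convex B"
    and ne: "mass_polytope E \<B> \<noteq> {}"
  shows "positroid_polytope (mass_polytope E \<B>)"
  using ne
proof (induction "card E" arbitrary: E rule: less_induct)
  case less
  show ?case
  proof (cases "\<exists>B\<in>\<B>. \<exists>B'\<in>\<B>. E \<subseteq> B \<union> B' \<and> B \<inter> B' \<inter> E \<noteq> {}")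
    case True
    then obtain B B' where B: "B \<in> \<B>" "B' \<in> \<B>" "E \<subseteq> B \<union> B'" "B \<inter> B' \<inter> E \<noteq> {}" by blast
    define E' where "E' = E - B \<inter> B'"
    have "x $ i = 0" if x: "x \<in> mass_polytope E \<B>" and i: "i \<in> B \<inter> B'" for x i
    proof -
      have x': "\<And>i. 0 \<le> x $ i" "\<And>i. i \<notin> E \<Longrightarrow> x $ i = 0" "mass x UNIV = 2" "mass x B \<le> 1" "mass x B' \<le> 1"
        using x B by (auto simp: mass_polytope_def)
      have "mass x UNIV = mass x (B \<union> B')"
        unfolding mass_def using x'(2) B(3) by (intro sum.mono_neutral_right) auto
      then have "mass x (B \<inter> B') \<le> 0" using mass_Un_Int[of x B B'] x' by simp
      moreover have "mass x {i} \<le> mass x (B \<inter> B')" using x'(1) i by (intro mass_mono) auto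
      ultimately show ?thesis using x'(1)[of i] by (simp add: mass_def)
    qed
    then have eq: "mass_polytope E \<B> = mass_polytope E' \<B>"
      unfolding E'_def mass_polytope_def by blast
    have "card E' < card E" using B(4) by (intro psubset_card_mono) (auto simp: E'_def)
    then show ?thesis using less eq by simp
  next
    case False
    then have lam: "B \<inter> E \<subseteq> B' \<or> B' \<inter> E \<subseteq> B" if "B \<in> \<B>" "B' \<in> \<B>" "B \<inter> B' \<inter> E \<noteq> {}" for B B'
      using that compat[OF that(1,2)] unfolding compatible_def by blast
    have eq: "mass_polytope E \<B> = convex hull (e_vec ` {I \<in> two_sets. e_vec I \<in> mass_polytope E \<B>})"
      using mass_polytope_eq_hull[OF sing lam] .
    define R where "R k l \<longleftrightarrow> (\<exists>B\<in>\<B>. k \<in> B \<and> l \<in> B)" for k l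
    have M: "{I \<in> two_sets. e_vec I \<in> mass_polytope E \<B>} =
        {I \<in> two_sets. I \<subseteq> E \<and> (\<forall>k\<in>I. \<forall>l\<in>I. k \<noteq> l \<longrightarrow> \<not> R k l)}"
    proof (intro Collect_cong conj_cong refl)
      fix I :: "'n set" assume I: "I \<in> two_sets"
      obtain i j where ij: "i < j" "I = {i, j}" using two_setsE[OF I] .
      show "e_vec I \<in> mass_polytope E \<B> \<longleftrightarrow> I \<subseteq> E \<and> (\<forall>k\<in>I. \<forall>l\<in>I. k \<noteq> l \<longrightarrow> \<not> R k l)"
        unfolding e_vec_mem_mass_polytope[OF I] using ij by (auto simp: R_def)
    qed
    \<comment> \<open>Nonemptiness yields a vertex, hence the two unrelated elements that rank two
      demands.\<close>
    have "{I \<in> two_sets. e_vec I \<in> mass_polytope E \<B>} \<noteq> {}"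
      using eq less.prems by (metis convex_hull_eq_empty image_empty)
    then obtain I where I: "I \<in> two_sets" "I \<subseteq> E" "\<forall>k\<in>I. \<forall>l\<in>I. k \<noteq> l \<longrightarrow> \<not> R k l"
      unfolding M by (auto simp: set_eq_iff)
    then obtain k0 l0 where kl: "k0 \<in> E" "l0 \<in> E" "\<not> R k0 l0" by (auto elim!: two_setsE)
    have "positroid {I \<in> two_sets. e_vec I \<in> mass_polytope E \<B>}"
      unfolding M
    proof (rule positroid_of_noncrossing_partition[where R = R, OF _ _ _ _ _ kl])
      show "R k k" for k using sing by (auto simp: R_def)
      show "R l k" if "R k l" for k l using that by (auto simp: R_def)
      show "R k m" if "k \<in> E" "l \<in> E" "m \<in> E" and r: "R k l" "R l m" for k l m
      proof -
        obtain B B' where "B \<in> \<B>" "k \<in> B" "l \<in> B" "B' \<in> \<B>" "l \<in> B'" "m \<in> B'"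
          using r by (auto simp: R_def)
        then show ?thesis using lam[of B B'] that unfolding R_def by blast
      qed
      show "R a b \<or> R a d" if lt: "a < b" "b < c" "c < d" and r: "R a c" for a b c d
      proof -
        obtain B where B: "B \<in> \<B>" "a \<in> B" "c \<in> B" using r by (auto simp: R_def)
        then have "b \<in> B \<or> d \<in> B" using cyc[OF B(1)] lt unfolding cyclically_convex_def by blast
        then show ?thesis using B unfolding R_def by blast
      qed
      show "R b a \<or> R b c" if lt: "a < b" "b < c" "c < d" and r: "R b d" for a b c d
      proof -
        obtain B where B: "B \<in> \<B>" "b \<in> B" "d \<in> B" using r by (auto simp: R_def)
        then have "a \<in> B \<or> c \<in> B" using cyc[OF B(1)] lt unfolding cyclically_convex_def by blast
        then show ?thesis using B unfolding R_def by blast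
      qed
    qed
    then show ?thesis using eq unfolding positroid_polytope_def by blast
  qed
qed

subsection \<open>Blades and their cells\<close>

lemma csuc_not_max:
  fixes l :: "'n::{finite,linorder}"
  assumes "l < j"
  shows "l < csuc l" "k < csuc l \<longleftrightarrow> k \<le> l" "csuc l \<le> k \<longleftrightarrow> l < k"
proof -
  have eq: "csuc l = Min {j. l < j}" and ne: "{j. l < j} \<noteq> {}" using assms by (auto simp: csuc_def)
  show 1: "l < csuc l" using Min_in[OF _ ne] by (simp add: eq)
  have 2: "csuc l \<le> k" if "l < k" for k using that by (simp add: eq)
  show "csuc l \<le> k \<longleftrightarrow> l < k" using 1 2 by (meson less_le_trans)
  then show "k < csuc l \<longleftrightarrow> k \<le> l" by (meson not_le)
qed

lemma csuc_max:
  fixes l :: "'n::{finite,linorder}"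
  assumes "\<And>j. j \<le> l"
  shows "csuc l \<le> k"
  using assms by (auto simp: csuc_def not_less[symmetric])

definition cint :: "'n::linorder \<Rightarrow> 'n \<Rightarrow> 'n set" where
  "cint k l = (if k \<le> l then {k..l} else {k..} \<union> {..l})"

lemma cint_csuc:
  fixes k l :: "'n::{finite,linorder}"
  assumes "csuc l \<noteq> k"
  shows "cint k (csuc l) = insert (csuc l) (cint k l)" "csuc l \<notin> cint k l"
proof -
  have "cint k (csuc l) = insert (csuc l) (cint k l) \<and> csuc l \<notin> cint k l"
  proof (cases "\<exists>j. l < j")
    case True
    then obtain j where j: "l < j" by blast
    have c: "x \<le> csuc l \<longleftrightarrow> x = csuc l \<or> x \<le> l" for x using csuc_not_max(2)[OF j, of x] by auto
    show ?thesis using csuc_not_max(1)[OF j] csuc_not_max(3)[OF j] c assms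
      by (auto simp: cint_def)
  next
    case False
    then have "csuc l \<le> x" "x \<le> l" for x using csuc_max[of l x] by (auto simp: not_less)
    then show ?thesis using assms by (auto simp: cint_def intro: antisym)
  qed
  then show "cint k (csuc l) = insert (csuc l) (cint k l)" "csuc l \<notin> cint k l" by auto
qed

lemma cint_csuc_eq_UNIV:
  fixes l :: "'n::{finite,linorder}"
  shows "cint (csuc l) l = UNIV"
proof (cases "\<exists>j. l < j")
  case True
  then obtain j where j: "l < j" by blast
  show ?thesis by (auto simp: cint_def csuc_not_max(3)[OF j])
next
  case False
  then have "csuc l \<le> x" "x \<le> l" for x using csuc_max[of l x] by (auto simp: not_less)
  then show ?thesis by (auto simp: cint_def)
qed

text \<open>Fewer than \<open>CARD('n)\<close> iterates cannot fill the circle, so the next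
  successor has not returned to \<open>k\<close> and extends the interval by a new point.\<close>

lemma csuc_iterates:
  fixes k :: "'n::{finite,linorder}"
  assumes "m < CARD('n)"
  shows "inj_on (\<lambda>t. (csuc ^^ t) k) {..m} \<and> (\<lambda>t. (csuc ^^ t) k) ` {..m} = cint k ((csuc ^^ m) k)"
  using assms
proof (induction m)
  case 0
  then show ?case by (auto simp: cint_def)
next
  case (Suc m)
  let ?l = "(csuc ^^ m) k"
  have IH: "inj_on (\<lambda>t. (csuc ^^ t) k) {..m}" "(\<lambda>t. (csuc ^^ t) k) ` {..m} = cint k ?l"
    using Suc by auto
  have "card (cint k ?l) = Suc m" using card_image[OF IH(1)] IH(2) by simp
  then have "cint k ?l \<noteq> UNIV" using Suc.prems by auto
  then have "csuc ?l \<noteq> k" using cint_csuc_eq_UNIV by metis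
  from cint_csuc[OF this] show ?case using IH by (simp add: atMost_Suc)
qed

lemma csuc_reaches:
  fixes k l :: "'n::{finite,linorder}"
  obtains t where "t < CARD('n)" "l = (csuc ^^ t) k"
proof -
  have p: "CARD('n) > 0" by simp
  define m where "m = CARD('n) - 1"
  have m: "m < CARD('n)" "Suc m = CARD('n)" using p by (auto simp: m_def)
  have "card ((\<lambda>t. (csuc ^^ t) k) ` {..m}) = CARD('n)"
    using csuc_iterates[OF m(1), of k] m(2) by (metis card_image card_atMost)
  then have "(\<lambda>t. (csuc ^^ t) k) ` {..m} = UNIV" by (simp add: card_eq_UNIV_imp_eq_UNIV)
  then have "l \<in> (\<lambda>t. (csuc ^^ t) k) ` {..m}" by blast
  then obtain t where "t \<le> m" "l = (csuc ^^ t) k" by auto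
  then show ?thesis using that m(1) le_less_trans by blast
qed

text \<open>The partial sums along the successor are masses of cyclic intervals starting at
  \<open>k\<close>; the full circle, which also occurs as \<open>cint k l\<close>, has mass
  0.\<close>

lemma blade_cone_iff:
  fixes x :: "real^'n::{finite,linorder}"
  shows "x \<in> blade_cone k \<longleftrightarrow> mass x UNIV = 0 \<and> (\<forall>l. 0 \<le> mass x (cint k l))"
proof -
  have s: "(\<Sum>t<Suc m. x $ ((csuc ^^ t) k)) = mass x (cint k ((csuc ^^ m) k))" if "m < CARD('n)" for m
    using csuc_iterates[OF that, of k] unfolding mass_def lessThan_Suc_atMost
    by (metis (no_types, lifting) sum.reindex_cong)
  have full: "cint k ((csuc ^^ m) k) = UNIV" if "Suc m = CARD('n)" for m
  proof -
    have "card (cint k ((csuc ^^ m) k)) = CARD('n)"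
      using csuc_iterates[of m k] that card_image by fastforce
    then show ?thesis by (simp add: card_eq_UNIV_imp_eq_UNIV)
  qed
  show ?thesis
  proof
    assume L: "x \<in> blade_cone k"
    then have 0: "mass x UNIV = 0" by (simp add: blade_cone_def mass_def)
    have "0 \<le> mass x (cint k l)" for l
    proof -
      obtain t where t: "t < CARD('n)" "l = (csuc ^^ t) k" by (rule csuc_reaches)
      show ?thesis
      proof (cases "Suc t = CARD('n)")
        case True
        then show ?thesis using full[OF True] 0 t by simp
      next
        case False
        then have "Suc t \<in> {1..CARD('n) - 1}" using t by auto
        then show ?thesis using L s[OF t(1)] t(2) unfolding blade_cone_def by fastforce
      qed
    qed
    then show "mass x UNIV = 0 \<and> (\<forall>l. 0 \<le> mass x (cint k l))" using 0 by blast
  next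
    assume R: "mass x UNIV = 0 \<and> (\<forall>l. 0 \<le> mass x (cint k l))"
    have "0 \<le> (\<Sum>t<m. x $ ((csuc ^^ t) k))" if "m \<in> {1..CARD('n) - 1}" for m
      using that s[of "m - 1"] R by auto
    then show "x \<in> blade_cone k" using R by (auto simp: blade_cone_def mass_def)
  qed
qed

lemma hypersimplex_eq: "hypersimplex = mass_polytope UNIV (range (\<lambda>k::'n::{finite,linorder}. {k}))"
proof -
  have "{I \<in> two_sets. e_vec I \<in> mass_polytope UNIV (range (\<lambda>k::'n. {k}))} = two_sets"
    by (auto simp: e_vec_mem_mass_polytope elim!: two_setsE)
  moreover have "mass_polytope UNIV (range (\<lambda>k::'n. {k})) =
      convex hull (e_vec ` {I \<in> two_sets. e_vec I \<in> mass_polytope UNIV (range (\<lambda>k::'n. {k}))})"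
    by (rule mass_polytope_eq_hull) auto
  ultimately show ?thesis by (simp add: hypersimplex_def)
qed

text \<open>The half-open cyclic interval \<open>(i, j]\<close>, for \<open>i \<noteq> j\<close>.\<close>
definition harc :: "'n::linorder \<Rightarrow> 'n \<Rightarrow> 'n set" where
  "harc i j = (if i < j then {i<..j} else - {j<..i})"

text \<open>Walking around from \<open>k\<close>, one meets \<open>j\<close> before
  \<open>i\<close>. By monotonicity of the mass the inequalities bind only at these two stops: mass
  1 up to \<open>j\<close>, and the full mass 2 up to \<open>i\<close>. The latter says that nothing
  sits on the part of \<open>(i, j]\<close> before \<open>k\<close>.\<close>

lemma blade_cone_hypersimplex:
  fixes x :: "real^'n::{finite,linorder}"
  assumes ij: "i \<noteq> j" and k: "k \<in> harc i j" and x: "x \<in> hypersimplex"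
  shows "x - e_vec {i, j} \<in> blade_cone k \<longleftrightarrow>
    1 \<le> mass x (harc i j) \<and> (\<forall>t \<in> harc i j - cint k j. x $ t = 0)"
proof -
  have x0: "\<And>i. 0 \<le> x $ i" and x2: "mass x UNIV = 2"
    using x by (auto simp: hypersimplex_eq mass_polytope_def)
  have jk: "j \<in> cint k l \<Longrightarrow> cint k j \<subseteq> cint k l" and ik: "i \<in> cint k l \<Longrightarrow> cint k i \<subseteq> cint k l"
    and i_j: "i \<in> cint k l \<Longrightarrow> j \<in> cint k l" for l
    using ij k by (auto simp: cint_def harc_def split: if_splits)
  have compl: "- cint k i = harc i j - cint k j" and sub: "cint k j \<subseteq> harc i j" and i_n: "i \<notin> cint k j"
      and jj: "j \<in> cint k j" and ii: "i \<in> cint k i" and ji: "j \<in> cint k i"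
    using ij k by (auto simp: cint_def harc_def split: if_splits)
  have e: "mass (e_vec {i, j}) B = of_bool (i \<in> B) + of_bool (j \<in> B)" for B
    using ij by (auto simp: mass_e_vec Int_insert_left)
  have zero: "(\<forall>t \<in> B. x $ t = 0) \<longleftrightarrow> mass x B \<le> 0" for B
  proof -
    have "mass x B \<ge> 0" using x0 by (simp add: mass_def sum_nonneg)
    moreover have "mass x B = 0 \<longleftrightarrow> (\<forall>t \<in> B. x $ t = 0)"
      unfolding mass_def using x0 by (simp add: sum_nonneg_eq_0_iff)
    ultimately show ?thesis by linarith
  qed
  have split: "mass x (harc i j) = mass x (cint k j) + mass x (harc i j - cint k j)"
    unfolding mass_def using sum.subset_diff[OF sub, of "\<lambda>i. x $ i"] by simp
  have i2: "mass x (cint k i) = 2 - mass x (harc i j - cint k j)"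
    using compl mass_Compl[of x "cint k i"] x2 by simp
  have "x - e_vec {i, j} \<in> blade_cone k \<longleftrightarrow> (\<forall>l. of_bool (i \<in> cint k l) + of_bool (j \<in> cint k l) \<le> mass x (cint k l))"
    using ij by (simp add: blade_cone_iff mass_diff e x2)
  also have "\<dots> \<longleftrightarrow> 1 \<le> mass x (cint k j) \<and> 2 \<le> mass x (cint k i)"
  proof
    assume L: "\<forall>l. of_bool (i \<in> cint k l) + of_bool (j \<in> cint k l) \<le> mass x (cint k l)"
    show "1 \<le> mass x (cint k j) \<and> 2 \<le> mass x (cint k i)"
      using L[rule_format, of j] L[rule_format, of i] i_n jj ii ji by simp
  next
    assume R: "1 \<le> mass x (cint k j) \<and> 2 \<le> mass x (cint k i)"
    show "\<forall>l. of_bool (i \<in> cint k l) + of_bool (j \<in> cint k l) \<le> mass x (cint k l)"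
    proof
      fix l
      consider "i \<in> cint k l" | "i \<notin> cint k l" "j \<in> cint k l" | "i \<notin> cint k l" "j \<notin> cint k l" by blast
      then show "of_bool (i \<in> cint k l) + of_bool (j \<in> cint k l) \<le> mass x (cint k l)"
      proof cases
        case 1
        then show ?thesis using i_j[OF 1] R mass_mono[of x, OF x0 ik[OF 1]] by simp
      next
        case 2
        then show ?thesis using R mass_mono[of x, OF x0 jk[OF 2(2)]] by simp
      next
        case 3
        then show ?thesis using x0 by (simp add: mass_def sum_nonneg)
      qed
    qed
  qed
  also have "\<dots> \<longleftrightarrow> 1 \<le> mass x (harc i j) \<and> mass x (harc i j - cint k j) \<le> 0"
  proof -
    have "0 \<le> mass x (harc i j - cint k j)" using x0 by (simp add: mass_def sum_nonneg)
    then show ?thesis using split i2 by linarith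
  qed
  finally show ?thesis unfolding zero .
qed

section \<open>Halves of splits and the cells they cut out\<close>

definition chord_arc :: "'n::{finite,linorder} set \<Rightarrow> 'n set" where
  "chord_arc J = {Min J<..Max J}"

lemma chord_arc_doubleton: "i < j \<Longrightarrow> chord_arc {i, j} = {i<..j}"
  by (auto simp: chord_arc_def min_def max_def)

text \<open>Of the two arcs between the ends of a chord, \<open>chord_arc\<close> is the one that
  does not wrap around. In a cell the selected arc is the light one, with mass at most 1, and its
  complement has mass at least 1.\<close>

definition signed_arc :: "bool \<Rightarrow> 'n::{finite,linorder} set \<Rightarrow> 'n set" where
  "signed_arc s J = (if s then chord_arc J else - chord_arc J)"

definition cell :: "'n::{finite,linorder} set set \<Rightarrow> ('n set \<Rightarrow> bool) \<Rightarrow> (real^'n::{finite,linorder}) set" where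
  "cell W \<sigma> = mass_polytope UNIV (range (\<lambda>k. {k}) \<union> (\<lambda>J. signed_arc (\<sigma> J) J) ` W)"

lemma cell_eq: "cell W \<sigma> = {x \<in> hypersimplex. \<forall>J\<in>W. mass x (signed_arc (\<sigma> J) J) \<le> 1}"
  by (auto simp: cell_def hypersimplex_eq mass_polytope_def)

lemma convex_cell: "convex (cell W \<sigma>)"
  unfolding cell_def by (rule convex_mass_polytope)

lemma cell_face_of_refl: "cell W \<sigma> face_of cell W \<sigma>"
  by (simp add: face_of_refl_eq convex_cell)

definition blade_cell :: "'n::{finite,linorder} set set \<Rightarrow> ('n set \<Rightarrow> 'n) \<Rightarrow> (real^'n::{finite,linorder}) set" where
  "blade_cell S f = hypersimplex \<inter> (\<Inter>J\<in>S. (+) (e_vec J) ` blade_cone (f J))"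

lemma in_translation_iff: "x \<in> (+) a ` S \<longleftrightarrow> x - a \<in> S" for a :: "'a::ab_group_add"
  by (metis add.commute add_diff_cancel_left' diff_add_cancel image_iff)

lemma blade_cell_iff:
  "x \<in> blade_cell S f \<longleftrightarrow> x \<in> hypersimplex \<and> (\<forall>J\<in>S. x - e_vec J \<in> blade_cone (f J))"
  unfolding blade_cell_def by (simp add: in_translation_iff del: image_add_0)

lemma mass_signed_arc:
  assumes "x \<in> hypersimplex"
  shows "mass x (signed_arc (\<not> s) J) = 2 - mass x (signed_arc s J)"
  using assms by (auto simp: signed_arc_def mass_Compl hypersimplex_eq mass_polytope_def)

text \<open>Every translated cone is half of the split, possibly with further coordinates forced to
  vanish. The heavy arc is the one containing \<open>k\<close>.\<close>

lemma blade_slice: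
  fixes J :: "'n::{finite,linorder} set" and k :: 'n
  assumes "J \<in> two_sets"
  obtains T where "\<And>x. x \<in> hypersimplex \<Longrightarrow> x - e_vec J \<in> blade_cone k \<longleftrightarrow>
    mass x (signed_arc (k \<notin> chord_arc J) J) \<le> 1 \<and> (\<forall>t\<in>T. x $ t = 0)"
proof -
  obtain i j where ij: "i < j" "J = {i, j}" using two_setsE[OF assms] .
  show ?thesis
  proof (cases "k \<in> chord_arc J")
    case True
    then have k: "k \<in> harc i j" using ij by (simp add: chord_arc_doubleton harc_def)
    show ?thesis
    proof (rule that[of "harc i j - cint k j"])
      fix x :: "real^'n::{finite,linorder}" assume x: "x \<in> hypersimplex"
      have "harc i j = signed_arc True J" using ij by (simp add: harc_def signed_arc_def chord_arc_doubleton)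
      then show "x - e_vec J \<in> blade_cone k \<longleftrightarrow>
         mass x (signed_arc (k \<notin> chord_arc J) J) \<le> 1 \<and> (\<forall>t\<in>harc i j - cint k j. x $ t = 0)"
        using blade_cone_hypersimplex[OF _ k x] ij True mass_signed_arc[OF x, of True] by auto
    qed
  next
    case False
    then have k: "k \<in> harc j i" using ij by (simp add: chord_arc_doubleton harc_def)
    show ?thesis
    proof (rule that[of "harc j i - cint k i"])
      fix x :: "real^'n::{finite,linorder}" assume x: "x \<in> hypersimplex"
      have "harc j i = signed_arc False J" using ij by (simp add: harc_def signed_arc_def chord_arc_doubleton)
      then show "x - e_vec J \<in> blade_cone k \<longleftrightarrow>
         mass x (signed_arc (k \<notin> chord_arc J) J) \<le> 1 \<and> (\<forall>t\<in>harc j i - cint k i. x $ t = 0)"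
        using blade_cone_hypersimplex[OF _ k x] ij False mass_signed_arc[OF x, of False]
        by (auto simp: insert_commute)
    qed
  qed
qed

text \<open>Starting right after an end of the chord leaves no coordinate that must vanish, so each
  full half of the split occurs as a cone.\<close>

lemma blade_slice_exact:
  fixes J :: "'n::{finite,linorder} set"
  assumes "J \<in> two_sets"
  obtains k where "\<And>x. x \<in> hypersimplex \<Longrightarrow> x - e_vec J \<in> blade_cone k \<longleftrightarrow>
    mass x (signed_arc s J) \<le> 1"
proof -
  obtain i j where ij: "i < j" "J = {i, j}" using two_setsE[OF assms] .
  have exact: "harc i j - cint (csuc i) j = {}" "csuc i \<in> harc i j" if "i \<noteq> j" for i j :: 'n
  proof -
    have "harc i j - cint (csuc i) j = {} \<and> csuc i \<in> harc i j"
    proof (cases "\<exists>l. i < l")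
      case True
      then obtain l where l: "i < l" by blast
      show ?thesis using that csuc_not_max(1)[OF l]
        by (auto simp: harc_def cint_def csuc_not_max(2,3)[OF l])
    next
      case False
      then have "csuc i \<le> x" "x \<le> i" for x using csuc_max[of i x] by (auto simp: not_less)
      then show ?thesis using that by (auto simp: harc_def cint_def not_less antisym)
    qed
    then show "harc i j - cint (csuc i) j = {}" "csuc i \<in> harc i j" by auto
  qed
  show ?thesis
  proof (cases s)
    case False
    have "harc i j = signed_arc True J" using ij by (simp add: harc_def signed_arc_def chord_arc_doubleton)
    then show ?thesis
      using that[of "csuc i"] blade_cone_hypersimplex[OF _ exact(2), of i j] exact(1)[of i j] ij False
        mass_signed_arc[of _ True J] by auto
  next
    case True
    have "harc j i = signed_arc False J" using ij by (simp add: harc_def signed_arc_def chord_arc_doubleton)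
    then show ?thesis
      using that[of "csuc j"] blade_cone_hypersimplex[OF _ exact(2), of j i] exact(1)[of j i] ij True
        mass_signed_arc[of _ False J] by (auto simp: insert_commute)
  qed
qed

lemma blade_cell_eq_cell:
  assumes "W \<subseteq> two_sets"
  obtains f where "blade_cell W f = cell W \<sigma>"
proof -
  have "\<forall>J\<in>W. \<exists>k. \<forall>x \<in> hypersimplex. x - e_vec J \<in> blade_cone k \<longleftrightarrow> mass x (signed_arc (\<sigma> J) J) \<le> 1"
  proof
    fix J assume "J \<in> W"
    then have "J \<in> two_sets" using assms by blast
    then show "\<exists>k. \<forall>x \<in> hypersimplex. x - e_vec J \<in> blade_cone k \<longleftrightarrow> mass x (signed_arc (\<sigma> J) J) \<le> 1"
      by (rule blade_slice_exact) blast
  qed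
  then obtain f where f: "\<forall>J\<in>W. \<forall>x \<in> hypersimplex. x - e_vec J \<in> blade_cone (f J) \<longleftrightarrow> mass x (signed_arc (\<sigma> J) J) \<le> 1"
    by (auto simp: bchoice_iff)
  then have "blade_cell W f = cell W \<sigma>" by (auto simp: blade_cell_iff cell_eq)
  then show ?thesis using that by blast
qed

lemma blade_cell_face_of_cell:
  assumes "W \<subseteq> two_sets"
  shows "blade_cell W f face_of cell W (\<lambda>J. f J \<notin> chord_arc J)"
proof -
  have "\<forall>J\<in>W. \<exists>T. \<forall>x \<in> hypersimplex. x - e_vec J \<in> blade_cone (f J) \<longleftrightarrow>
      mass x (signed_arc (f J \<notin> chord_arc J) J) \<le> 1 \<and> (\<forall>t\<in>T. x $ t = 0)"
  proof
    fix J assume "J \<in> W"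
    then have "J \<in> two_sets" using assms by blast
    then show "\<exists>T. \<forall>x \<in> hypersimplex. x - e_vec J \<in> blade_cone (f J) \<longleftrightarrow>
      mass x (signed_arc (f J \<notin> chord_arc J) J) \<le> 1 \<and> (\<forall>t\<in>T. x $ t = 0)"
      by (rule blade_slice) blast
  qed
  then obtain T where T: "\<forall>J\<in>W. \<forall>x \<in> hypersimplex. x - e_vec J \<in> blade_cone (f J) \<longleftrightarrow>
      mass x (signed_arc (f J \<notin> chord_arc J) J) \<le> 1 \<and> (\<forall>t\<in>T J. x $ t = 0)"
    unfolding bchoice_iff by blast
  define U where "U = (\<Union>J\<in>W. T J)"
  let ?D = "cell W (\<lambda>J. f J \<notin> chord_arc J)"
  have pos: "0 \<le> x $ i" if "x \<in> ?D" for x i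
    using that by (auto simp: cell_def mass_polytope_def)
  have "mass x U = 0 \<longleftrightarrow> (\<forall>t\<in>U. x $ t = 0)" if "x \<in> ?D" for x
    unfolding mass_def using pos[OF that] by (simp add: sum_nonneg_eq_0_iff)
  \<comment> \<open>All forced zeros amount to the single equation \<open>mass x U = 0\<close>,
    whose hyperplane supports the cell because coordinates are nonnegative.\<close>
  then have "blade_cell W f = ?D \<inter> {x. e_vec U \<bullet> x = 0}"
    using T by (auto simp: blade_cell_iff cell_eq U_def mass_as_inner[symmetric])
  also have "\<dots> face_of ?D"
  proof (rule face_of_Int_supporting_hyperplane_ge)
    show "convex ?D" by (rule convex_cell)
    show "0 \<le> e_vec U \<bullet> x" if "x \<in> ?D" for x
      using pos[OF that] by (simp add: mass_as_inner[symmetric] mass_def sum_nonneg)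
  qed
  finally show ?thesis .
qed

text \<open>An arbitrary index function yields only a face of a cell, while every cell is itself
  attained; by transitivity of faces the same sets arise.\<close>

lemma blade_subdivision_eq:
  assumes "W \<subseteq> two_sets"
  shows "blade_subdivision W = {F. F \<noteq> {} \<and> (\<exists>\<sigma>. F face_of cell W \<sigma>)}"
  unfolding blade_subdivision_def blade_cell_def[symmetric]
  using blade_cell_face_of_cell[OF assms] blade_cell_eq_cell[OF assms]
  by (metis (no_types, lifting) face_of_trans)

section \<open>Weakly separated blades give positroid subdivisions\<close>

lemma weakly_separated_doubletons:
  assumes "i < j" "k < l"
  shows "weakly_separated {i, j} {k, l} \<longleftrightarrow> \<not> (i < k \<and> k < j \<and> j < l) \<and> \<not> (k < i \<and> i < l \<and> l < j)"
proof -
  have False if "weakly_separated {i, j} {k, l}" "i < k" "k < j" "j < l"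
    using that unfolding weakly_separated_def
    by (elim notE, intro exI[of _ i] exI[of _ k] exI[of _ j] exI[of _ l])
      (auto simp: cyclically_ordered_def)
  moreover have False if "weakly_separated {i, j} {k, l}" "k < i" "i < l" "l < j"
    using that unfolding weakly_separated_def
    by (elim notE, intro exI[of _ i] exI[of _ l] exI[of _ j] exI[of _ k])
      (auto simp: cyclically_ordered_def)
  moreover have "weakly_separated {i, j} {k, l}"
    if "\<not> (i < k \<and> k < j \<and> j < l)" "\<not> (k < i \<and> i < l \<and> l < j)"
    using that assms unfolding weakly_separated_def cyclically_ordered_def by auto
  ultimately show ?thesis by blast
qed

lemma compatible_arcs:
  assumes "I \<in> two_sets" "J \<in> two_sets" "weakly_separated I J"
  shows "compatible (chord_arc I) (chord_arc J)"
proof -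
  obtain i j k l where *: "i < j" "I = {i, j}" "k < l" "J = {k, l}"
    using assms(1,2) by (metis two_sets_iff)
  then have "\<not> (i < k \<and> k < j \<and> j < l) \<and> \<not> (k < i \<and> i < l \<and> l < j)"
    using assms(3) weakly_separated_doubletons by blast
  then have "j \<le> k \<or> l \<le> i \<or> (i \<le> k \<and> l \<le> j) \<or> (k \<le> i \<and> j \<le> l)" by force
  then show ?thesis using * by (auto simp: chord_arc_doubleton compatible_def)
qed

lemma mem_Un_uminus_image: "B \<in> S \<union> uminus ` S \<Longrightarrow> \<exists>C\<in>S. B = C \<or> B = - C"
  by blast

text \<open>A face adds only complements of the sets defining the cell, and both compatibility and
  cyclic convexity survive complementation.\<close>

lemma positroid_polytope_face_of_cell:
  assumes W: "w_collection W" and F: "F face_of cell W \<sigma>" "F \<noteq> {}"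
  shows "positroid_polytope F"
proof -
  let ?B = "range (\<lambda>k. {k}) \<union> (\<lambda>J. signed_arc (\<sigma> J) J) ` W"
  obtain E \<B> where E: "F = mass_polytope E \<B>" "?B \<subseteq> \<B>" "\<B> \<subseteq> ?B \<union> uminus ` ?B"
    using face_of_mass_polytope[OF F[unfolded cell_def]] .
  have W': "W \<subseteq> two_sets" "\<And>I J. I \<in> W \<Longrightarrow> J \<in> W \<Longrightarrow> weakly_separated I J"
    using W by (auto simp: w_collection_def)
  have c1: "compatible B B'" if "B \<in> ?B" "B' \<in> ?B" for B B'
  proof -
    have "compatible (signed_arc s I) (signed_arc s' J)" if "I \<in> W" "J \<in> W" for I J s s'
      using compatible_arcs[of I J] W' that by (auto simp: signed_arc_def compatible_uminus)
    then show ?thesis using that by (auto simp: compatible_singleton)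
  qed
  have cyc1: "cyclically_convex B" if "B \<in> ?B" for B
    using that by (auto simp: cyclically_convex_singleton cyclically_convex_uminus
        cyclically_convex_interval signed_arc_def chord_arc_def)
  have orig: "\<exists>C\<in>?B. B = C \<or> B = - C" if "B \<in> \<B>" for B
    using mem_Un_uminus_image[OF subsetD[OF E(3) that]] .
  have "compatible B B'" if B: "B \<in> \<B>" "B' \<in> \<B>" for B B'
  proof -
    obtain C C' where "C \<in> ?B" "B = C \<or> B = - C" "C' \<in> ?B" "B' = C' \<or> B' = - C'"
      using orig[OF B(1)] orig[OF B(2)] by (elim bexE)
    then show ?thesis using c1[of C C'] by (auto simp: compatible_uminus)
  qed
  moreover have "cyclically_convex B" if B: "B \<in> \<B>" for B
  proof -
    obtain C where "C \<in> ?B" "B = C \<or> B = - C" using orig[OF B] by (elim bexE)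
    then show ?thesis using cyc1[of C] by (auto simp: cyclically_convex_uminus)
  qed
  moreover have "{k} \<in> \<B>" for k using E(2) by blast
  ultimately show ?thesis
    using F(2) positroid_polytope_mass_polytope unfolding E(1) by blast
qed

lemma positroid_polytope_eq_hull:
  assumes "positroid_polytope P"
  obtains M where "positroid M" "M \<subseteq> two_sets" "P = convex hull (e_vec ` M)"
  using assms by (auto simp: positroid_polytope_def positroid_def)

text \<open>Where the side choices disagree, both arcs have mass at most 1 and together 2, so
  equality holds; each such equation is a supporting hyperplane.\<close>

lemma cell_Int_face_of: "cell W \<sigma> \<inter> cell W \<tau> face_of cell W \<sigma>"
proof -
  let ?N = "{J \<in> W. \<sigma> J \<noteq> \<tau> J}"
  have "cell W \<sigma> \<inter> cell W \<tau> = cell W \<sigma> \<inter> (\<Inter>J\<in>?N. cell W \<sigma> \<inter> {x. e_vec (signed_arc (\<sigma> J) J) \<bullet> x = 1})"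
  proof (intro set_eqI)
    fix x
    have *: "mass x (signed_arc (\<tau> J) J) = (if \<sigma> J = \<tau> J then mass x (signed_arc (\<sigma> J) J)
        else 2 - mass x (signed_arc (\<sigma> J) J))" if "x \<in> hypersimplex" for J
      using mass_signed_arc[OF that, of "\<sigma> J" J] by (cases "\<sigma> J"; cases "\<tau> J") auto
    show "x \<in> cell W \<sigma> \<inter> cell W \<tau> \<longleftrightarrow>
        x \<in> cell W \<sigma> \<inter> (\<Inter>J\<in>?N. cell W \<sigma> \<inter> {x. e_vec (signed_arc (\<sigma> J) J) \<bullet> x = 1})"
    proof (cases "x \<in> cell W \<sigma>")
      case True
      then have x: "x \<in> hypersimplex" and \<sigma>: "\<And>J. J \<in> W \<Longrightarrow> mass x (signed_arc (\<sigma> J) J) \<le> 1"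
        by (auto simp: cell_eq)
      have key: "mass x (signed_arc (\<tau> J) J) \<le> 1 \<longleftrightarrow> \<sigma> J = \<tau> J \<or> mass x (signed_arc (\<sigma> J) J) = 1"
        if "J \<in> W" for J
        using *[OF x, of J] \<sigma>[OF that] by (cases "\<sigma> J = \<tau> J") auto
      have "x \<in> cell W \<tau> \<longleftrightarrow> (\<forall>J\<in>W. mass x (signed_arc (\<tau> J) J) \<le> 1)"
        using x by (simp add: cell_eq)
      also have "\<dots> \<longleftrightarrow> (\<forall>J\<in>?N. mass x (signed_arc (\<sigma> J) J) = 1)"
        using key by blast
      finally show ?thesis unfolding mass_as_inner using True by blast
    qed simp
  qed
  also have "\<dots> face_of cell W \<sigma>"
  proof (cases "?N = {}")
    case True
    then show ?thesis by (auto simp: cell_face_of_refl)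
  next
    case False
    have "(\<Inter>J\<in>?N. cell W \<sigma> \<inter> {x. e_vec (signed_arc (\<sigma> J) J) \<bullet> x = 1}) face_of cell W \<sigma>"
    proof (rule face_of_Inter)
      fix T assume "T \<in> (\<lambda>J. cell W \<sigma> \<inter> {x. e_vec (signed_arc (\<sigma> J) J) \<bullet> x = 1}) ` ?N"
      then obtain J where J: "J \<in> W" "T = cell W \<sigma> \<inter> {x. e_vec (signed_arc (\<sigma> J) J) \<bullet> x = 1}" by blast
      show "T face_of cell W \<sigma>"
        unfolding J(2)
      proof (rule face_of_Int_supporting_hyperplane_le)
        show "convex (cell W \<sigma>)" by (rule convex_cell)
        show "e_vec (signed_arc (\<sigma> J) J) \<bullet> x \<le> 1" if "x \<in> cell W \<sigma>" for x
          using that J(1) by (auto simp: cell_eq mass_as_inner[symmetric])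
      qed
    qed (use False in auto)
    then show ?thesis by (intro face_of_Int) (auto simp: cell_face_of_refl)
  qed
  finally show ?thesis .
qed

lemma cells_cover:
  assumes "x \<in> hypersimplex"
  obtains \<sigma> where "x \<in> cell W \<sigma>"
proof
  show "x \<in> cell W (\<lambda>J. mass x (chord_arc J) \<le> 1)"
    using assms mass_signed_arc[OF assms, of True] by (auto simp: cell_eq signed_arc_def)
qed

lemma positroid_subdivision_blade_subdivision:
  assumes W: "w_collection W"
  shows "positroid_subdivision (blade_subdivision W)"
proof -
  have eq: "blade_subdivision W = {F. F \<noteq> {} \<and> (\<exists>\<sigma>. F face_of cell W \<sigma>)}"
    using W blade_subdivision_eq by (auto simp: w_collection_def)
  have pos: "positroid_polytope F" if "F \<noteq> {}" "F face_of cell W \<sigma>" for F \<sigma>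
    using positroid_polytope_face_of_cell[OF W] that by blast
  have poly: "polytope F" if "positroid_polytope F" for F
    by (rule positroid_polytope_eq_hull[OF that]) (simp add: polytope_convex_hull)
  have fin: "finite {F. F face_of cell W \<sigma>}" for \<sigma>
  proof (cases "cell W \<sigma> = {}")
    case False
    then have "polytope (cell W \<sigma>)"
      using poly pos[OF False, of \<sigma>] by (simp add: cell_face_of_refl)
    then show ?thesis by (rule finite_polytope_faces)
  qed (simp add: face_of_empty cong: Collect_cong)
  have "finite (\<Union>\<sigma>. {F. F face_of cell W \<sigma>})" using fin by simp
  then have 1: "finite (blade_subdivision W)"
    by (rule finite_subset[rotated]) (auto simp: eq)
  have 2: "\<Union>(blade_subdivision W) = hypersimplex"
  proof
    show "\<Union>(blade_subdivision W) \<subseteq> hypersimplex"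
      unfolding eq by (auto simp: cell_eq dest!: face_of_imp_subset)
    show "hypersimplex \<subseteq> \<Union>(blade_subdivision W)"
    proof
      fix x assume "x \<in> (hypersimplex :: (real^'a::{finite,linorder}) set)"
      then obtain \<sigma> where "x \<in> cell W \<sigma>" using cells_cover by blast
      moreover have "cell W \<sigma> face_of cell W \<sigma>" by (simp add: cell_face_of_refl)
      ultimately show "x \<in> \<Union>(blade_subdivision W)" unfolding eq by blast
    qed
  qed
  have 3: "F \<inter> G face_of F" if F: "F face_of cell W \<sigma>" and G: "G face_of cell W \<tau>" for F G \<sigma> \<tau>
  proof -
    \<comment> \<open>Faces of different cells are compared inside \<open>?D\<close>: slicing both
      by \<open>?D\<close> gives faces of \<open>?D\<close>, and their intersection is then a face
      of \<open>cell W \<sigma>\<close>.\<close>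
    let ?D = "cell W \<sigma> \<inter> cell W \<tau>"
    have "F \<inter> ?D = F \<inter> cell W \<tau>" "G \<inter> ?D = G \<inter> cell W \<sigma>"
      using face_of_imp_subset[OF F] face_of_imp_subset[OF G] by blast+
    then have "F \<inter> ?D face_of ?D" "G \<inter> ?D face_of ?D"
      using face_of_slice[OF F convex_cell[of W \<tau>]] face_of_slice[OF G convex_cell[of W \<sigma>]]
      by (simp_all add: Int_commute)
    then have "(F \<inter> ?D) \<inter> (G \<inter> ?D) face_of ?D" by (rule face_of_Int)
    moreover have "(F \<inter> ?D) \<inter> (G \<inter> ?D) = F \<inter> G"
      using face_of_imp_subset[OF F] face_of_imp_subset[OF G] by blast
    ultimately have "F \<inter> G face_of cell W \<sigma>" using cell_Int_face_of[of W \<sigma> \<tau>] face_of_trans by fastforce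
    then show ?thesis using face_of_subset[OF _ _ face_of_imp_subset[OF F]] by blast
  qed
  have 4: "G \<in> blade_subdivision W" if "F \<in> blade_subdivision W" "G face_of F" "G \<noteq> {}" for F G
    using that face_of_trans unfolding eq by blast
  have 5: "positroid_polytope F" "polytope F" "F \<noteq> {}" if "F \<in> blade_subdivision W" for F
    using that pos poly unfolding eq by blast+
  have 6: "F \<inter> G face_of F \<and> F \<inter> G face_of G" if FG: "F \<in> blade_subdivision W" "G \<in> blade_subdivision W" for F G
  proof -
    obtain \<sigma> \<tau> where "F face_of cell W \<sigma>" "G face_of cell W \<tau>" using FG unfolding eq by blast
    then show ?thesis using 3[of F \<sigma> G \<tau>] 3[of G \<tau> F \<sigma>] by (simp add: Int_commute)
  qed
  show ?thesis
    unfolding positroid_subdivision_def polyhedral_subdivision_def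
    using 1 2 4 5 6 by blast
qed


section \<open>Crossing blades never give a positroid subdivision\<close>

lemma mass_e_vec_doubleton:
  "i \<noteq> j \<Longrightarrow> mass (e_vec {i, j}) B = of_bool (i \<in> B) + of_bool (j \<in> B)"
  by (auto simp: mass_e_vec Int_insert_left)

lemma convex_hull_e_vec:
  assumes "x \<in> convex hull (e_vec ` M)"
  obtains \<mu> where "\<And>I. I \<in> M \<Longrightarrow> 0 \<le> \<mu> I" "sum \<mu> M = 1" "x = (\<Sum>I\<in>M. \<mu> I *\<^sub>R e_vec I)"
proof -
  have inj: "inj_on e_vec M" by (auto simp: inj_on_def e_vec_inj)
  obtain u where u: "\<forall>v\<in>e_vec ` M. 0 \<le> u v" "sum u (e_vec ` M) = 1"
      "(\<Sum>v\<in>e_vec ` M. u v *\<^sub>R v) = x"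
    using assms unfolding convex_hull_finite[OF finite_imageI[OF finite]] by blast
  show ?thesis
    by (rule that[of "u \<circ> e_vec"]) (use u in \<open>auto simp: sum.reindex[OF inj] comp_def\<close>)
qed

text \<open>The weighted slacks are nonnegative and sum to zero.\<close>

lemma convex_combination_tight:
  fixes f :: "'a \<Rightarrow> real"
  assumes "finite M" "\<And>I. I \<in> M \<Longrightarrow> 0 \<le> \<mu> I" "sum \<mu> M = 1" "\<And>I. I \<in> M \<Longrightarrow> f I \<le> \<kappa>"
    "(\<Sum>I\<in>M. \<mu> I * f I) = \<kappa>" "I \<in> M" "\<mu> I > 0"
  shows "f I = \<kappa>"
proof -
  have "(\<Sum>I\<in>M. \<mu> I * (\<kappa> - f I)) = 0"
    using assms(3,5) by (simp add: right_diff_distrib sum_subtractf sum_distrib_right[symmetric])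
  then have "\<mu> I * (\<kappa> - f I) = 0"
    using assms by (subst (asm) sum_nonneg_eq_0_iff) auto
  then show ?thesis using assms(7) by simp
qed

text \<open>Both splits are tight at the midpoint \<open>m\<close>, so every vertex of positive
  weight in \<open>m\<close> meets each arc exactly once. This leaves only the two crossing sets.
  Either pair of vertices that the Pluecker relation then demands has a member lying wholly inside
  the light arc of one of the splits.\<close>

lemma crossing_blades_not_positroid:
  fixes a b c d :: "'n::{finite,linorder}"
  assumes S: "S \<subseteq> two_sets" and pos: "positroid_subdivision (blade_subdivision S)"
    and lt: "a < b" "b < c" "c < d" and mem: "{a, c} \<in> S" "{b, d} \<in> S"
  shows False
proof -
  define m :: "real^'n::{finite,linorder}" where "m = (1/2) *\<^sub>R e_vec {a, c} + (1/2) *\<^sub>R e_vec {b, d}"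
  have ne: "a \<noteq> b" "a \<noteq> c" "a \<noteq> d" "b \<noteq> c" "b \<noteq> d" "c \<noteq> d" using lt by auto
  have mm: "mass m B = (of_bool (a \<in> B) + of_bool (b \<in> B) + of_bool (c \<in> B) + of_bool (d \<in> B)) / 2" for B
    using ne unfolding m_def mass_add mass_scaleR by (simp add: mass_e_vec_doubleton field_simps)
  have "m \<in> hypersimplex"
    unfolding m_def hypersimplex_def
    by (intro convexD[OF convex_convex_hull] hull_inc) (use ne in auto)
  then have "m \<in> \<Union>(blade_subdivision S)"
    using pos by (simp add: positroid_subdivision_def polyhedral_subdivision_def)
  then obtain F f where F: "m \<in> F" "F face_of blade_cell S f"
    unfolding blade_subdivision_def blade_cell_def by blast
  define C where "C = blade_cell S f"
  have mC: "m \<in> C" using F face_of_imp_subset by (auto simp: C_def)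
  have "C face_of C"
    using blade_cell_face_of_cell[OF S, of f] by (simp add: C_def face_of_refl_eq face_of_imp_convex)
  then have "C \<in> blade_subdivision S"
    using mC by (auto simp: blade_subdivision_def blade_cell_def[symmetric] C_def)
  then have "positroid_polytope C" using pos by (auto simp: positroid_subdivision_def)
  then obtain M where M: "positroid M" "M \<subseteq> two_sets" "C = convex hull (e_vec ` M)"
    by (rule positroid_polytope_eq_hull)
  have eC: "e_vec I \<in> C" if "I \<in> M" for I using that M(3) by (simp add: hull_inc)
  have side: "\<exists>s. \<forall>x\<in>C. mass x (signed_arc s J) \<le> 1" if J: "J \<in> S" for J
  proof -
    obtain T where T: "\<And>x. x \<in> hypersimplex \<Longrightarrow> x - e_vec J \<in> blade_cone (f J) \<longleftrightarrow>
      mass x (signed_arc (f J \<notin> chord_arc J) J) \<le> 1 \<and> (\<forall>t\<in>T. x $ t = 0)"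
      using blade_slice[of J "f J"] J S by blast
    show ?thesis
    proof (intro exI ballI)
      fix x assume "x \<in> C"
      then have "x \<in> hypersimplex" "x - e_vec J \<in> blade_cone (f J)"
        using J by (auto simp: C_def blade_cell_iff)
      then show "mass x (signed_arc (f J \<notin> chord_arc J) J) \<le> 1" using T by blast
    qed
  qed
  obtain s1 s2 where s: "\<And>x. x \<in> C \<Longrightarrow> mass x (signed_arc s1 {a, c}) \<le> 1"
     "\<And>x. x \<in> C \<Longrightarrow> mass x (signed_arc s2 {b, d}) \<le> 1"
    using side mem by meson
  define A1 where "A1 = signed_arc s1 {a, c}"
  define A2 where "A2 = signed_arc s2 {b, d}"
  have A1: "(a \<notin> A1 \<and> b \<in> A1 \<and> c \<in> A1 \<and> d \<notin> A1) \<or> (a \<in> A1 \<and> b \<notin> A1 \<and> c \<notin> A1 \<and> d \<in> A1)"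
    using lt by (auto simp: A1_def signed_arc_def chord_arc_doubleton)
  have A2: "(a \<notin> A2 \<and> b \<notin> A2 \<and> c \<in> A2 \<and> d \<in> A2) \<or> (a \<in> A2 \<and> b \<in> A2 \<and> c \<notin> A2 \<and> d \<notin> A2)"
    using lt by (auto simp: A2_def signed_arc_def chord_arc_doubleton)
  obtain \<mu> where \<mu>: "\<And>I. I \<in> M \<Longrightarrow> 0 \<le> \<mu> I" "sum \<mu> M = 1" "m = (\<Sum>I\<in>M. \<mu> I *\<^sub>R e_vec I)"
    using convex_hull_e_vec[of m M] mC M(3) by blast
  have tight: "mass (e_vec I) B = mass m B"
    if "I \<in> M" "\<mu> I > 0" "\<And>I. I \<in> M \<Longrightarrow> mass (e_vec I) B \<le> mass m B" for I B
  proof (rule convex_combination_tight[of M \<mu> "\<lambda>I. mass (e_vec I) B"])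
    show "(\<Sum>I\<in>M. \<mu> I * mass (e_vec I) B) = mass m B"
      unfolding \<mu>(3) mass_as_inner by (simp add: inner_sum_right)
  qed (use that \<mu> in auto)
  have only: "I = {a, c} \<or> I = {b, d}" if I: "I \<in> M" "\<mu> I > 0" for I
  proof -
    obtain i j where ij: "i < j" "I = {i, j}" using I M(2) two_setsE by blast
    \<comment> \<open>The mass of \<open>m\<close> on the four points is already the maximum 2, so
      every contributing vertex is supported there.\<close>
    have "mass (e_vec I) {a, b, c, d} = 2"
    proof (subst tight[OF I])
      fix K assume "K \<in> M"
      then have "card K = 2" "finite K" using M(2) by (auto simp: two_sets_def)
      then have "real (card (K \<inter> {a, b, c, d})) \<le> 2"
        using card_mono[of K "K \<inter> {a, b, c, d}"] by simp
      then show "mass (e_vec K) {a, b, c, d} \<le> mass m {a, b, c, d}"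
        unfolding mass_e_vec by (simp add: mm)
    qed (simp add: mm)
    then have i4: "i \<in> {a, b, c, d}" "j \<in> {a, b, c, d}"
      unfolding ij(2) mass_e_vec_doubleton[OF less_imp_neq[OF ij(1)]]
      by (simp_all only: of_bool_def split: if_splits)
    have "mass m A1 = 1" "mass m A2 = 1" using A1 A2 by (auto simp: mm)
    then have "mass (e_vec I) A1 = 1" "mass (e_vec I) A2 = 1"
      using tight[OF I] s eC unfolding A1_def[symmetric] A2_def[symmetric] by metis+
    then have "(i \<in> A1) \<noteq> (j \<in> A1)" "(i \<in> A2) \<noteq> (j \<in> A2)"
      unfolding ij(2) mass_e_vec_doubleton[OF less_imp_neq[OF ij(1)]]
      by (auto simp: of_bool_def split: if_splits)
    with i4 show ?thesis unfolding ij(2) insert_iff empty_iff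
      using A1 A2 by (elim disjE) (simp_all add: insert_commute)
  qed
  have exI: "\<exists>I\<in>M. \<mu> I > 0 \<and> t \<in> I" if t: "m $ t > 0" for t
  proof (rule ccontr)
    assume "\<not> ?thesis"
    then have "\<mu> I * e_vec I $ t = 0" if "I \<in> M" for I
      using \<mu>(1)[OF that] that by (auto simp: e_vec_nth less_le)
    then have "(\<Sum>I\<in>M. \<mu> I * e_vec I $ t) = 0" by (intro sum.neutral) blast
    then have "m $ t = 0" unfolding \<mu>(3) by simp
    then show False using t by simp
  qed
  have "m $ a > 0" "m $ b > 0" using ne by (auto simp: m_def e_vec_nth)
  then have "{a, c} \<in> M" "{b, d} \<in> M"
    using exI[of a] exI[of b] only ne by (metis insert_iff singletonD)+
  then have "{a, b} \<in> M \<and> {c, d} \<in> M \<or> {a, d} \<in> M \<and> {b, c} \<in> M"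
    using positroid_Pluecker[OF M(1) lt] by blast
  then show False
  proof
    assume "{a, b} \<in> M \<and> {c, d} \<in> M"
    then have "mass (e_vec {a, b}) A2 \<le> 1" "mass (e_vec {c, d}) A2 \<le> 1"
      using s(2) eC unfolding A2_def by blast+
    then show False using A2 ne by (auto simp: mass_e_vec_doubleton)
  next
    assume "{a, d} \<in> M \<and> {b, c} \<in> M"
    then have "mass (e_vec {a, d}) A1 \<le> 1" "mass (e_vec {b, c}) A1 \<le> 1"
      using s(1) eC unfolding A1_def by blast+
    then show False using A1 ne by (auto simp: mass_e_vec_doubleton)
  qed
qed

lemma weakly_separated_if_positroid_subdivision:
  assumes S: "S \<subseteq> two_sets" and pos: "positroid_subdivision (blade_subdivision S)"
  shows "w_collection S"
  unfolding w_collection_def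
proof (intro conjI S ballI)
  fix I J assume IJ: "I \<in> S" "J \<in> S"
  then obtain i j k l where *: "i < j" "I = {i, j}" "k < l" "J = {k, l}"
    using S by (metis subset_iff two_sets_iff)
  show "weakly_separated I J"
    using crossing_blades_not_positroid[OF S pos] IJ * unfolding *(2,4)
    by (subst weakly_separated_doubletons) blast+
qed

section \<open>Frozen sets and the coefficients of a height\<close>

lemma cpred_csuc: "cpred (csuc i) = i"
proof (cases "\<exists>j. i < j")
  case True
  then obtain j where j: "i < j" by blast
  have "{k. k < csuc i} = {..i}" using csuc_not_max(2)[OF j] by auto
  moreover have "Max {..i} = i" by (rule Max_eqI) auto
  ultimately show ?thesis using csuc_not_max(1)[OF j] by (auto simp: cpred_def)
next
  case False
  then have "csuc i \<le> x" "x \<le> i" for x using csuc_max[of i x] by (auto simp: not_less)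
  then show ?thesis by (auto simp: cpred_def not_less intro!: Max_eqI dest: leD)
qed

lemma csuc_eq_iff: "csuc i = csuc j \<longleftrightarrow> i = j"
  by (metis cpred_csuc)

lemma csuc_surj: obtains k where "i = csuc k"
proof -
  have "inj (csuc :: 'a \<Rightarrow> 'a)" by (simp add: inj_on_def csuc_eq_iff)
  then have "surj (csuc :: 'a \<Rightarrow> 'a)" by (simp add: finite_UNIV_inj_surj)
  then show ?thesis using that by (metis surjD)
qed

lemma csuc_neq:
  fixes i :: "'n::{finite,linorder}"
  assumes "CARD('n) > 1"
  shows "csuc i \<noteq> i"
proof
  assume eq: "csuc i = i"
  have "inj_on (\<lambda>t. (csuc ^^ t) i) {..1}" using csuc_iterates[of 1 i] assms by simp
  from inj_onD[OF this, of 0 1] show False using eq by simp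
qed

lemma frozen_sets_doubleton:
  fixes i j :: "'n::{finite,linorder}"
  assumes n: "CARD('n) > 2" and ij: "i \<noteq> j"
  shows "{i, j} \<in> frozen_sets \<longleftrightarrow> j = csuc i \<or> i = csuc j"
proof
  assume "{i, j} \<in> frozen_sets"
  then obtain k m where km: "{i, j} = (\<lambda>t. (csuc ^^ t) k) ` {..<m}"
    by (auto simp: frozen_sets_def cyclic_interval_def)
  have c2: "card ((\<lambda>t. (csuc ^^ t) k) ` {..<m}) = 2" using ij by (simp add: km[symmetric])
  have "m \<ge> 2" using card_image_le[of "{..<m}" "\<lambda>t. (csuc ^^ t) k"] c2 by simp
  moreover have "m < 3"
  proof (rule ccontr)
    assume "\<not> m < 3"
    then have "(\<lambda>t. (csuc ^^ t) k) ` {..2} \<subseteq> (\<lambda>t. (csuc ^^ t) k) ` {..<m}" by auto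
    then have "card ((\<lambda>t. (csuc ^^ t) k) ` {..2::nat}) \<le> 2"
      using c2 card_mono[of "(\<lambda>t. (csuc ^^ t) k) ` {..<m}"] by fastforce
    moreover have "card ((\<lambda>t. (csuc ^^ t) k) ` {..2::nat}) = 3"
      using csuc_iterates[of 2 k] n by (metis card_image card_atMost eval_nat_numeral(3))
    ultimately show False by simp
  qed
  ultimately have "m = 2" by simp
  then have "{i, j} = {k, csuc k}" using km by (simp add: numeral_2_eq_2 lessThan_Suc insert_commute)
  then show "j = csuc i \<or> i = csuc j" by (auto simp: doubleton_eq_iff)
next
  have fr: "{i, csuc i} \<in> frozen_sets" if "i \<noteq> csuc i" for i :: 'n
  proof -
    have "{i, csuc i} = (\<lambda>t. (csuc ^^ t) i) ` {..<2}" by (auto simp: numeral_2_eq_2 lessThan_Suc)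
    then have "cyclic_interval {i, csuc i}" unfolding cyclic_interval_def by (intro exI)
    then show ?thesis using that by (simp add: frozen_sets_def)
  qed
  assume "j = csuc i \<or> i = csuc j"
  then show "{i, j} \<in> frozen_sets" using fr[of i] fr[of j] ij by (auto simp: insert_commute)
qed

lemma nonfrozen_sets_doubleton:
  fixes i j :: "'n::{finite,linorder}"
  assumes "CARD('n) > 2"
  shows "{i, j} \<in> nonfrozen_sets \<longleftrightarrow> i \<noteq> j \<and> j \<noteq> csuc i \<and> i \<noteq> csuc j"
  using frozen_sets_doubleton[OF assms] unfolding nonfrozen_sets_def by auto

text \<open>Both elements of \<open>I\<close> are written as successors, so that moving back undoes
  \<open>csuc\<close> and each choice of \<open>M\<close> determines \<open>I\<close>. Nonfrozenness
  of \<open>{i, j}\<close> ensures that in the four candidates the moved elements are initial and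
  the two elements distinct.\<close>

lemma L_elt_support:
  fixes i j :: "'n::{finite,linorder}"
  assumes n: "CARD('n) > 2" and J: "{i, j} \<in> nonfrozen_sets"
  shows "{(I, M). I \<in> two_sets \<and> M \<subseteq> initial_elements I \<and> (I - M) \<union> cpred ` M = {i, j}} =
    {({i, j}, {}), ({csuc i, j}, {csuc i}), ({i, csuc j}, {csuc j}), ({csuc i, csuc j}, {csuc i, csuc j})}"
    (is "?L = ?R")
proof
  have ne: "i \<noteq> j" "j \<noteq> csuc i" "i \<noteq> csuc j" using J nonfrozen_sets_doubleton[OF n] by auto
  have n1: "csuc x \<noteq> x" for x :: 'n using csuc_neq n by force
  show "?L \<subseteq> ?R"
  proof
    fix z assume "z \<in> ?L"
    then obtain I M where z: "z = (I, M)" and I: "I \<in> two_sets" and M: "M \<subseteq> initial_elements I"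
      and eq: "I - M \<union> cpred ` M = {i, j}" by blast
    obtain k l where kl: "I = {csuc k, csuc l}" "k \<noteq> l"
      using I two_setsE csuc_surj by (metis csuc_eq_iff order_less_irrefl)
    have "M \<subseteq> {csuc k, csuc l}" using M kl by (auto simp: initial_elements_def)
    then have "M = {} \<or> M = {csuc k} \<or> M = {csuc l} \<or> M = {csuc k, csuc l}" by blast
    then have "I = {i, j} \<and> M = {} \<or> I = {csuc i, j} \<and> M = {csuc i} \<or>
       I = {i, csuc j} \<and> M = {csuc j} \<or> I = {csuc i, csuc j} \<and> M = {csuc i, csuc j}"
    proof (elim disjE)
      assume "M = {}"
      then show ?thesis using eq by simp
    next
      assume m: "M = {csuc k}"
      then have "{csuc l, k} = {i, j}"
        using eq kl by (simp add: cpred_csuc csuc_eq_iff insert_Diff_if insert_commute)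
      then show ?thesis using m kl by (auto simp: doubleton_eq_iff)
    next
      assume m: "M = {csuc l}"
      then have "{csuc k, l} = {i, j}"
        using eq kl by (simp add: cpred_csuc csuc_eq_iff insert_Diff_if insert_commute)
      then show ?thesis using m kl by (auto simp: doubleton_eq_iff)
    next
      assume m: "M = {csuc k, csuc l}"
      then have "{k, l} = {i, j}" using eq kl by (simp add: cpred_csuc)
      then show ?thesis using m kl by (auto simp: doubleton_eq_iff)
    qed
    then show "z \<in> ?R" unfolding z by blast
  qed
  show "?R \<subseteq> ?L"
    using ne n1 by (auto simp: initial_elements_def cpred_csuc csuc_eq_iff dest: sym)
qed

lemma Sigma_filter_eq: "{z \<in> Sigma A B. P (fst z) (snd z)} = {(x, y). x \<in> A \<and> y \<in> B x \<and> P x y}"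
  by auto

text \<open>This is a negated mixed second difference over a unit square of index pairs; the sign is
  negative when no end or both ends are moved.\<close>

lemma trop_to_Zbar_nth:
  fixes i j :: "'n::{finite,linorder}"
  assumes n: "CARD('n) > 2" and J: "{i, j} \<in> nonfrozen_sets"
  shows "trop_to_Zbar p $ {i, j} = p $ {csuc i, j} + p $ {i, csuc j} - p $ {i, j} - p $ {csuc i, csuc j}"
proof -
  have ne: "i \<noteq> j" "j \<noteq> csuc i" "i \<noteq> csuc j" using J nonfrozen_sets_doubleton[OF n] by auto
  let ?G = "\<lambda>I M. p $ I * (-1) ^ (1 + card M)"
  have "trop_to_Zbar p $ {i, j} = (\<Sum>I\<in>two_sets. p $ I * L_elt I $ {i, j})"
    using J by (simp add: trop_to_Zbar_def mod_frozen_nth)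
  also have "\<dots> = (\<Sum>I\<in>two_sets. \<Sum>M\<in>Pow (initial_elements I).
      if (I - M) \<union> cpred ` M = {i, j} then ?G I M else 0)"
    unfolding L_elt_def beta_def sum_component sum_distrib_left
    by (intro sum.cong refl) (simp add: axis_def)
  also have "\<dots> = (\<Sum>z\<in>Sigma two_sets (\<lambda>I. Pow (initial_elements I)).
      if (fst z - snd z) \<union> cpred ` snd z = {i, j} then ?G (fst z) (snd z) else 0)"
    by (simp add: sum.Sigma split_def)
  also have "\<dots> = (\<Sum>z\<in>{z \<in> Sigma two_sets (\<lambda>I. Pow (initial_elements I)).
      (fst z - snd z) \<union> cpred ` snd z = {i, j}}. ?G (fst z) (snd z))"
    by (rule sum.inter_filter[symmetric]) simp
  finally have sum_eq: "trop_to_Zbar p $ {i, j} = \<dots>" .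
  have set_eq: "{z \<in> Sigma two_sets (\<lambda>I. Pow (initial_elements I)). (fst z - snd z) \<union> cpred ` snd z = {i, j}} =
      {(I, M). I \<in> two_sets \<and> M \<subseteq> initial_elements I \<and> (I - M) \<union> cpred ` M = {i, j}}"
    unfolding Sigma_filter_eq[of two_sets _ "\<lambda>I M. (I - M) \<union> cpred ` M = {i, j}"] Pow_iff ..
  show ?thesis
    unfolding sum_eq set_eq L_elt_support[OF n J] using ne by (simp add: csuc_eq_iff)
qed

lemma trop_to_Zbar_nth_0: "J \<notin> nonfrozen_sets \<Longrightarrow> trop_to_Zbar p $ J = 0"
  by (simp add: trop_to_Zbar_def mod_frozen_nth)

subsection \<open>Heights and the positive tropical Grassmannian\<close>

lemma nonfrozen_setsE:
  assumes "J \<in> nonfrozen_sets"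
  obtains i j where "i < j" "J = {i, j}"
  using assms two_setsE unfolding nonfrozen_sets_def by blast

lemma csuc_chain_constant:
  fixes a b :: "'n::{finite,linorder}"
  assumes "a \<le> b" "\<And>i. a \<le> i \<Longrightarrow> i < b \<Longrightarrow> f (csuc i) = f i"
  shows "f b = f a"
  using assms
proof (induction "card {a<..b}" arbitrary: a rule: less_induct)
  case less
  show ?case
  proof (cases "a = b")
    case False
    then have ab: "a < b" using less.prems(1) by simp
    note c = csuc_not_max[OF ab]
    have cb: "csuc a \<le> b" using c(3) ab by blast
    have "card {csuc a<..b} < card {a<..b}"
      using c(1) cb by (intro psubset_card_mono) auto
    then have "f b = f (csuc a)"
      using less.hyps[of "csuc a"] cb less.prems(2) c(1) by (meson less_imp_le order_trans)
    then show ?thesis using less.prems(2)[of a] ab by simp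
  qed simp
qed

text \<open>A function with vanishing mixed differences is additively separable. The relations stop
  at the diagonal, so columns are first compared with the last column \<open>mx\<close>; relations
  wrapping around then tie that column to the column of \<open>mn\<close>.\<close>

lemma kernel_trop_to_Zbar:
  fixes q :: "real^('n::{finite,linorder} set)"
  assumes n: "CARD('n) > 2"
    and zero: "\<And>J. J \<in> nonfrozen_sets \<Longrightarrow> trop_to_Zbar q $ J = 0"
  obtains u where "\<And>i j. i \<noteq> j \<Longrightarrow> q $ {i, j} = u i + u j"
proof -
  have T: "q $ {csuc i, j} + q $ {i, csuc j} = q $ {i, j} + q $ {csuc i, csuc j}"
    if "i \<noteq> j" "j \<noteq> csuc i" "i \<noteq> csuc j" for i j
    using zero[of "{i, j}"] trop_to_Zbar_nth[OF n, of i j q] nonfrozen_sets_doubleton[OF n, of i j] that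
    by simp
  define mn :: 'n where "mn = Min UNIV"
  define mx :: 'n where "mx = Max UNIV"
  have mn: "mn \<le> x" and mx: "x \<le> mx" for x by (auto simp: mn_def mx_def)
  have "\<not> (UNIV :: 'n set) \<subseteq> {mn, mx}"
  proof
    assume "(UNIV :: 'n set) \<subseteq> {mn, mx}"
    then have "CARD('n) \<le> card {mn, mx}" by (intro card_mono) auto
    then show False using n card_insert_le_m1[of 2 "{mx}" mn] by simp
  qed
  then obtain md where md: "mn < md" "md < mx" using mn mx by (metis insertCI order_le_less subsetI)
  define one where "one = csuc mn"
  have one: "mn < one" "one < mx" "\<And>k. one \<le> k \<longleftrightarrow> mn < k"
    using csuc_not_max[OF md(1)] le_less_trans[OF _ md(2), of one] md(1) by (auto simp: one_def)
  have cmx: "csuc mx = mn" using csuc_max[of mx mn] mx mn by (intro antisym) auto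
  have lt: "i < csuc i" "k < csuc i \<longleftrightarrow> k \<le> i" "csuc i \<le> k \<longleftrightarrow> i < k" if "i < mx" for i k
    using csuc_not_max[OF that] by auto
  have step1: "q $ {i, c} - q $ {csuc i, c} = q $ {i, mx} - q $ {csuc i, mx}"
    if ic: "i < mx" "csuc i < c" for i c
  proof -
    have "q $ {i, mx} - q $ {csuc i, mx} = q $ {i, c} - q $ {csuc i, c}"
    proof (rule csuc_chain_constant[where f = "\<lambda>c. q $ {i, c} - q $ {csuc i, c}"])
      fix x assume x: "c \<le> x" "x < mx"
      have "i < csuc i" "csuc i < x" "x < csuc x" using lt[OF ic(1)] lt[OF x(2)] ic(2) x(1) by auto
      then have "i \<noteq> x" "x \<noteq> csuc i" "i \<noteq> csuc x" by auto
      from T[OF this] show "q $ {i, csuc x} - q $ {csuc i, csuc x} = q $ {i, x} - q $ {csuc i, x}"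
        by linarith
    qed (rule mx)
    then show ?thesis by simp
  qed
  have step2: "q $ {b, c} - q $ {b, mx} = q $ {mn, c} - q $ {mn, mx}" if bc: "b < c" for b c
  proof (rule csuc_chain_constant[where f = "\<lambda>i. q $ {i, c} - q $ {i, mx}", OF mn])
    fix i assume i: "mn \<le> i" "i < b"
    have imx: "i < mx" using i(2) mx[of b] by simp
    have "csuc i \<le> b" using lt(3)[OF imx] i(2) by blast
    then have "csuc i < c" using bc by simp
    then show "q $ {csuc i, c} - q $ {csuc i, mx} = q $ {i, c} - q $ {i, mx}"
      using step1[OF imx, of c] by simp
  qed
  \<comment> \<open>The relations used here have \<open>j = mx\<close>, so their second index wraps
    to \<open>mn\<close>.\<close>
  have step3: "q $ {k, mx} - q $ {k, mn} = q $ {one, mx} - q $ {one, mn}" if k: "mn < k" "k < mx" for k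
  proof (rule csuc_chain_constant[where f = "\<lambda>k. q $ {k, mx} - q $ {k, mn}"])
    show "one \<le> k" using one(3) k by blast
    fix i assume i: "one \<le> i" "i < k"
    have imx: "i < mx" using i k by simp
    have "csuc i \<le> k" using lt(3)[OF imx] i(2) by blast
    then have "csuc i \<noteq> mx" "mn < i" using k(2) i(1) one(1) by auto
    then have "i \<noteq> mx" "mx \<noteq> csuc i" "i \<noteq> csuc mx" using imx by (auto simp: cmx)
    from T[OF this] show "q $ {csuc i, mx} - q $ {csuc i, mn} = q $ {i, mx} - q $ {i, mn}"
      by (simp add: cmx)
  qed
  \<comment> \<open>\<open>u0\<close> solves the three equations on the triangle \<open>mn\<close>,
    \<open>one\<close>, \<open>mx\<close>; the row of \<open>mn\<close> then dictates all other
    values of \<open>u\<close>.\<close>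
  define u0 where "u0 = (q $ {mn, one} + q $ {mn, mx} - q $ {one, mx}) / 2"
  define u where "u k = (if k = mn then u0 else q $ {mn, k} - u0)" for k
  have a: "q $ {mn, j} = u mn + u j" if "mn < j" for j using that by (auto simp: u_def)
  have b: "q $ {i, mx} = u i + u mx" if "mn < i" "i < mx" for i
    using step3[OF that] that one(1,2) by (simp add: u_def u0_def insert_commute)
  have main: "q $ {i, j} = u i + u j" if ij: "i < j" for i j
  proof -
    consider "i = mn" | "mn < i" "j = mx" | "mn < i" "j < mx" using mn[of i] mx[of j] by fastforce
    then show ?thesis
    proof cases
      case 1 then show ?thesis using a ij by simp
    next
      case 2 then show ?thesis using b ij by simp
    next
      case 3
      then show ?thesis using step2[OF ij] a[of j] a[of mx] b[of i] ij one by simp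
    qed
  qed
  show ?thesis
  proof (rule that[of u])
    show "q $ {i, j} = u i + u j" if "i \<noteq> j" for i j
      using that main[of i j] main[of j i] by (cases "i < j") (auto simp: insert_commute)
  qed
qed

text \<open>On 2-sets, \<open>of_bool (I \<subseteq> A)\<close> is the convex function max(0,
  \<open>card (I \<inter> A)\<close> - 1), which bends exactly along the hyperplane where
  \<open>A\<close> has mass 1.\<close>

definition height :: "real^('n::{finite,linorder} set) \<Rightarrow> real^('n set)" where
  "height c = (\<chi> I. if I \<in> two_sets
     then \<Sum>J\<in>nonfrozen_sets. c $ J * of_bool (I \<subseteq> chord_arc J) else 0)"

text \<open>The cyclic derivative of the indicator of an arc lives at its two ends, also across the
  step from the maximum to the minimum.\<close>

lemma indicator_csuc_diff:
  fixes i j k :: "'n::{finite,linorder}"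
  assumes "i < j"
  shows "of_bool (csuc k \<in> {i<..j}) - of_bool (k \<in> {i<..j}) = (of_bool (k = i) - of_bool (k = j) :: real)"
proof (cases "\<exists>l. k < l")
  case True
  then obtain l where l: "k < l" by blast
  have "csuc k \<in> {i<..j} \<longleftrightarrow> i \<le> k \<and> k < j" by (simp add: csuc_not_max(2,3)[OF l])
  then show ?thesis using assms by auto
next
  case False
  then have *: "csuc k \<le> x" "x \<le> k" for x using csuc_max[of k x] by (auto simp: not_less)
  then have "csuc k \<notin> {i<..j}" "i < k" using assms by (auto simp: not_less intro: less_le_trans)
  then show ?thesis using *(2)[of j] by auto
qed

lemma trop_to_Zbar_height:
  fixes c :: "real^('n::{finite,linorder} set)"
  assumes n: "CARD('n) > 2"
  shows "trop_to_Zbar (height c) = mod_frozen c"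
proof (rule vec_eq_iff[THEN iffD2, rule_format])
  fix K :: "'n set"
  show "trop_to_Zbar (height c) $ K = mod_frozen c $ K"
  proof (cases "K \<in> nonfrozen_sets")
    case True
    then obtain k l where kl: "K = {k, l}" by (rule nonfrozen_setsE)
    have ne: "k \<noteq> l" "l \<noteq> csuc k" "k \<noteq> csuc l"
      using True nonfrozen_sets_doubleton[OF n] by (auto simp: kl)
    have h: "height c $ {x, y} =
        (\<Sum>J\<in>nonfrozen_sets. c $ J * (of_bool (x \<in> chord_arc J) * of_bool (y \<in> chord_arc J)))"
      if "x \<noteq> y" for x y
      using that by (simp add: height_def of_bool_conj)
    have one: "of_bool (csuc k \<in> chord_arc J) * of_bool (l \<in> chord_arc J)
        + of_bool (k \<in> chord_arc J) * of_bool (csuc l \<in> chord_arc J)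
        - of_bool (k \<in> chord_arc J) * of_bool (l \<in> chord_arc J)
        - of_bool (csuc k \<in> chord_arc J) * of_bool (csuc l \<in> chord_arc J) = (of_bool (J = K) :: real)"
      if J: "J \<in> nonfrozen_sets" for J
    proof -
      obtain i j where ij: "i < j" "J = {i, j}" using nonfrozen_setsE[OF J] .
      let ?s = "\<lambda>x. of_bool (x \<in> {i<..j}) :: real"
      \<comment> \<open>The second difference factors into derivatives at \<open>k\<close> and at
        \<open>l\<close>. As \<open>k\<close> and \<open>l\<close> differ, the product is nonzero
        only when they are the two ends of the arc, and then it is -1.\<close>
      have "?s (csuc k) * ?s l + ?s k * ?s (csuc l) - ?s k * ?s l - ?s (csuc k) * ?s (csuc l) =
          - ((?s (csuc k) - ?s k) * (?s (csuc l) - ?s l))" by (simp only: algebra_simps)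
      also have "\<dots> = of_bool (J = K)"
        unfolding indicator_csuc_diff[OF ij(1)] using ne ij
        by (auto simp: kl doubleton_eq_iff)
      finally show ?thesis unfolding ij(2) chord_arc_doubleton[OF ij(1)] .
    qed
    have "trop_to_Zbar (height c) $ K =
      (\<Sum>J\<in>nonfrozen_sets. c $ J * (of_bool (csuc k \<in> chord_arc J) * of_bool (l \<in> chord_arc J)
        + of_bool (k \<in> chord_arc J) * of_bool (csuc l \<in> chord_arc J)
        - of_bool (k \<in> chord_arc J) * of_bool (l \<in> chord_arc J)
        - of_bool (csuc k \<in> chord_arc J) * of_bool (csuc l \<in> chord_arc J)))"
      using ne True unfolding kl
      by (simp add: trop_to_Zbar_nth[OF n] h csuc_eq_iff not_sym[OF ne(2)] right_diff_distrib distrib_left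
          sum.distrib sum_subtractf)
    also have "\<dots> = (\<Sum>J\<in>nonfrozen_sets. c $ J * of_bool (J = K))"
      by (intro sum.cong refl) (simp only: one)
    also have "\<dots> = c $ K" using True by (simp add: of_bool_def if_distrib cong: if_cong)
    finally show ?thesis using True by (simp add: mod_frozen_nth)
  next
    case False
    then show ?thesis by (simp add: trop_to_Zbar_nth_0 mod_frozen_nth)
  qed
qed

lemma linear_trop_to_Zbar: "linear trop_to_Zbar"
  by (rule linearI) (auto simp: vec_eq_iff trop_to_Zbar_def mod_frozen_nth algebra_simps sum.distrib sum_distrib_left)

lemma mod_frozen_trop_to_Zbar: "mod_frozen (trop_to_Zbar p) = trop_to_Zbar p"
  by (auto simp: vec_eq_iff mod_frozen_nth trop_to_Zbar_nth_0)

lemma inner_e_vec_doubleton: "i \<noteq> j \<Longrightarrow> u \<bullet> e_vec {i, j} = u $ i + u $ j"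
  by (simp add: e_vec_def inner_add_right inner_axis)

lemma height_representation:
  fixes p :: "real^('n::{finite,linorder} set)"
  assumes n: "CARD('n) > 2"
  obtains u where "\<And>I. I \<in> two_sets \<Longrightarrow>
    p $ I = u \<bullet> e_vec I + (\<Sum>J\<in>nonfrozen_sets. trop_to_Zbar p $ J * of_bool (I \<subseteq> chord_arc J))"
proof -
  let ?h = "height (trop_to_Zbar p)"
  have "trop_to_Zbar (p - ?h) = 0"
    by (simp add: linear_diff[OF linear_trop_to_Zbar] trop_to_Zbar_height[OF n] mod_frozen_trop_to_Zbar)
  then obtain u where u: "\<And>i j. i \<noteq> j \<Longrightarrow> (p - ?h) $ {i, j} = u i + u j"
    using kernel_trop_to_Zbar[OF n, of "p - ?h"] by (metis zero_index)
  show ?thesis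
  proof (rule that[of "\<chi> i. u i"])
    fix I :: "'n set" assume I: "I \<in> two_sets"
    then obtain i j where "i < j" and "I = {i, j}" by (rule two_setsE)
    then have ij: "i \<noteq> j" "I = {i, j}" by auto
    then show "p $ I = (\<chi> i. u i) \<bullet> e_vec I + (\<Sum>J\<in>nonfrozen_sets. trop_to_Zbar p $ J * of_bool (I \<subseteq> chord_arc J))"
      using u[OF ij(1)] I by (simp add: inner_e_vec_doubleton height_def del: doubleton_in_two_sets)
  qed
qed

text \<open>\<open>A\<close> to \<open>D\<close> stand for \<open>i < a\<close> to
  \<open>i < d\<close>, and \<open>E\<close> to \<open>H\<close> for \<open>a \<le> j\<close> to
  \<open>d \<le> j\<close>. Monotonicity leaves five patterns per chain; the disjunctions come from
  \<open>i < j\<close>.\<close>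

lemma quad_of_bool:
  assumes "A \<longrightarrow> B" "B \<longrightarrow> C" "C \<longrightarrow> D" "H \<longrightarrow> G" "G \<longrightarrow> F" "F \<longrightarrow> E"
    "A \<or> E" "B \<or> F" "C \<or> G" "D \<or> H"
  shows "of_bool (A \<and> E) * of_bool (D \<and> H) + of_bool (B \<and> F) * of_bool (C \<and> G)
      - of_bool (A \<and> E) * of_bool (C \<and> G) - of_bool (B \<and> F) * of_bool (D \<and> H)
      = (of_bool (\<not> A \<and> B \<and> G \<and> \<not> H) :: real)"
    "of_bool (A \<and> E) * of_bool (B \<and> F) + of_bool (C \<and> G) * of_bool (D \<and> H)
      - of_bool (A \<and> E) * of_bool (C \<and> G) - of_bool (B \<and> F) * of_bool (D \<and> H)
      = (of_bool (\<not> B \<and> C \<and> H \<or> F \<and> \<not> G \<and> A) :: real)"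
proof -
  have "(A, B, C, D) \<in> {(True,True,True,True), (False,True,True,True), (False,False,True,True), (False,False,False,True), (False,False,False,False)}"
   using assms(1-3) by (cases A; cases B; cases C; cases D; simp)
  moreover have "(H, G, F, E) \<in> {(True,True,True,True), (False,True,True,True), (False,False,True,True), (False,False,False,True), (False,False,False,False)}"
   using assms(4-6) by (cases H; cases G; cases F; cases E; simp)
  ultimately show "of_bool (A \<and> E) * of_bool (D \<and> H) + of_bool (B \<and> F) * of_bool (C \<and> G)
      - of_bool (A \<and> E) * of_bool (C \<and> G) - of_bool (B \<and> F) * of_bool (D \<and> H)
      = (of_bool (\<not> A \<and> B \<and> G \<and> \<not> H) :: real)"
    "of_bool (A \<and> E) * of_bool (B \<and> F) + of_bool (C \<and> G) * of_bool (D \<and> H)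
      - of_bool (A \<and> E) * of_bool (C \<and> G) - of_bool (B \<and> F) * of_bool (D \<and> H)
      = (of_bool (\<not> B \<and> C \<and> H \<or> F \<and> \<not> G \<and> A) :: real)"
    using assms(7-10) unfolding insert_iff empty_iff prod.inject
    by (elim disjE FalseE; simp)+
qed

text \<open>A chord contributes to a Pluecker difference exactly when its arc contains one
  consecutive pair and misses the opposite pair: \<open>b, c\<close> without \<open>a, d\<close> in
  the first identity, one of \<open>a, b\<close> and \<open>c, d\<close> without the other in the
  second.\<close>

lemma quad_arc:
  fixes a b c d :: "'n::{finite,linorder}"
  assumes "a < b" "b < c" "c < d" "i < j"
  defines "s \<equiv> \<lambda>x y. of_bool ({x, y} \<subseteq> chord_arc {i, j}) :: real"
  shows "s a d + s b c - s a c - s b d = of_bool (a \<le> i \<and> i < b \<and> c \<le> j \<and> j < d)"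
    "s a b + s c d - s a c - s b d = of_bool (b \<le> i \<and> i < c \<and> d \<le> j \<or> b \<le> j \<and> j < c \<and> i < a)"
proof -
  have s: "s x y = of_bool (i < x \<and> x \<le> j) * of_bool (i < y \<and> y \<le> j)" for x y
    by (simp add: s_def chord_arc_doubleton[OF assms(4)] of_bool_conj)
  have le: "x \<le> i \<longleftrightarrow> \<not> i < x" "j < x \<longleftrightarrow> \<not> x \<le> j" for x by auto
  have mono: "i < a \<longrightarrow> i < b" "i < b \<longrightarrow> i < c" "i < c \<longrightarrow> i < d"
    "d \<le> j \<longrightarrow> c \<le> j" "c \<le> j \<longrightarrow> b \<le> j" "b \<le> j \<longrightarrow> a \<le> j"
    "i < a \<or> a \<le> j" "i < b \<or> b \<le> j" "i < c \<or> c \<le> j" "i < d \<or> d \<le> j"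
    using assms(1-4) by auto
  show "s a d + s b c - s a c - s b d = of_bool (a \<le> i \<and> i < b \<and> c \<le> j \<and> j < d)"
    "s a b + s c d - s a c - s b d = of_bool (b \<le> i \<and> i < c \<and> d \<le> j \<or> b \<le> j \<and> j < c \<and> i < a)"
    unfolding s le using quad_of_bool[OF mono] by blast+
qed

text \<open>The coefficient is the gap in one of the three-term inequalities for \<open>i\<close>,
  \<open>csuc i\<close>, \<open>j\<close>, \<open>csuc j\<close>. Which one depends on whether
  \<open>csuc j\<close> wraps and becomes the smallest of the four.\<close>

lemma trop_to_Zbar_nonneg:
  fixes p :: "real^('n::{finite,linorder} set)"
  assumes n: "CARD('n) > 2" and p: "p \<in> trop_pos"
  shows "0 \<le> trop_to_Zbar p $ J"
proof (cases "J \<in> nonfrozen_sets")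
  case True
  then obtain i j where ij: "i < j" "J = {i, j}" by (rule nonfrozen_setsE)
  have ne: "j \<noteq> csuc i" "i \<noteq> csuc j" using True nonfrozen_sets_doubleton[OF n] by (auto simp: ij)
  have trop: "p $ {a, c} + p $ {b, d} \<le> p $ {a, b} + p $ {c, d}"
     "p $ {a, c} + p $ {b, d} \<le> p $ {b, c} + p $ {a, d}" if "a < b" "b < c" "c < d" for a b c d
    using p that by (auto simp: trop_pos_def)
  have ci: "i < csuc i" "csuc i < j" using csuc_not_max[OF ij(1)] ne(1) ij(1) by (auto simp: order_less_le)
  have T: "trop_to_Zbar p $ J = p $ {csuc i, j} + p $ {i, csuc j} - p $ {i, j} - p $ {csuc i, csuc j}"
    using trop_to_Zbar_nth[OF n] True unfolding ij(2) by blast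
  show ?thesis
  proof (cases "\<exists>l. j < l")
    case True
    then have "j < csuc j" using csuc_not_max(1) by blast
    then show ?thesis using trop(2)[OF ci, of "csuc j"] by (simp add: T)
  next
    case False
    then have "csuc j \<le> i" "csuc j \<noteq> i" using csuc_max[of j i] ne by (auto simp: not_less)
    then have "csuc j < i" by simp
    then show ?thesis using trop(1)[OF _ ci, of "csuc j"] by (simp add: T insert_commute)
  qed
qed (simp add: trop_to_Zbar_nth_0)

text \<open>With nonnegative coefficients both Pluecker differences are sums of nonnegative terms.
  The smaller is positive only if one chord of the support splits the four points as
  \<open>bc|ad\<close> and another as \<open>ab|cd\<close>; two such chords cross. Conversely
  \<open>{a, c}\<close> and \<open>{b, d}\<close> are such a pair.\<close>

lemma trop_pos_iff:
  fixes p :: "real^('n::{finite,linorder} set)"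
  assumes n: "CARD('n) > 2"
  shows "p \<in> trop_pos \<longleftrightarrow> (\<forall>I. I \<notin> two_sets \<longrightarrow> p $ I = 0) \<and> (\<forall>J. 0 \<le> trop_to_Zbar p $ J) \<and>
    w_collection {J. trop_to_Zbar p $ J \<noteq> 0}"
proof -
  let ?c = "\<lambda>J. trop_to_Zbar p $ J"
  define x where "x a b c d J = (of_bool ({a, d} \<subseteq> chord_arc J) + of_bool ({b, c} \<subseteq> chord_arc J)
    - of_bool ({a, c} \<subseteq> chord_arc J) - of_bool ({b, d} \<subseteq> chord_arc J) :: real)" for a b c d :: 'n and J
  define y where "y a b c d J = (of_bool ({a, b} \<subseteq> chord_arc J) + of_bool ({c, d} \<subseteq> chord_arc J)
    - of_bool ({a, c} \<subseteq> chord_arc J) - of_bool ({b, d} \<subseteq> chord_arc J) :: real)" for a b c d :: 'n and J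
  have x: "x a b c d {i, j} = of_bool (a \<le> i \<and> i < b \<and> c \<le> j \<and> j < d)"
    "y a b c d {i, j} = of_bool (b \<le> i \<and> i < c \<and> d \<le> j \<or> b \<le> j \<and> j < c \<and> i < a)"
    if "a < b" "b < c" "c < d" "i < j" for a b c d i j
    using quad_arc[OF that] unfolding x_def y_def by blast+
  have x0: "0 \<le> x a b c d J" "0 \<le> y a b c d J" if lt: "a < b" "b < c" "c < d" and J: "J \<in> nonfrozen_sets" for a b c d J
  proof -
    obtain i j where "i < j" "J = {i, j}" using nonfrozen_setsE[OF J] .
    then show "0 \<le> x a b c d J" "0 \<le> y a b c d J" using x[OF lt] by auto
  qed
  obtain u where u: "\<And>I. I \<in> two_sets \<Longrightarrow>
    p $ I = u \<bullet> e_vec I + (\<Sum>J\<in>nonfrozen_sets. ?c J * of_bool (I \<subseteq> chord_arc J))"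
    using height_representation[OF n] by blast
  have X: "p $ {a, d} + p $ {b, c} - p $ {a, c} - p $ {b, d} = (\<Sum>J\<in>nonfrozen_sets. ?c J * x a b c d J)"
    and Y: "p $ {a, b} + p $ {c, d} - p $ {a, c} - p $ {b, d} = (\<Sum>J\<in>nonfrozen_sets. ?c J * y a b c d J)"
    if "a < b" "b < c" "c < d" for a b c d
  proof -
    have ne: "a \<noteq> b" "a \<noteq> c" "a \<noteq> d" "b \<noteq> c" "b \<noteq> d" "c \<noteq> d" using that by auto
    have pq: "p $ {k, l} = u $ k + u $ l + (\<Sum>J\<in>nonfrozen_sets. ?c J * of_bool ({k, l} \<subseteq> chord_arc J))"
      if "k \<noteq> l" for k l
      using u[of "{k, l}"] that by (simp add: inner_e_vec_doubleton)
    show "p $ {a, d} + p $ {b, c} - p $ {a, c} - p $ {b, d} = (\<Sum>J\<in>nonfrozen_sets. ?c J * x a b c d J)"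
      "p $ {a, b} + p $ {c, d} - p $ {a, c} - p $ {b, d} = (\<Sum>J\<in>nonfrozen_sets. ?c J * y a b c d J)"
      unfolding x_def y_def pq[OF ne(1)] pq[OF ne(2)] pq[OF ne(3)] pq[OF ne(4)] pq[OF ne(5)] pq[OF ne(6)]
        right_diff_distrib distrib_left sum.distrib sum_subtractf by simp_all
  qed
  have supp: "?c J \<noteq> 0 \<Longrightarrow> J \<in> nonfrozen_sets" for J using trop_to_Zbar_nth_0 by blast
  have trop_eq: "p $ {a, c} + p $ {b, d} = min (p $ {a, b} + p $ {c, d}) (p $ {b, c} + p $ {a, d}) \<longleftrightarrow>
     min (\<Sum>J\<in>nonfrozen_sets. ?c J * y a b c d J) (\<Sum>J\<in>nonfrozen_sets. ?c J * x a b c d J) = 0"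
    if "a < b" "b < c" "c < d" for a b c d
    using X[OF that] Y[OF that] by (auto simp: min_def split: if_splits)
  show ?thesis
  proof (intro iffI conjI; (elim conjE)?)
    assume p: "p \<in> trop_pos"
    then show "\<forall>I. I \<notin> two_sets \<longrightarrow> p $ I = 0" by (simp add: trop_pos_def)
    show nn: "\<forall>J. 0 \<le> ?c J" using trop_to_Zbar_nonneg[OF n p] by blast
    have cross: False if lt: "a < b" "b < c" "c < d" and ne: "?c {a, c} \<noteq> 0" "?c {b, d} \<noteq> 0" for a b c d
    proof -
      have "?c {a, c} * x a b c d {a, c} \<le> (\<Sum>J\<in>nonfrozen_sets. ?c J * x a b c d J)"
        using nn x0[OF lt] supp[OF ne(1)] by (intro member_le_sum) auto
      moreover have "?c {b, d} * y a b c d {b, d} \<le> (\<Sum>J\<in>nonfrozen_sets. ?c J * y a b c d J)"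
        using nn x0[OF lt] supp[OF ne(2)] by (intro member_le_sum) auto
      moreover have "x a b c d {a, c} = 1" "y a b c d {b, d} = 1" using x[OF lt] lt by auto
      moreover have "?c {a, c} > 0" "?c {b, d} > 0" using nn ne by (auto simp: order_less_le)
      ultimately have "min (\<Sum>J\<in>nonfrozen_sets. ?c J * y a b c d J) (\<Sum>J\<in>nonfrozen_sets. ?c J * x a b c d J) > 0"
        by simp
      moreover have "p $ {a, c} + p $ {b, d} = min (p $ {a, b} + p $ {c, d}) (p $ {b, c} + p $ {a, d})"
        using p lt by (simp add: trop_pos_def)
      ultimately show False using trop_eq[OF lt] by (metis less_irrefl)
    qed
    show "w_collection {J. ?c J \<noteq> 0}"
      unfolding w_collection_def
    proof (intro conjI ballI)
      show "{J. ?c J \<noteq> 0} \<subseteq> two_sets" using supp by (auto simp: nonfrozen_sets_def)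
      fix I J assume IJ: "I \<in> {J. ?c J \<noteq> 0}" "J \<in> {J. ?c J \<noteq> 0}"
      then have "I \<in> two_sets" "J \<in> two_sets" using supp by (auto simp: nonfrozen_sets_def)
      then obtain i j k l where *: "i < j" "I = {i, j}" "k < l" "J = {k, l}" by (metis two_sets_iff)
      show "weakly_separated I J"
        using cross[of i k j l] cross[of k i l j] IJ unfolding *(2,4)
        by (subst weakly_separated_doubletons[OF *(1,3)]) blast
    qed
  next
    assume sup2: "\<forall>I. I \<notin> two_sets \<longrightarrow> p $ I = 0" and nn: "\<forall>J. 0 \<le> ?c J"
      and W: "w_collection {J. ?c J \<noteq> 0}"
    have "min (\<Sum>J\<in>nonfrozen_sets. ?c J * y a b c d J) (\<Sum>J\<in>nonfrozen_sets. ?c J * x a b c d J) = 0"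
      if lt: "a < b" "b < c" "c < d" for a b c d
    proof (rule ccontr)
      assume ne: "\<not> ?thesis"
      have "0 \<le> (\<Sum>J\<in>nonfrozen_sets. ?c J * y a b c d J)" "0 \<le> (\<Sum>J\<in>nonfrozen_sets. ?c J * x a b c d J)"
        using x0[OF lt] nn by (auto intro!: sum_nonneg)
      then have "(\<Sum>J\<in>nonfrozen_sets. ?c J * y a b c d J) \<noteq> 0" "(\<Sum>J\<in>nonfrozen_sets. ?c J * x a b c d J) \<noteq> 0"
        using ne by (auto simp: min_def split: if_splits)
      then obtain J K where JK: "J \<in> nonfrozen_sets" "?c J * x a b c d J \<noteq> 0"
          "K \<in> nonfrozen_sets" "?c K * y a b c d K \<noteq> 0"
        by (meson sum.neutral)
      then obtain i j k l where *: "i < j" "J = {i, j}" "k < l" "K = {k, l}"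
        unfolding nonfrozen_sets_def by (metis DiffD1 two_sets_iff)
      have "weakly_separated J K" using W JK by (auto simp: w_collection_def)
      then have "\<not> (i < k \<and> k < j \<and> j < l) \<and> \<not> (k < i \<and> i < l \<and> l < j)"
        unfolding *(2,4) using weakly_separated_doubletons[OF *(1,3)] by blast
      moreover have "a \<le> i \<and> i < b \<and> c \<le> j \<and> j < d"
         "b \<le> k \<and> k < c \<and> d \<le> l \<or> b \<le> l \<and> l < c \<and> k < a"
        using JK x[OF lt] * by auto
      ultimately show False by (auto simp: not_less)
    qed
    then show "p \<in> trop_pos" using sup2 trop_eq by (simp add: trop_pos_def)
  qed
qed

subsection \<open>Regular subdivisions are blade subdivisions\<close>

text \<open>The weights of a minimising convex combination can sit only on minimising
  points.\<close>

lemma convex_hull_minimizers: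
  fixes V :: "'a::euclidean_space set"
  assumes fin: "finite V"
  shows "{q \<in> convex hull V. \<forall>r \<in> convex hull V. a \<bullet> q \<le> a \<bullet> r} =
    convex hull {v \<in> V. \<forall>w \<in> V. a \<bullet> v \<le> a \<bullet> w}" (is "?F = convex hull ?M")
proof (cases "V = {}")
  case False
  show ?thesis
  proof
    have "convex hull V \<subseteq> {r. a \<bullet> v \<le> a \<bullet> r}" if "v \<in> ?M" for v
      using that by (intro hull_minimal) (auto simp: convex_halfspace_ge)
    then have "?M \<subseteq> ?F" by (auto simp: hull_inc)
    moreover have "?F = convex hull V \<inter> (\<Inter>r\<in>convex hull V. {q. a \<bullet> q \<le> a \<bullet> r})" by auto
    then have "convex ?F" by (simp add: convex_Int convex_INT convex_halfspace_le)
    ultimately show "convex hull ?M \<subseteq> ?F" by (rule hull_minimal)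
  next
    show "?F \<subseteq> convex hull ?M"
    proof
      fix q assume q: "q \<in> ?F"
      obtain u where u: "\<forall>v\<in>V. 0 \<le> u v" "sum u V = 1" "(\<Sum>v\<in>V. u v *\<^sub>R v) = q"
        using q unfolding convex_hull_finite[OF fin] by blast
      obtain v0 where v0: "v0 \<in> V" "\<And>w. w \<in> V \<Longrightarrow> a \<bullet> v0 \<le> a \<bullet> w"
        using fin False
        by (metis (no_types, lifting) arg_min_if_finite(1) arg_min_least)
      have qa: "a \<bullet> q = (\<Sum>v\<in>V. u v * (a \<bullet> v))" unfolding u(3)[symmetric] by (simp add: inner_sum_right)
      have "(\<Sum>v\<in>V. u v * (a \<bullet> v0)) \<le> (\<Sum>v\<in>V. u v * (a \<bullet> v))"
        using u v0 by (intro sum_mono mult_left_mono) auto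
      then have "a \<bullet> v0 \<le> a \<bullet> q" using u(2) qa by (simp add: sum_distrib_right[symmetric])
      moreover have "a \<bullet> q \<le> a \<bullet> v0" using q v0 by (auto simp: hull_inc)
      ultimately have eq: "(\<Sum>v\<in>V. u v * - (a \<bullet> v)) = - (a \<bullet> v0)" using qa by (simp add: sum_negf)
      have tight: "- (a \<bullet> v) = - (a \<bullet> v0)" if "v \<in> V" "u v > 0" for v
        by (rule convex_combination_tight[OF fin _ u(2) _ eq that(1)]) (use u v0 that in auto)
      have M: "v \<in> ?M" if "v \<in> V" "u v \<noteq> 0" for v
      proof -
        have "u v > 0" using u(1) that by (auto simp: less_le)
        then show ?thesis using tight[of v] v0 that by auto
      qed
      have "sum u ?M = sum u V" "(\<Sum>v\<in>?M. u v *\<^sub>R v) = (\<Sum>v\<in>V. u v *\<^sub>R v)"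
      proof -
        have 0: "u v = 0" if "v \<in> V - ?M" for v using M[of v] that by blast
        show "sum u ?M = sum u V" "(\<Sum>v\<in>?M. u v *\<^sub>R v) = (\<Sum>v\<in>V. u v *\<^sub>R v)"
          by (intro sum.mono_neutral_left fin; use 0 in force)+
      qed
      then have "\<exists>u. (\<forall>v\<in>?M. 0 \<le> u v) \<and> sum u ?M = 1 \<and> (\<Sum>v\<in>?M. u v *\<^sub>R v) = q"
        using u by (intro exI[of _ u]) auto
      then show "q \<in> convex hull ?M" using fin by (subst convex_hull_finite) auto
    qed
  qed
qed simp

definition argmin_sets :: "real^('n::{finite,linorder} set) \<Rightarrow> real^'n::{finite,linorder} \<Rightarrow> 'n set set" where
  "argmin_sets p y = {I \<in> two_sets. \<forall>K \<in> two_sets. y \<bullet> e_vec I + p $ I \<le> y \<bullet> e_vec K + p $ K}"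

lemma regular_subdivision_eq:
  "regular_subdivision p = range (\<lambda>y. convex hull (e_vec ` argmin_sets p y))"
proof -
  have "fst ` {q \<in> lifted_hypersimplex p.
      \<forall>r\<in>lifted_hypersimplex p. y \<bullet> fst q + snd q \<le> y \<bullet> fst r + snd r} =
      convex hull (e_vec ` argmin_sets p y)" for y :: "real^'a::{finite,linorder}"
  proof -
    let ?V = "(\<lambda>I. (e_vec I, p $ I)) ` two_sets"
    have ip: "y \<bullet> fst q + snd q = (y, 1) \<bullet> q" for q :: "(real^'a::{finite,linorder}) \<times> real"
      by (simp add: inner_prod_def)
    have "fst ` {q \<in> lifted_hypersimplex p.
        \<forall>r\<in>lifted_hypersimplex p. y \<bullet> fst q + snd q \<le> y \<bullet> fst r + snd r} =
        fst ` (convex hull {v \<in> ?V. \<forall>w \<in> ?V. (y, 1) \<bullet> v \<le> (y, 1) \<bullet> w})"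
      unfolding lifted_hypersimplex_def ip by (subst convex_hull_minimizers) auto
    also have "\<dots> = convex hull (fst ` {v \<in> ?V. \<forall>w \<in> ?V. (y, 1) \<bullet> v \<le> (y, 1) \<bullet> w})"
      by (rule convex_hull_linear_image[OF linear_fst])
    also have "fst ` {v \<in> ?V. \<forall>w \<in> ?V. (y, 1) \<bullet> v \<le> (y, 1) \<bullet> w} = e_vec ` argmin_sets p y"
      by (force simp: argmin_sets_def)
    finally show ?thesis .
  qed
  then show ?thesis unfolding regular_subdivision_def lower_faces_def image_image by simp
qed

text \<open>For a 2-set the two indicators differ by \<open>card (I \<inter> A)\<close> minus 1, so
  switching an arc to its complement changes a height by an affine function only.\<close>

lemma of_bool_subset_Compl:
  assumes "I \<in> two_sets"
  shows "(of_bool (I \<subseteq> A) :: real) = of_bool (I \<subseteq> - A) + e_vec A \<bullet> e_vec I - 1"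
proof -
  obtain i j where "i < j" "I = {i, j}" using two_setsE[OF assms] .
  then show ?thesis by (auto simp: mass_as_inner[symmetric] mass_e_vec_doubleton)
qed

lemma signed_height_representation:
  fixes p :: "real^('n::{finite,linorder} set)"
  assumes n: "CARD('n) > 2"
  obtains u where "\<And>I. I \<in> two_sets \<Longrightarrow>
    p $ I = u \<bullet> e_vec I + (\<Sum>J\<in>nonfrozen_sets. trop_to_Zbar p $ J * of_bool (I \<subseteq> signed_arc (\<sigma> J) J))"
proof -
  let ?c = "\<lambda>J. trop_to_Zbar p $ J"
  obtain u where u: "\<And>I. I \<in> two_sets \<Longrightarrow>
    p $ I = u \<bullet> e_vec I + (\<Sum>J\<in>nonfrozen_sets. ?c J * of_bool (I \<subseteq> chord_arc J))"
    using height_representation[OF n] by blast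
  \<comment> \<open>Half of \<open>e_vec UNIV\<close> pairs to 1 with every 2-set and so absorbs the
    constant into the linear part.\<close>
  define w where "w = (\<Sum>J\<in>nonfrozen_sets. if \<sigma> J then 0
      else ?c J *\<^sub>R (e_vec (chord_arc J) - (1/2) *\<^sub>R e_vec UNIV))"
  have "p $ I = (u + w) \<bullet> e_vec I + (\<Sum>J\<in>nonfrozen_sets. ?c J * of_bool (I \<subseteq> signed_arc (\<sigma> J) J))"
    if I: "I \<in> two_sets" for I
  proof -
    have two: "e_vec UNIV \<bullet> e_vec I = 2"
      using I unfolding mass_as_inner[symmetric] mass_e_vec by (simp add: two_sets_def)
    have "w \<bullet> e_vec I = (\<Sum>J\<in>nonfrozen_sets. ?c J * of_bool (I \<subseteq> chord_arc J) -
        ?c J * of_bool (I \<subseteq> signed_arc (\<sigma> J) J))"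
      unfolding w_def inner_sum_left
    proof (intro sum.cong refl)
      fix J
      show "(if \<sigma> J then 0 else ?c J *\<^sub>R (e_vec (chord_arc J) - (1/2) *\<^sub>R e_vec UNIV)) \<bullet> e_vec I =
          ?c J * of_bool (I \<subseteq> chord_arc J) - ?c J * of_bool (I \<subseteq> signed_arc (\<sigma> J) J)"
        unfolding of_bool_subset_Compl[OF I, of "chord_arc J"]
        by (simp add: signed_arc_def inner_diff_left two algebra_simps
            of_bool_subset_Compl[OF I, of "chord_arc J"])
    qed
    then show ?thesis using u[OF I] by (simp add: inner_add_left sum_subtractf)
  qed
  then show ?thesis using that by blast
qed

lemma e_vec_mem_cell:
  assumes "I \<in> two_sets"
  shows "e_vec I \<in> cell W \<sigma> \<longleftrightarrow> (\<forall>J\<in>W. \<not> I \<subseteq> signed_arc (\<sigma> J) J)"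
proof -
  have "\<not> I \<subseteq> {k}" for k using two_setsE[OF assms] by force
  then show ?thesis unfolding cell_def e_vec_mem_mass_polytope[OF assms] by auto
qed

lemma face_of_cell_eq_hull:
  assumes W: "w_collection W" and F: "F face_of cell W \<sigma>" "F \<noteq> {}"
  shows "F = convex hull (e_vec ` {I \<in> two_sets. e_vec I \<in> F})"
    "{I \<in> two_sets. e_vec I \<in> F} \<noteq> {}"
proof -
  obtain M where "positroid M" and M: "M \<subseteq> two_sets" "F = convex hull (e_vec ` M)"
    using positroid_polytope_eq_hull[OF positroid_polytope_face_of_cell[OF W F]] .
  have "e_vec ` M \<subseteq> e_vec ` {I \<in> two_sets. e_vec I \<in> F}"
    using M(1) unfolding M(2) by (auto simp: hull_inc)
  then have "F \<subseteq> convex hull (e_vec ` {I \<in> two_sets. e_vec I \<in> F})"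
    unfolding M(2) by (rule hull_mono)
  moreover have "convex hull (e_vec ` {I \<in> two_sets. e_vec I \<in> F}) \<subseteq> F"
    using face_of_imp_convex[OF F(1)] by (intro hull_minimal) auto
  ultimately show eq: "F = convex hull (e_vec ` {I \<in> two_sets. e_vec I \<in> F})" by (rule equalityI)
  show "{I \<in> two_sets. e_vec I \<in> F} \<noteq> {}"
  proof
    assume e: "{I \<in> two_sets. e_vec I \<in> F} = {}"
    have "F = convex hull (e_vec ` {})" using eq unfolding e .
    then show False using F(2) by simp
  qed
qed

text \<open>
  Modulo a linear function, the heights are \<open>\<Sum>J. c J * [I \<subseteq> signed_arc (\<sigma> J) J]\<close> for every choice
  of sides \<open>\<sigma>\<close>: these are nonnegative and vanish exactly at the vertices of \<open>cell W \<sigma>\<close>.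
\<close>
theorem regular_subdivision_eq_blade_subdivision:
  fixes p :: "real^('n::{finite,linorder} set)"
  assumes n: "CARD('n) > 2" and p: "p \<in> trop_pos"
  shows "regular_subdivision p = blade_subdivision {J. trop_to_Zbar p $ J \<noteq> 0}"
proof -
  let ?c = "\<lambda>J. trop_to_Zbar p $ J"
  define W where "W = {J. ?c J \<noteq> 0}"
  have nn: "\<And>J. 0 \<le> ?c J" and W: "w_collection W"
    using iffD1[OF trop_pos_iff[OF n] p] unfolding W_def by blast+
  have W2: "W \<subseteq> two_sets" using W by (simp add: w_collection_def)
  have Wn: "W \<subseteq> nonfrozen_sets" using trop_to_Zbar_nth_0 by (auto simp: W_def)
  define g where "g \<sigma> I = (\<Sum>J\<in>nonfrozen_sets. ?c J * of_bool (I \<subseteq> signed_arc (\<sigma> J) J))" for \<sigma> I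
  have g0: "0 \<le> g \<sigma> I" for \<sigma> I unfolding g_def using nn by (intro sum_nonneg) auto
  have gcell: "g \<sigma> I = 0 \<longleftrightarrow> e_vec I \<in> cell W \<sigma>" if I: "I \<in> two_sets" for \<sigma> I
  proof -
    have "g \<sigma> I = 0 \<longleftrightarrow> (\<forall>J\<in>nonfrozen_sets. ?c J * of_bool (I \<subseteq> signed_arc (\<sigma> J) J) = 0)"
      unfolding g_def using nn by (subst sum_nonneg_eq_0_iff) auto
    also have "\<dots> \<longleftrightarrow> (\<forall>J\<in>W. \<not> I \<subseteq> signed_arc (\<sigma> J) J)" using Wn unfolding W_def by auto
    finally show ?thesis using e_vec_mem_cell[OF I] by blast
  qed
  have rep: "\<exists>u. \<forall>I\<in>two_sets. p $ I = u \<bullet> e_vec I + g \<sigma> I" for \<sigma>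
  proof -
    show ?thesis
      by (rule signed_height_representation[OF n, of p \<sigma>]) (unfold g_def, blast)
  qed
  have eq: "blade_subdivision W = {F. F \<noteq> {} \<and> (\<exists>\<sigma>. F face_of cell W \<sigma>)}"
    using blade_subdivision_eq[OF W2] .
  have "regular_subdivision p = blade_subdivision W"
  proof
    show "blade_subdivision W \<subseteq> regular_subdivision p"
    proof
      fix F assume "F \<in> blade_subdivision W"
      then obtain \<sigma> where F: "F face_of cell W \<sigma>" "F \<noteq> {}" unfolding eq by blast
      have cne: "cell W \<sigma> \<noteq> {}" using F face_of_imp_subset by blast
      obtain N where "cell W \<sigma> = convex hull (e_vec ` N)"
        using face_of_cell_eq_hull(1)[OF W cell_face_of_refl cne] by blast
      then have "polyhedron (cell W \<sigma>)"
        by (simp add: polytope_convex_hull polytope_imp_polyhedron)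
      then have "F exposed_face_of cell W \<sigma>" using F(1) exposed_face_of_polyhedron by blast
      then obtain a b where ab: "cell W \<sigma> \<subseteq> {x. a \<bullet> x \<le> b}" "F = cell W \<sigma> \<inter> {x. a \<bullet> x = b}"
        unfolding exposed_face_of_def by blast
      obtain u where u: "\<And>I. I \<in> two_sets \<Longrightarrow> p $ I = u \<bullet> e_vec I + g \<sigma> I" using rep by blast
      \<comment> \<open>The functional selecting the whole cell is tilted by a small multiple of the
        one exposing \<open>F\<close>. Inside the cell the tilt singles out \<open>F\<close>, while
        the finitely many vertices outside stay above because of their surplus
        \<open>g \<sigma>\<close>.\<close>
      obtain \<epsilon> where \<epsilon>: "0 < \<epsilon>"
        "\<And>I. I \<in> {I \<in> two_sets. 0 < g \<sigma> I} \<Longrightarrow> \<epsilon> * (a \<bullet> e_vec I - b) < g \<sigma> I"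
        by (rule small_multiple_less[of "{I \<in> two_sets. 0 < g \<sigma> I}" "g \<sigma>" "\<lambda>I. a \<bullet> e_vec I - b"]) auto
      define y where "y = - u - \<epsilon> *\<^sub>R a"
      have val: "y \<bullet> e_vec I + p $ I = g \<sigma> I - \<epsilon> * (a \<bullet> e_vec I)" if "I \<in> two_sets" for I
        using u[OF that] by (simp add: y_def inner_diff_left)
      have v1: "y \<bullet> e_vec I + p $ I = - (\<epsilon> * b)" if "I \<in> two_sets" "e_vec I \<in> F" for I
        using that val[OF that(1)] gcell[OF that(1)] unfolding ab(2) by auto
      have v2: "- (\<epsilon> * b) < y \<bullet> e_vec I + p $ I" if I: "I \<in> two_sets" "e_vec I \<notin> F" for I
      proof (cases "e_vec I \<in> cell W \<sigma>")
        case True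
        then have "a \<bullet> e_vec I < b" using ab I(2) by (auto simp: less_le)
        then have "\<epsilon> * (a \<bullet> e_vec I) < \<epsilon> * b" using \<epsilon>(1) by simp
        moreover have "g \<sigma> I = 0" using True gcell[OF I(1)] by blast
        ultimately show ?thesis using val[OF I(1)] by linarith
      next
        case False
        then have "0 < g \<sigma> I" using gcell[OF I(1)] g0[of \<sigma> I] by (auto simp: less_le)
        then show ?thesis using \<epsilon>(2)[of I] val[OF I(1)] I(1) by (simp add: right_diff_distrib)
      qed
      have "argmin_sets p y = {I \<in> two_sets. e_vec I \<in> F}"
      proof -
        obtain I0 where I0: "I0 \<in> two_sets" "e_vec I0 \<in> F" using face_of_cell_eq_hull(2)[OF W F] by auto
        have "y \<bullet> e_vec I + p $ I \<le> y \<bullet> e_vec K + p $ K"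
          if "I \<in> two_sets" "e_vec I \<in> F" "K \<in> two_sets" for I K
          using v1[OF that(1,2)] v1[of K] v2[of K] that(3) by (cases "e_vec K \<in> F") auto
        moreover have "e_vec I \<in> F"
          if "I \<in> two_sets" "\<forall>K \<in> two_sets. y \<bullet> e_vec I + p $ I \<le> y \<bullet> e_vec K + p $ K" for I
          using v2[of I] v1[OF I0] that I0(1) by force
        ultimately show ?thesis unfolding argmin_sets_def by blast
      qed
      then have "F = convex hull (e_vec ` argmin_sets p y)" using face_of_cell_eq_hull(1)[OF W F] by simp
      then show "F \<in> regular_subdivision p" unfolding regular_subdivision_eq by blast
    qed
  next
    show "regular_subdivision p \<subseteq> blade_subdivision W"
    proof
      fix C assume "C \<in> regular_subdivision p"
      then obtain y where C: "C = convex hull (e_vec ` argmin_sets p y)"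
        unfolding regular_subdivision_eq by blast
      define M where "M = argmin_sets p y"
      have M2: "M \<subseteq> two_sets" by (auto simp: M_def argmin_sets_def)
      have "{csuc i, i} \<in> two_sets" for i :: 'n using csuc_neq[of i] n by simp
      then have "(two_sets :: 'n set set) \<noteq> {}" by blast
      from arg_min_if_finite[OF finite this, of "\<lambda>I. y \<bullet> e_vec I + p $ I"]
      have "arg_min_on (\<lambda>I. y \<bullet> e_vec I + p $ I) two_sets \<in> M"
        by (auto simp: M_def argmin_sets_def not_less)
      then obtain I0 where I0: "I0 \<in> M" by blast
      have cM: "card M > 0" using I0 by (auto simp: card_gt_0_iff)
      \<comment> \<open>The cell is chosen through the barycentre of the minimising vertices. On
        that cell \<open>y'\<close> is at least \<open>v0\<close>, so the average of
        \<open>g \<sigma>\<close> over \<open>M\<close> cannot be positive, and all of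
        \<open>M\<close> lies in this one cell.\<close>
      define m where "m = (\<Sum>I\<in>M. (1 / real (card M)) *\<^sub>R e_vec I)"
      have "m \<in> hypersimplex"
        unfolding m_def hypersimplex_def
        by (intro convex_sum convex_convex_hull hull_inc) (use cM M2 in auto)
      then obtain \<sigma> where \<sigma>: "m \<in> cell W \<sigma>" using cells_cover by blast
      obtain u where u: "\<And>I. I \<in> two_sets \<Longrightarrow> p $ I = u \<bullet> e_vec I + g \<sigma> I" using rep by blast
      define y' where "y' = y + u"
      define v0 where "v0 = y \<bullet> e_vec I0 + p $ I0"
      have val: "y \<bullet> e_vec I + p $ I = y' \<bullet> e_vec I + g \<sigma> I" if "I \<in> two_sets" for I
        using u[OF that] by (simp add: y'_def inner_add_left)
      have M_iff: "I \<in> M \<longleftrightarrow> I \<in> two_sets \<and> y' \<bullet> e_vec I + g \<sigma> I = v0" for I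
      proof
        assume I: "I \<in> M"
        then have "y \<bullet> e_vec I + p $ I = v0"
          using I0 unfolding M_def argmin_sets_def v0_def by (auto intro: antisym)
        then show "I \<in> two_sets \<and> y' \<bullet> e_vec I + g \<sigma> I = v0" using val I M2 by auto
      next
        assume "I \<in> two_sets \<and> y' \<bullet> e_vec I + g \<sigma> I = v0"
        then show "I \<in> M" using val[of I] I0 unfolding M_def argmin_sets_def v0_def by auto
      qed
      have min: "v0 \<le> y' \<bullet> e_vec I + g \<sigma> I" if "I \<in> two_sets" for I
        using val[OF that] I0 that unfolding M_def argmin_sets_def v0_def by auto
      have cell_hull: "cell W \<sigma> = convex hull (e_vec ` {I \<in> two_sets. e_vec I \<in> cell W \<sigma>})"
        using face_of_cell_eq_hull(1)[OF W cell_face_of_refl] \<sigma> by blast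
      have "e_vec ` {I \<in> two_sets. e_vec I \<in> cell W \<sigma>} \<subseteq> {x. v0 \<le> y' \<bullet> x}"
      proof clarify
        fix I assume I: "I \<in> two_sets" "e_vec I \<in> cell W \<sigma>"
        then have "g \<sigma> I = 0" using gcell by blast
        then show "v0 \<le> y' \<bullet> e_vec I" using min[OF I(1)] by simp
      qed
      then have "convex hull (e_vec ` {I \<in> two_sets. e_vec I \<in> cell W \<sigma>}) \<subseteq> {x. v0 \<le> y' \<bullet> x}"
        by (intro hull_minimal) (auto simp: convex_halfspace_ge)
      then have ge: "v0 \<le> y' \<bullet> x" if "x \<in> cell W \<sigma>" for x using that cell_hull by blast
      have "(\<Sum>I\<in>M. (1 / real (card M)) * (y' \<bullet> e_vec I + g \<sigma> I)) = v0"
      proof -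
        have "(\<Sum>I\<in>M. (1 / real (card M)) * (y' \<bullet> e_vec I + g \<sigma> I)) = (\<Sum>I\<in>M. (1 / real (card M)) * v0)"
          using M_iff by (intro sum.cong) auto
        then show ?thesis using I0 by auto
      qed
      moreover have "(\<Sum>I\<in>M. (1 / real (card M)) * (y' \<bullet> e_vec I + g \<sigma> I)) =
          y' \<bullet> m + (\<Sum>I\<in>M. g \<sigma> I) / real (card M)"
        by (simp add: m_def inner_sum_right sum.distrib add_divide_distrib sum_divide_distrib)
      ultimately have "(\<Sum>I\<in>M. g \<sigma> I) / real (card M) \<le> 0" using ge[OF \<sigma>] by simp
      then have "(\<Sum>I\<in>M. g \<sigma> I) \<le> 0" using I0 by (auto simp: divide_le_0_iff)
      then have "(\<Sum>I\<in>M. g \<sigma> I) = 0" using g0 by (meson antisym sum_nonneg)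
      then have gM: "g \<sigma> I = 0" if "I \<in> M" for I
        using that g0 sum_nonneg_eq_0_iff[of M "g \<sigma>"] by simp
      define F where "F = cell W \<sigma> \<inter> {x. y' \<bullet> x = v0}"
      have F: "F face_of cell W \<sigma>"
        unfolding F_def by (rule face_of_Int_supporting_hyperplane_ge[OF convex_cell ge])
      have MF: "{I \<in> two_sets. e_vec I \<in> F} = M"
      proof (intro set_eqI iffI)
        fix I assume "I \<in> {I \<in> two_sets. e_vec I \<in> F}"
        then have I: "I \<in> two_sets" "e_vec I \<in> cell W \<sigma>" "y' \<bullet> e_vec I = v0" by (auto simp: F_def)
        then have "g \<sigma> I = 0" using gcell by blast
        then show "I \<in> M" using I M_iff by simp
      next
        fix I assume I: "I \<in> M"
        then have "e_vec I \<in> cell W \<sigma>" using gM[OF I] gcell M2 by blast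
        then show "I \<in> {I \<in> two_sets. e_vec I \<in> F}" using I gM[OF I] M_iff[of I] by (simp add: F_def)
      qed
      then have Fne: "F \<noteq> {}" using I0 by blast
      have "C = F" using face_of_cell_eq_hull(1)[OF W F Fne] C unfolding MF M_def by simp
      then show "C \<in> blade_subdivision W" unfolding eq using F Fne by blast
    qed
  qed
  then show ?thesis unfolding W_def .
qed

section \<open>Recovering the support from the subdivision\<close>

lemma e_vec_mem_hull:
  assumes "e_vec K \<in> convex hull (e_vec ` M)" "M \<subseteq> two_sets" "K \<in> two_sets"
  shows "K \<in> M"
proof -
  obtain \<mu> where \<mu>: "\<And>I. I \<in> M \<Longrightarrow> 0 \<le> \<mu> I" "sum \<mu> M = 1" "e_vec K = (\<Sum>I\<in>M. \<mu> I *\<^sub>R e_vec I)"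
    using convex_hull_e_vec[OF assms(1)] by blast
  have "\<exists>I\<in>M. \<mu> I \<noteq> 0" using \<mu>(2) by (metis sum.neutral zero_neq_one)
  then obtain I where I: "I \<in> M" "\<mu> I > 0" using \<mu>(1) by (auto simp: less_le)
  have c: "card L = 2" "finite L" if "L \<in> two_sets" for L :: "'a set" using that by (auto simp: two_sets_def)
  have "real (card (I \<inter> K)) = 2"
  proof (rule convex_combination_tight[of M \<mu> "\<lambda>I. real (card (I \<inter> K))"])
    show "(\<Sum>I\<in>M. \<mu> I * real (card (I \<inter> K))) = 2"
    proof -
      have "(\<Sum>I\<in>M. \<mu> I * real (card (I \<inter> K))) = mass (e_vec K) K"
        unfolding arg_cong[OF \<mu>(3), of "\<lambda>x. mass x K"]
        by (simp add: mass_as_inner inner_sum_right) (simp add: mass_as_inner[symmetric] mass_e_vec)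
      then show ?thesis using c(1)[OF assms(3)] by (simp add: mass_e_vec)
    qed
    show "real (card (J \<inter> K)) \<le> 2" if "J \<in> M" for J
      using card_mono[of K "J \<inter> K"] c[OF assms(3)] by simp
  qed (use I \<mu> in auto)
  then have "card (I \<inter> K) = 2" by simp
  moreover have "I \<in> two_sets" using I(1) assms(2) by blast
  ultimately have "I \<inter> K = I" "I \<inter> K = K"
    using c[OF assms(3)] c[of I] by (metis card_subset_eq inf_le1, metis card_subset_eq inf_le2)
  then show ?thesis using I(1) by simp
qed

text \<open>\<open>{i, csuc j}\<close>, \<open>{csuc i, j}\<close> and \<open>{i, j}\<close>,
  \<open>{csuc i, csuc j}\<close> are the diagonals of a parallelogram, and the coefficient is the
  excess height of the first. Its ends can minimise together only without excess. Conversely, the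
  split at \<open>{i, j}\<close> is the only one both of whose halves exclude one of these
  ends.\<close>

lemma trop_to_Zbar_eq_0_iff:
  fixes p :: "real^('n::{finite,linorder} set)"
  assumes n: "CARD('n) > 2" and p: "p \<in> trop_pos" and J: "{i, j} \<in> nonfrozen_sets"
  shows "trop_to_Zbar p $ {i, j} = 0 \<longleftrightarrow>
    (\<exists>C\<in>regular_subdivision p. e_vec {i, csuc j} \<in> C \<and> e_vec {csuc i, j} \<in> C)"
proof -
  let ?c = "\<lambda>J. trop_to_Zbar p $ J"
  have ne: "i \<noteq> j" "j \<noteq> csuc i" "i \<noteq> csuc j" using J nonfrozen_sets_doubleton[OF n] by auto
  have nn: "\<And>J. 0 \<le> ?c J" using trop_to_Zbar_nonneg[OF n p] .
  have T: "?c {i, j} = p $ {csuc i, j} + p $ {i, csuc j} - p $ {i, j} - p $ {csuc i, csuc j}"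
    using trop_to_Zbar_nth[OF n J] .
  have tw: "{i, j} \<in> two_sets" "{csuc i, csuc j} \<in> two_sets" "{i, csuc j} \<in> two_sets" "{csuc i, j} \<in> two_sets"
    using ne by (auto simp: csuc_eq_iff dest: sym)
  show ?thesis
  proof
    assume "\<exists>C\<in>regular_subdivision p. e_vec {i, csuc j} \<in> C \<and> e_vec {csuc i, j} \<in> C"
    then obtain y where y: "e_vec {i, csuc j} \<in> convex hull (e_vec ` argmin_sets p y)"
        "e_vec {csuc i, j} \<in> convex hull (e_vec ` argmin_sets p y)"
      unfolding regular_subdivision_eq by blast
    have a2: "argmin_sets p y \<subseteq> two_sets" by (auto simp: argmin_sets_def)
    have "{i, csuc j} \<in> argmin_sets p y" "{csuc i, j} \<in> argmin_sets p y"
      using e_vec_mem_hull[OF y(1) a2 tw(3)] e_vec_mem_hull[OF y(2) a2 tw(4)] by auto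
    then have "y \<bullet> e_vec {i, csuc j} + p $ {i, csuc j} \<le> y \<bullet> e_vec {i, j} + p $ {i, j}"
      "y \<bullet> e_vec {csuc i, j} + p $ {csuc i, j} \<le> y \<bullet> e_vec {csuc i, csuc j} + p $ {csuc i, csuc j}"
      using tw unfolding argmin_sets_def by blast+
    moreover have "y \<bullet> e_vec {i, csuc j} + y \<bullet> e_vec {csuc i, j} = y \<bullet> e_vec {i, j} + y \<bullet> e_vec {csuc i, csuc j}"
      using ne by (simp add: inner_e_vec_doubleton csuc_eq_iff not_sym[OF ne(2)])
    ultimately have "?c {i, j} \<le> 0" using T by linarith
    then show "?c {i, j} = 0" using nn[of "{i, j}"] by simp
  next
    assume c0: "?c {i, j} = 0"
    define W where "W = {J. ?c J \<noteq> 0}"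
    have W: "w_collection W" using iffD1[OF trop_pos_iff[OF n] p] unfolding W_def by blast
    have W2: "W \<subseteq> two_sets" using W by (simp add: w_collection_def)
    have "\<exists>s. \<not> {i, csuc j} \<subseteq> signed_arc s K \<and> \<not> {csuc i, j} \<subseteq> signed_arc s K" if K: "K \<in> W" for K
    proof (rule ccontr)
      assume "\<not> ?thesis"
      then have bad: "{i, csuc j} \<subseteq> signed_arc s K \<or> {csuc i, j} \<subseteq> signed_arc s K" for s by blast
      obtain k l where kl: "k < l" "K = {k, l}" using two_setsE K W2 by blast
      let ?A = "{k<..l}"
      have A: "signed_arc True K = ?A" "signed_arc False K = - ?A"
        using kl by (auto simp: signed_arc_def chord_arc_doubleton)
      \<comment> \<open>One of the two sets lies in the arc and the other in its complement, so
        membership changes from \<open>i\<close> to \<open>csuc i\<close> and from \<open>j\<close>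
        to \<open>csuc j\<close>; only the ends of \<open>K\<close> allow this.\<close>
      have "i \<in> ?A \<and> csuc j \<in> ?A \<and> csuc i \<notin> ?A \<and> j \<notin> ?A \<or> i \<notin> ?A \<and> csuc j \<notin> ?A \<and> csuc i \<in> ?A \<and> j \<in> ?A"
        using bad[of True] bad[of False] unfolding A by auto
      then have "(i = l \<and> j = k) \<or> (i = k \<and> j = l)"
        using indicator_csuc_diff[OF kl(1), of i] indicator_csuc_diff[OF kl(1), of j] ne(1)
        by (auto simp: of_bool_def split: if_splits simp del: greaterThanAtMost_iff)
      then have "K = {i, j}" using kl(2) by auto
      then show False using K c0 by (simp add: W_def)
    qed
    then obtain \<sigma> where "\<And>K. K \<in> W \<Longrightarrow> \<not> {i, csuc j} \<subseteq> signed_arc (\<sigma> K) K \<and> \<not> {csuc i, j} \<subseteq> signed_arc (\<sigma> K) K"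
      by metis
    then have "e_vec {i, csuc j} \<in> cell W \<sigma>" "e_vec {csuc i, j} \<in> cell W \<sigma>"
      using e_vec_mem_cell[OF tw(3)] e_vec_mem_cell[OF tw(4)] by blast+
    moreover from this have "cell W \<sigma> \<in> regular_subdivision p"
      unfolding regular_subdivision_eq_blade_subdivision[OF n p] W_def[symmetric] blade_subdivision_eq[OF W2]
      using cell_face_of_refl by blast
    ultimately show "\<exists>C\<in>regular_subdivision p. e_vec {i, csuc j} \<in> C \<and> e_vec {csuc i, j} \<in> C" by blast
  qed
qed

theorem regular_subdivision_eq_iff_support_eq:
  fixes p p' :: "real^('n::{finite,linorder} set)"
  assumes n: "CARD('n) > 2" and p: "p \<in> trop_pos" "p' \<in> trop_pos"
  shows "regular_subdivision p' = regular_subdivision p \<longleftrightarrow>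
    {J. trop_to_Zbar p' $ J \<noteq> 0} = {J. trop_to_Zbar p $ J \<noteq> 0}"
proof
  assume eq: "regular_subdivision p' = regular_subdivision p"
  have "trop_to_Zbar p' $ J = 0 \<longleftrightarrow> trop_to_Zbar p $ J = 0" for J
  proof (cases "J \<in> nonfrozen_sets")
    case True
    obtain i j where "i < j" "J = {i, j}" using nonfrozen_setsE[OF True] .
    then show ?thesis
      using trop_to_Zbar_eq_0_iff[OF n p(1), of i j] trop_to_Zbar_eq_0_iff[OF n p(2), of i j] True eq by simp
  qed (simp add: trop_to_Zbar_nth_0)
  then show "{J. trop_to_Zbar p' $ J \<noteq> 0} = {J. trop_to_Zbar p $ J \<noteq> 0}" by simp
qed (simp add: regular_subdivision_eq_blade_subdivision[OF n] p)

subsection \<open>Triangulations and the fan\<close>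

lemma weakly_separated_sym: "weakly_separated I J \<Longrightarrow> weakly_separated J I"
  unfolding weakly_separated_def cyclically_ordered_def by blast

lemma weakly_separated_refl: "weakly_separated I I"
  unfolding weakly_separated_def by blast

lemma frozen_sets_cases:
  fixes I :: "'n::{finite,linorder} set"
  assumes n: "CARD('n) > 2" and I: "I \<in> frozen_sets"
  obtains i j where "i < j" "I = {i, j}" "\<not> (\<exists>x. i < x \<and> x < j)"
    | "I = {Min UNIV, Max UNIV}"
proof -
  obtain i j where ij: "i < j" "I = {i, j}" using I two_setsE unfolding frozen_sets_def by blast
  then have "j = csuc i \<or> i = csuc j" using I frozen_sets_doubleton[OF n, of i j] by auto
  then show ?thesis
  proof
    assume "j = csuc i"
    then have "\<not> (\<exists>x. i < x \<and> x < j)" using csuc_not_max(2)[OF ij(1)] by (auto simp: not_less)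
    then show ?thesis using that(1) ij by blast
  next
    assume ic: "i = csuc j"
    have mx: "x \<le> j" for x
    proof (rule ccontr)
      assume "\<not> x \<le> j"
      then have "j < csuc j" using csuc_not_max(1)[of j x] by simp
      then show False using ic ij(1) by simp
    qed
    have "i \<le> x" for x using csuc_max[of j x] mx ic by simp
    then have "i = Min UNIV" "j = Max UNIV" using mx by (auto intro!: Min_eqI[symmetric] Max_eqI[symmetric])
    then show ?thesis using that(2) ij(2) by blast
  qed
qed

lemma frozen_weakly_separated:
  fixes I J :: "'n::{finite,linorder} set"
  assumes n: "CARD('n) > 2" and I: "I \<in> frozen_sets" and J: "J \<in> two_sets"
  shows "weakly_separated I J"
proof -
  obtain k l where kl: "k < l" "J = {k, l}" using two_setsE[OF J] .
  from n I show ?thesis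
  proof (cases rule: frozen_sets_cases)
    case (1 i j)
    then show ?thesis using kl weakly_separated_doubletons[OF 1(1) kl(1)] by auto
  next
    case 2
    have b: "Min UNIV \<le> x" "x \<le> Max UNIV" for x :: 'n by auto
    have "Min UNIV < (Max UNIV :: 'n)" using kl(1) b by (meson le_less_trans less_le_trans)
    from weakly_separated_doubletons[OF this kl(1)] show ?thesis
      unfolding 2 kl(2) using b by (simp add: not_less) (meson b leD)
  qed
qed

text \<open>\<open>{Min UNIV, Max UNIV}\<close> is frozen but long once a third element exists; it
  causes the shift by one in the final count.\<close>

definition long_set :: "'n::{finite,linorder} set \<Rightarrow> bool" where
  "long_set J \<longleftrightarrow> (\<exists>x. Min J < x \<and> x < Max J)"

lemma long_set_doubleton: "i < j \<Longrightarrow> long_set {i, j} \<longleftrightarrow> (\<exists>x. i < x \<and> x < j)"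
  by (auto simp: long_set_def min_def max_def)

text \<open>
  Triangulation count: the chord \<open>{a, b}\<close> borders a triangle \<open>{a, c, b}\<close> on its inner side, with
  \<open>c\<close> the last vertex before \<open>b\<close> joined to \<open>a\<close>, and all other chords inside \<open>[a, b]\<close> lie in
  \<open>[a, c]\<close> or \<open>[c, b]\<close>.
\<close>
lemma card_long_sets_in_interval:
  fixes U :: "'n::{finite,linorder} set set"
  assumes U: "w_collection U"
    and max: "\<And>J. J \<in> two_sets \<Longrightarrow> (\<And>K. K \<in> U \<Longrightarrow> weakly_separated J K) \<Longrightarrow> J \<in> U"
    and ab: "a < b" "{a, b} \<in> U"
  shows "card {J \<in> U. J \<subseteq> {a..b} \<and> long_set J} = card {a<..<b}"
  using ab
proof (induction "card {a<..<b}" arbitrary: a b rule: less_induct)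
  case less
  have U2: "U \<subseteq> two_sets" using U by (simp add: w_collection_def)
  have cross: False if "i < k" "k < j" "j < l" "{i, j} \<in> U" "{k, l} \<in> U" for i j k l
  proof -
    have "i < j" "k < l" using that by auto
    then show False using U that weakly_separated_doubletons[of i j k l] by (auto simp: w_collection_def)
  qed
  show ?case
  proof (cases "{a<..<b} = {}")
    case True
    have "J \<notin> U \<or> \<not> J \<subseteq> {a..b} \<or> \<not> long_set J" for J
    proof (rule ccontr)
      assume *: "\<not> ?thesis"
      then obtain i j where ij: "i < j" "J = {i, j}" using U2 two_setsE by blast
      then obtain x where "i < x" "x < j" "a \<le> i" "j \<le> b" using * long_set_doubleton by auto
      then have "x \<in> {a<..<b}" by auto
      then show False using True by blast
    qed
    then have "{J \<in> U. J \<subseteq> {a..b} \<and> long_set J} = {}" by blast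
    then show ?thesis unfolding True by simp
  next
    case False
    then obtain x where x: "a < x" "x < b" by auto
    define S where "S = {c. a < c \<and> c < b \<and> {a, c} \<in> U}"
    have sa: "a < csuc a" "csuc a < b" "\<And>y. y < csuc a \<longleftrightarrow> y \<le> a"
      using csuc_not_max[OF x(1)] le_less_trans[OF _ x(2), of "csuc a"] x(1) by auto
    \<comment> \<open>Nothing lies between \<open>a\<close> and \<open>csuc a\<close>, so no chord
      crosses this edge and maximality puts it in \<open>U\<close>. Hence \<open>S\<close> is
      nonempty.\<close>
    have "{a, csuc a} \<in> U"
    proof (rule max)
      fix K assume K: "K \<in> U"
      obtain k l where kl: "k < l" "K = {k, l}" using K U2 two_setsE by blast
      show "weakly_separated {a, csuc a} K"
        unfolding kl(2) weakly_separated_doubletons[OF sa(1) kl(1)] sa(3) by auto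
    qed (use sa(1) in auto)
    then have Sne: "S \<noteq> {}" using sa(1,2) by (auto simp: S_def)
    define c where "c = Max S"
    have c: "a < c" "c < b" "{a, c} \<in> U" using Max_in[OF _ Sne] by (auto simp: c_def S_def)
    have cmax: "d \<le> c" if "a < d" "d < b" "{a, d} \<in> U" for d using that by (auto simp: c_def S_def)
    \<comment> \<open>A chord crossing \<open>{c, b}\<close> would cross \<open>{a, b}\<close> or
      \<open>{a, c}\<close>, or join \<open>a\<close> to a vertex strictly between \<open>c\<close>
      and \<open>b\<close>, against the choice of \<open>c\<close>.\<close>
    have cb: "{c, b} \<in> U"
    proof (rule max)
      fix K assume K: "K \<in> U"
      obtain k l where kl: "k < l" "K = {k, l}" using K U2 two_setsE by blast
      show "weakly_separated {c, b} K"
        unfolding kl(2) weakly_separated_doubletons[OF c(2) kl(1)]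
      proof (intro conjI notI; elim conjE)
        assume "c < k" "k < b" "b < l"
        then show False using cross[of a k b l] less_trans[of a c k] less.prems K kl c by auto
      next
        assume kcl: "k < c" "c < l" "l < b"
        consider "k < a" | "k = a" | "a < k" by force
        then show False
        proof cases
          case 1 then show False using cross[of k a l b] less_trans[of a c l] less.prems K kl kcl c by auto
        next
          case 2 then show False using cmax[of l] less_trans[of a c l] K kl kcl c by auto
        next
          case 3 then show False using cross[of a k c l] K kl kcl c by auto
        qed
      qed
    qed (use c in auto)
    let ?L = "\<lambda>a b. {J \<in> U. J \<subseteq> {a..b} \<and> long_set J}"
    have dec: "?L a b = insert {a, b} (?L a c \<union> ?L c b)"
    proof
      show "insert {a, b} (?L a c \<union> ?L c b) \<subseteq> ?L a b"
      proof -
        have "{a..c} \<subseteq> {a..b}" "{c..b} \<subseteq> {a..b}" using c by auto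
        moreover have "{a, b} \<in> ?L a b" using less.prems x by (auto simp: long_set_doubleton)
        ultimately show ?thesis by blast
      qed
      show "?L a b \<subseteq> insert {a, b} (?L a c \<union> ?L c b)"
      proof
        fix J assume J: "J \<in> ?L a b"
        then obtain i j where ij: "i < j" "J = {i, j}" using U2 two_setsE by blast
        have ij': "a \<le> i" "j \<le> b" using J ij by auto
        consider "j \<le> c" | "c \<le> i" | "i < c" "c < j" by force
        then show "J \<in> insert {a, b} (?L a c \<union> ?L c b)"
        proof cases
          case 1 then show ?thesis using J ij ij' by auto
        next
          case 2 then show ?thesis using J ij ij' by auto
        next
          case 3
          have "i = a" using cross[of a i c j] J ij ij' 3 c by (cases "a < i") auto
          moreover have "j = b" using cmax[of j] J ij ij' 3 c \<open>i = a\<close> by (cases "j < b") auto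
          ultimately show ?thesis using ij by simp
        qed
      qed
    qed
    have "card {a<..<c} < card {a<..<b}" "card {c<..<b} < card {a<..<b}"
      using c by (auto intro!: psubset_card_mono)
    then have IH: "card (?L a c) = card {a<..<c}" "card (?L c b) = card {c<..<b}"
      using less.hyps c cb by blast+
    have disj: "?L a c \<inter> ?L c b = {}"
    proof (rule ccontr)
      assume "?L a c \<inter> ?L c b \<noteq> {}"
      then obtain J where J: "J \<in> U" "J \<subseteq> {a..c}" "J \<subseteq> {c..b}" by blast
      obtain i j where "i < j" "J = {i, j}" using J(1) U2 two_setsE by blast
      then show False using J by auto
    qed
    have "{a, b} \<notin> ?L a c \<union> ?L c b" using c by auto
    \<comment> \<open>The chord \<open>{a, b}\<close> itself is the extra one; it is matched with
      the apex \<open>c\<close>.\<close>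
    then have "card (?L a b) = Suc (card {a<..<c} + card {c<..<b})"
      unfolding dec using IH disj by (simp add: card_Un_disjoint)
    also have "\<dots> = card (insert c ({a<..<c} \<union> {c<..<b}))"
    proof -
      have "{a<..<c} \<inter> {c<..<b} = {}" by auto
      then show ?thesis by (simp add: card_Un_disjoint)
    qed
    also have "insert c ({a<..<c} \<union> {c<..<b}) = {a<..<b}" using c by auto
    finally show ?thesis .
  qed
qed

text \<open>The edge \<open>{mn, mx}\<close> has all other \<open>CARD('n) - 2\<close> vertices on
  its inner side, so there are as many long chords. It is the only frozen one among them, and the
  others form \<open>W\<close>.\<close>

lemma card_maximal_nonfrozen:
  fixes W :: "'n::{finite,linorder} set set"
  assumes n: "CARD('n) > 2" and W: "w_collection W" "W \<subseteq> nonfrozen_sets"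
    and max: "\<And>J. J \<in> nonfrozen_sets \<Longrightarrow> (\<And>K. K \<in> W \<Longrightarrow> weakly_separated J K) \<Longrightarrow> J \<in> W"
  shows "maximal_w_collection (W \<union> frozen_sets)" "card W = CARD('n) - 3"
proof -
  let ?U = "W \<union> frozen_sets"
  have U2: "?U \<subseteq> two_sets" using W by (auto simp: nonfrozen_sets_def frozen_sets_def)
  have U: "w_collection ?U"
    unfolding w_collection_def
  proof (intro conjI U2 ballI)
    fix I J assume "I \<in> ?U" "J \<in> ?U"
    then show "weakly_separated I J"
      using W(1) U2 frozen_weakly_separated[OF n] weakly_separated_sym unfolding w_collection_def by blast
  qed
  have Umax: "J \<in> ?U" if "J \<in> two_sets" "\<And>K. K \<in> ?U \<Longrightarrow> weakly_separated J K" for J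
    using max[of J] that by (auto simp: nonfrozen_sets_def)
  show "maximal_w_collection ?U"
    unfolding maximal_w_collection_def
  proof (intro conjI U allI impI)
    fix W' assume W': "w_collection W' \<and> ?U \<subseteq> W'"
    have "J \<in> ?U" if "J \<in> W'" for J
      using Umax[of J] W' that unfolding w_collection_def by blast
    then show "W' = ?U" using W' by blast
  qed
  define mn :: 'n where "mn = Min UNIV"
  define mx :: 'n where "mx = Max UNIV"
  have b: "mn \<le> x" "x \<le> mx" for x by (auto simp: mn_def mx_def)
  have lt: "mn < mx"
  proof (rule ccontr)
    assume "\<not> mn < mx"
    then have "x = mn" for x using b by (meson antisym not_less order_trans)
    then have "(UNIV :: 'n set) = {mn}" by blast
    then have "CARD('n) = card {mn}" by simp
    then show False using n by simp
  qed
  have "csuc mx = mn" using csuc_max[of mx mn] b by (auto intro: antisym)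
  then have fr: "{mn, mx} \<in> frozen_sets" using frozen_sets_doubleton[OF n, of mn mx] lt by simp
  have UN: "(UNIV :: 'n set) = insert mn (insert mx {mn<..<mx})" using b by (auto simp: less_le)
  have "CARD('n) = card (insert mn (insert mx {mn<..<mx}))" by (rule arg_cong[OF UN])
  also have "\<dots> = Suc (Suc (card {mn<..<mx}))" using lt by simp
  finally have card_inner: "card {mn<..<mx} = CARD('n) - 2" by simp
  then have "{mn<..<mx} \<noteq> {}" using n by auto
  then have longmm: "long_set {mn, mx}" using lt by (auto simp: long_set_doubleton)
  have eq: "{J \<in> ?U. J \<subseteq> {mn..mx} \<and> long_set J} = insert {mn, mx} W"
  proof (intro set_eqI iffI)
    fix J assume J: "J \<in> {J \<in> ?U. J \<subseteq> {mn..mx} \<and> long_set J}"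
    show "J \<in> insert {mn, mx} W"
    proof (cases "J \<in> W")
      case False
      then have "J \<in> frozen_sets" using J by blast
      with n show ?thesis
      proof (cases rule: frozen_sets_cases)
        case (1 i j)
        then show ?thesis using J long_set_doubleton[of i j] by auto
      next
        case 2
        then show ?thesis by (simp add: mn_def mx_def)
      qed
    qed simp
  next
    fix J assume J: "J \<in> insert {mn, mx} W"
    have "long_set J"
    proof (cases "J = {mn, mx}")
      case True then show ?thesis using longmm by simp
    next
      case False
      then have Jn: "J \<in> nonfrozen_sets" using J W(2) by blast
      obtain i j where ij: "i < j" "J = {i, j}" using nonfrozen_setsE[OF Jn] .
      have "i < csuc i" "csuc i \<le> j" "csuc i \<noteq> j"
        using csuc_not_max(1,3)[OF ij(1)] ij(1) Jn nonfrozen_sets_doubleton[OF n, of i j] ij(2) by auto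
      then show ?thesis using ij long_set_doubleton[of i j] by (auto simp: less_le)
    qed
    then show "J \<in> {J \<in> ?U. J \<subseteq> {mn..mx} \<and> long_set J}" using J fr b by auto
  qed
  have "card {J \<in> ?U. J \<subseteq> {mn..mx} \<and> long_set J} = card {mn<..<mx}"
    by (rule card_long_sets_in_interval[OF U Umax lt]) (use fr in auto)
  moreover have "{mn, mx} \<notin> W" using fr W(2) by (auto simp: nonfrozen_sets_def)
  ultimately have "Suc (card W) = CARD('n) - 2" unfolding eq card_inner by simp
  then show "card W = CARD('n) - 3" by simp
qed

section \<open>Coordinate cones and the transported fan\<close>

lemma P_cone_iff: "c \<in> P_cone W \<longleftrightarrow> (\<forall>J. 0 \<le> c $ J) \<and> (\<forall>J. J \<notin> W \<longrightarrow> c $ J = 0)"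
proof
  assume "c \<in> P_cone W"
  then obtain d where d: "c = (\<Sum>J\<in>W. d J *\<^sub>R beta J)" "\<forall>J\<in>W. 0 \<le> d J" unfolding P_cone_def by blast
  have "c $ K = (if K \<in> W then d K else 0)" for K
    by (simp add: d(1) beta_def axis_def if_distrib cong: if_cong)
  then show "(\<forall>J. 0 \<le> c $ J) \<and> (\<forall>J. J \<notin> W \<longrightarrow> c $ J = 0)" using d(2) by simp
next
  assume c: "(\<forall>J. 0 \<le> c $ J) \<and> (\<forall>J. J \<notin> W \<longrightarrow> c $ J = 0)"
  then have "c = (\<Sum>J\<in>W. c $ J *\<^sub>R beta J)"
    by (auto simp: vec_eq_iff beta_def axis_def if_distrib cong: if_cong)
  then show "c \<in> P_cone W" unfolding P_cone_def using c by blast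
qed

lemma P_cone_mono: "W \<subseteq> W' \<Longrightarrow> P_cone W \<subseteq> P_cone W'"
  unfolding subset_iff P_cone_iff by blast

lemma beta_in_P_cone_iff: "beta J \<in> P_cone W \<longleftrightarrow> J \<in> W"
  by (auto simp: P_cone_iff beta_def axis_def)

lemma independent_beta: "independent (beta ` W)"
proof (rule independent_mono[OF independent_Basis])
  show "beta ` W \<subseteq> Basis" by (auto simp: beta_def)
qed

lemma dim_P_cone: "dim (P_cone W) = card W"
proof (rule dim_unique[of "beta ` W"])
  show "beta ` W \<subseteq> P_cone W" using beta_in_P_cone_iff by blast
  show "P_cone W \<subseteq> span (beta ` W)" by (auto simp: P_cone_iff span_beta_iff)
  show "card (beta ` W) = card W" by (intro card_image) (auto simp: inj_on_def beta_def axis_eq_axis)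
qed (rule independent_beta)

lemma simplicial_P_cone: "simplicial_cone (P_cone W)"
  unfolding simplicial_cone_def
proof (intro exI conjI)
  show "P_cone W = convex_cone hull (beta ` W)"
  proof
    show "convex_cone hull (beta ` W) \<subseteq> P_cone W"
    proof (rule hull_minimal)
      show "convex_cone (P_cone W)" unfolding convex_cone_iff by (auto simp: P_cone_iff)
    qed (use beta_in_P_cone_iff in blast)
    have "(\<Sum>J\<in>A. d J *\<^sub>R beta J) \<in> convex_cone hull (beta ` W)"
      if "finite A" "A \<subseteq> W" "\<forall>J\<in>W. 0 \<le> d J" for A and d :: "'a set \<Rightarrow> real"
      using that
    proof (induction A)
      case empty
      then show ?case by (simp add: convex_cone_hull_contains_0)
    next
      case (insert x A)
      have "beta x \<in> convex_cone hull (beta ` W)" using insert.prems by (intro hull_inc) auto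
      then have "d x *\<^sub>R beta x \<in> convex_cone hull (beta ` W)"
        using insert.prems by (intro convex_cone_hull_mul) auto
      then show ?case using insert by (simp add: convex_cone_hull_add)
    qed
    then show "P_cone W \<subseteq> convex_cone hull (beta ` W)" unfolding P_cone_def by auto
  qed
qed (auto simp: independent_beta)

lemma closed_trop_pos: "closed (trop_pos :: (real^('n::{finite,linorder} set)) set)"
proof -
  have "trop_pos = (\<Inter>I\<in>-two_sets. {p :: real^('n set). p $ I = 0}) \<inter>
     (\<Inter>(a, b, c, d)\<in>{(a, b, c, d). a < b \<and> b < c \<and> c < d}.
        {p. p $ {a,c} + p $ {b,d} = min (p $ {a,b} + p $ {c,d}) (p $ {b,c} + p $ {a,d})})"
    by (auto simp: trop_pos_def)
  also have "closed \<dots>"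
    by (intro closed_Int closed_INT ballI)
      (auto intro!: closed_Collect_eq continuous_intros split: prod.splits)
  finally show ?thesis .
qed

lemma height_in_trop_pos:
  fixes c :: "real^('n::{finite,linorder} set)"
  assumes n: "CARD('n) > 2" and W: "w_collection W" "W \<subseteq> nonfrozen_sets" and c: "c \<in> P_cone W"
  shows "height c \<in> trop_pos" "trop_to_Zbar (height c) = c"
proof -
  have c': "\<And>J. 0 \<le> c $ J" "\<And>J. J \<notin> W \<Longrightarrow> c $ J = 0" using c by (auto simp: P_cone_iff)
  show T: "trop_to_Zbar (height c) = c"
    unfolding trop_to_Zbar_height[OF n] using c'(2) W(2) by (auto simp: vec_eq_iff mod_frozen_nth)
  have "w_collection {J. c $ J \<noteq> 0}"
    using W(1) c'(2) unfolding w_collection_def by blast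
  then show "height c \<in> trop_pos"
    unfolding trop_pos_iff[OF n] T using c'(1) by (simp add: height_def)
qed

lemma height_add_scaleR: "height (c + t *\<^sub>R d) = height c + t *\<^sub>R height d"
  by (auto simp: vec_eq_iff height_def algebra_simps sum.distrib sum_distrib_left
      simp del: sum_mult_of_bool_eq)

text \<open>Vanishing off \<open>W\<close> is a closed condition, which bounds the image from above.
  For the other inclusion a point of the cone is approached by points of full support
  \<open>W\<close>, and their lifts under \<open>height\<close> converge as heights.\<close>

lemma trop_to_Zbar_closure_class:
  fixes W :: "'n::{finite,linorder} set set"
  assumes n: "CARD('n) > 2" and W: "w_collection W" "W \<subseteq> nonfrozen_sets"
  shows "trop_to_Zbar ` closure {p \<in> trop_pos. {J. trop_to_Zbar p $ J \<noteq> 0} = W} = P_cone W"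
    (is "trop_to_Zbar ` closure ?K = _")
proof
  let ?T = "{p \<in> trop_pos. \<forall>J. J \<notin> W \<longrightarrow> trop_to_Zbar p $ J = 0}"
  have "continuous_on UNIV (trop_to_Zbar :: real^('n set) \<Rightarrow> _)"
    using linear_continuous_on linear_conv_bounded_linear linear_trop_to_Zbar by blast
  then have cont: "continuous_on UNIV (\<lambda>p :: real^('n set). trop_to_Zbar p $ J)" for J
    by (intro continuous_on_component)
  have "?T = trop_pos \<inter> (\<Inter>J\<in>-W. {p. trop_to_Zbar p $ J = 0})" by auto
  also have "closed \<dots>"
    by (intro closed_Int closed_trop_pos closed_INT ballI closed_Collect_eq cont continuous_on_const)
  finally have "closure ?K \<subseteq> ?T" by (intro closure_minimal) auto
  then show "trop_to_Zbar ` closure ?K \<subseteq> P_cone W"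
    using trop_to_Zbar_nonneg[OF n] by (auto simp: P_cone_iff)
  show "P_cone W \<subseteq> trop_to_Zbar ` closure ?K"
  proof
    fix c assume c: "c \<in> P_cone W"
    define d :: "real^('n set)" where "d = (\<chi> J. of_bool (J \<in> W))"
    \<comment> \<open>A small multiple of the indicator of \<open>W\<close> makes the support
      exactly \<open>W\<close>, even when \<open>c\<close> is on the boundary of the cone.\<close>
    define q where "q k = c + inverse (real (Suc k)) *\<^sub>R d" for k
    have qP: "q k \<in> P_cone W" for k using c by (auto simp: q_def d_def P_cone_iff)
    have supp: "{J. q k $ J \<noteq> 0} = W" for k
    proof (intro set_eqI iffI; unfold mem_Collect_eq)
      fix J assume "q k $ J \<noteq> 0"
      then show "J \<in> W" using qP[of k] by (auto simp: P_cone_iff)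
    next
      fix J assume "J \<in> W"
      moreover have "0 \<le> c $ J" using c by (simp add: P_cone_iff)
      ultimately have "0 < q k $ J" by (simp add: q_def d_def add_nonneg_pos)
      then show "q k $ J \<noteq> 0" by simp
    qed
    have "height (q k) \<in> ?K" for k using height_in_trop_pos[OF n W qP[of k]] supp[of k] by simp
    moreover have "(\<lambda>k. height (q k)) \<longlonglongrightarrow> height c"
    proof -
      have "(\<lambda>k. height c + inverse (real (Suc k)) *\<^sub>R height d) \<longlonglongrightarrow> height c + 0 *\<^sub>R height d"
        by (intro tendsto_intros LIMSEQ_inverse_real_of_nat)
      then show ?thesis unfolding q_def height_add_scaleR by simp
    qed
    ultimately have "height c \<in> closure ?K"
      unfolding closure_sequential by (intro exI[of _ "\<lambda>k. height (q k)"] conjI allI)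
    with height_in_trop_pos(2)[OF n W c, symmetric] show "c \<in> trop_to_Zbar ` closure ?K"
      by (rule image_eqI)
  qed
qed

theorem Zbar_fan_eq:
  assumes n: "CARD('n::{finite,linorder}) > 2"
  shows "Zbar_fan = P_cone ` {W :: 'n set set. w_collection W \<and> W \<subseteq> nonfrozen_sets}"
proof -
  have cone: "trop_to_Zbar ` closure {p' \<in> trop_pos. regular_subdivision p' = regular_subdivision p} =
      P_cone {J. trop_to_Zbar p $ J \<noteq> 0}" if p: "p \<in> trop_pos" for p :: "real^('n set)"
  proof -
    have "{p' \<in> trop_pos. regular_subdivision p' = regular_subdivision p} =
      {p' \<in> trop_pos. {J. trop_to_Zbar p' $ J \<noteq> 0} = {J. trop_to_Zbar p $ J \<noteq> 0}}"
      using regular_subdivision_eq_iff_support_eq[OF n p] by blast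
    moreover have "w_collection {J. trop_to_Zbar p $ J \<noteq> 0}"
      using iffD1[OF trop_pos_iff[OF n] p] by blast
    moreover have "{J. trop_to_Zbar p $ J \<noteq> 0} \<subseteq> nonfrozen_sets" using trop_to_Zbar_nth_0 by blast
    ultimately show ?thesis using trop_to_Zbar_closure_class[OF n] by simp
  qed
  have supp: "(\<lambda>p. {J. trop_to_Zbar p $ J \<noteq> 0}) ` trop_pos =
     {W :: 'n set set. w_collection W \<and> W \<subseteq> nonfrozen_sets}"
  proof
    show "(\<lambda>p. {J. trop_to_Zbar p $ J \<noteq> 0}) ` trop_pos \<subseteq> {W :: 'n set set. w_collection W \<and> W \<subseteq> nonfrozen_sets}"
      using trop_pos_iff[OF n] trop_to_Zbar_nth_0 by blast
    show "{W :: 'n set set. w_collection W \<and> W \<subseteq> nonfrozen_sets} \<subseteq> (\<lambda>p. {J. trop_to_Zbar p $ J \<noteq> 0}) ` trop_pos"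
    proof
      fix W :: "'n set set" assume "W \<in> {W. w_collection W \<and> W \<subseteq> nonfrozen_sets}"
      then have W: "w_collection W" "W \<subseteq> nonfrozen_sets" by auto
      define d :: "real^('n set)" where "d = (\<chi> J. of_bool (J \<in> W))"
      have d: "d \<in> P_cone W" by (auto simp: P_cone_iff d_def)
      have "W = {J. trop_to_Zbar (height d) $ J \<noteq> 0}"
        unfolding height_in_trop_pos(2)[OF n W d] by (auto simp: d_def)
      then show "W \<in> (\<lambda>p. {J. trop_to_Zbar p $ J \<noteq> 0}) ` trop_pos"
        using height_in_trop_pos(1)[OF n W d] by (rule image_eqI)
    qed
  qed
  have "Zbar_fan = (\<lambda>p. P_cone {J. trop_to_Zbar p $ J \<noteq> 0}) ` (trop_pos :: (real^('n set)) set)"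
    unfolding Zbar_fan_def trop_fan_def image_image using cone by (intro image_cong refl)
  also have "\<dots> = P_cone ` {W :: 'n set set. w_collection W \<and> W \<subseteq> nonfrozen_sets}"
    unfolding supp[symmetric] image_image ..
  finally show ?thesis .
qed

text \<open>Frozen coefficients in \<open>Z_set\<close> may have any sign, but deleting them keeps
  the support weakly separated. Conversely, a point of a cone is its own representative and already
  lies in \<open>Z_set\<close>.\<close>

lemma Union_Zbar_fan:
  assumes n: "CARD('n::{finite,linorder}) > 2"
  shows "\<Union>Zbar_fan = (Zbar_set :: (real^('n set)) set)"
proof (intro set_eqI iffI)
  fix c :: "real^('n set)"
  assume "c \<in> \<Union>Zbar_fan"
  then obtain W where W: "w_collection W" "W \<subseteq> nonfrozen_sets" "c \<in> P_cone W"
    unfolding Zbar_fan_eq[OF n] by blast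
  have c: "\<And>J. 0 \<le> c $ J" "\<And>J. J \<notin> W \<Longrightarrow> c $ J = 0" using W(3) by (auto simp: P_cone_iff)
  have "w_collection {J. c $ J \<noteq> 0}" using W(1) c(2) unfolding w_collection_def by blast
  then have "positroid_subdivision (blade_subdivision {J. c $ J \<noteq> 0})"
    by (rule positroid_subdivision_blade_subdivision)
  moreover have "c \<in> blade_space"
    unfolding blade_space_def span_beta_iff using c(2) W(2) by (auto simp: nonfrozen_sets_def)
  ultimately have "c \<in> Z_set" using c(1) by (simp add: Z_set_def)
  moreover have "c = mod_frozen c" using c(2) W(2) by (auto simp: vec_eq_iff mod_frozen_nth)
  ultimately show "c \<in> Zbar_set" unfolding Zbar_set_def by blast
next
  fix c :: "real^('n set)"
  assume "c \<in> Zbar_set"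
  then obtain z where z: "c = mod_frozen z" "z \<in> Z_set" unfolding Zbar_set_def by blast
  then have z': "\<And>J. J \<notin> two_sets \<Longrightarrow> z $ J = 0" "positroid_subdivision (blade_subdivision {J. z $ J \<noteq> 0})"
    "\<And>J. J \<in> nonfrozen_sets \<Longrightarrow> 0 \<le> z $ J"
    by (auto simp: Z_set_def blade_space_def span_beta_iff)
  have "w_collection {J. z $ J \<noteq> 0}"
    using z'(1) by (intro weakly_separated_if_positroid_subdivision z'(2)) auto
  then have "w_collection {J \<in> nonfrozen_sets. z $ J \<noteq> 0}" unfolding w_collection_def by blast
  moreover have "c \<in> P_cone {J \<in> nonfrozen_sets. z $ J \<noteq> 0}"
    using z'(3) by (auto simp: z(1) P_cone_iff mod_frozen_nth)
  ultimately show "c \<in> \<Union>Zbar_fan" unfolding Zbar_fan_eq[OF n] by blast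
qed

theorem proposition2p37:
  assumes "CARD('n::{finite,linorder}) > 2"
  shows "\<Union>Zbar_fan = (Zbar_set :: (real^('n set)) set) \<and>
    (\<forall>C \<in> maximal_cones (Zbar_fan :: (real^('n set)) set set).
       simplicial_cone C \<and> dim C = CARD('n) - 3 \<and>
       (\<exists>W. nonfrozen_maximal_w_collection W \<and> C = P_cone W))"
proof (intro conjI ballI Union_Zbar_fan[OF assms])
  fix C :: "(real^('n set)) set"
  assume "C \<in> maximal_cones Zbar_fan"
  then have C: "C \<in> Zbar_fan" and Cmax: "\<And>D. D \<in> Zbar_fan \<Longrightarrow> C \<subseteq> D \<Longrightarrow> D = C"
    by (auto simp: maximal_cones_def)
  obtain W where W: "w_collection W" "W \<subseteq> nonfrozen_sets" "C = P_cone W"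
    using C unfolding Zbar_fan_eq[OF assms] by blast
  \<comment> \<open>A further compatible chord would enlarge the cone strictly, because
    \<open>beta J\<close> lies in \<open>P_cone W\<close> only for \<open>J\<close> in
    \<open>W\<close>.\<close>
  have max: "J \<in> W" if J: "J \<in> nonfrozen_sets" and ws: "\<And>K. K \<in> W \<Longrightarrow> weakly_separated J K" for J
  proof -
    have "w_collection (insert J W)"
      using W(1) J ws weakly_separated_sym weakly_separated_refl
      unfolding w_collection_def nonfrozen_sets_def by blast
    then have "P_cone (insert J W) \<in> Zbar_fan" using J W(2) unfolding Zbar_fan_eq[OF assms] by blast
    then have "P_cone (insert J W) = P_cone W" using Cmax W(3) P_cone_mono by blast
    then show ?thesis using beta_in_P_cone_iff[of J] by blast
  qed
  note card_W = card_maximal_nonfrozen[OF assms W(1,2) max]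
  show "simplicial_cone C" "dim C = CARD('n) - 3"
    unfolding W(3) dim_P_cone using simplicial_P_cone card_W(2) by auto
  have "W = (W \<union> frozen_sets) \<inter> nonfrozen_sets" using W(2) by (auto simp: nonfrozen_sets_def)
  then show "\<exists>W. nonfrozen_maximal_w_collection W \<and> C = P_cone W"
    using card_W(1) W(3) unfolding nonfrozen_maximal_w_collection_def by blast
qed

end
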